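(* Let $\{A^n\}_{n\in\mathbb{N}}$ be a sequence of nonempty compact subsets of $\mathbb{R}^d$ converging with respect to the Hausdorff metric to a nonempty compact set $A\subseteq\mathbb{R}^d$, and let $r\in(0,\infty)\setminus C(A)$. Then $r\notin C(A^n)$ for all sufficiently large $n$, and for every $i=0,\dots,d-1$ the curvature measures $C_i(A^n_r;\cdot)$ converge weakly to $C_i(A_r;\cdot)$ as $n\to\infty$. Here $A_r$ and $A^n_r$ denote the closed $r$-parallel neighborhoods of $A$ and $A^n$.
   Context: For nonempty closed $A\subseteq\mathbb{R}^d$: $\Delta_A(x)=\min\{|x-a|:a\in A\}$, $\Sigma_A(x)=\{a\in A:|x-a|=\Delta_A(x)\}$, and $A_r=\{x:\Delta_A(x)\le r\}$. For compact $A$, a point $x\in\mathbb{R}^d$ is critical for $\Delta_A$ if $x$ lies in the closed convex hull of $\Sigma_A(x)$; $C(A)\subseteq(0,\infty)$ is the set of critical values, i.e. of all $r>0$ such that $\Delta_A(x)=r$ for some critical point $x$ of $\Delta_A$. $\operatorname{reach}D=\sup\{\rho\ge 0:\forall x\in\mathbb{R}^d,\ \Delta_D(x)<\rho\Rightarrow \operatorname{card}\Sigma_D(x)=1\}$ for a closed set $D$. Curvature measures of a closed set $D$ with $\operatorname{reach}D>0$: let $\xi_D(x)$ be the unique nearest point of $D$ to $x$ when $\Delta_D(x)<\operatorname{reach}D$, let $V_d$ be Lebesgue measure and $\omega_i$ the volume of the unit $i$-ball. The signed Radon measures $C_0(D;\cdot),\dots,C_{d-1}(D;\cdot)$ are determined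 by the local Steiner formula $V_d((D_\rho\setminus D)\cap\xi_D^{-1}(F))=\sum_{i=1}^d\omega_i\rho^iC_{d-i}(D;F)$ for $0\le\rho<\operatorname{reach}D$ and bounded Borel $F$. Curvature measures of parallel sets: if $r>0$ is not a critical value of $\Delta_A$, then $A_r$ is a full-dimensional Lipschitz manifold and $\overline{\mathbb{R}^d\setminus A_r}$ has positive reach, and one defines $C_i(A_r;F)=(-1)^{d-i-1}C_i(\overline{\mathbb{R}^d\setminus A_r};F)$, $i=0,\dots,d-1$. These are finite signed measures concentrated on the compact set $\partial A_r$. Weak convergence of finite signed measures $\mu_n\to\mu$ means $\int f\,d\mu_n\to\int f\,d\mu$ for all bounded continuous $f:\mathbb{R}^d\to\mathbb{R}$. *)

theory Defs
  imports "HOL-Analysis.Analysis"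
begin

text \<open>The ambient space is an arbitrary Euclidean space of dimension \<open>d = DIM('a)\<close>.
  The distance function of a nonempty closed set \<open>A\<close> is the library's \<open>\<lambda>x. infdist x A\<close>;
  the infimum is attained, so it is the minimum.\<close>

definition nearest_points :: "'a::euclidean_space set \<Rightarrow> 'a \<Rightarrow> 'a set" where
  "nearest_points A x = {a \<in> A. dist x a = infdist x A}"

definition parallel_set :: "'a::euclidean_space set \<Rightarrow> real \<Rightarrow> 'a set" where
  "parallel_set A r = {x. infdist x A \<le> r}"

definition critical_point :: "'a::euclidean_space set \<Rightarrow> 'a \<Rightarrow> bool" where
  "critical_point A x \<longleftrightarrow> x \<in> closure (convex hull (nearest_points A x))"

definition critical_values :: "'a::euclidean_space set \<Rightarrow> real set" where
  "critical_values A = {r. 0 < r \<and> (\<exists>x. critical_point A x \<and> infdist x A = r)}"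

definition hausdorff_dist :: "'a::euclidean_space set \<Rightarrow> 'a set \<Rightarrow> real" where
  "hausdorff_dist A B = max (SUP a\<in>A. infdist a B) (SUP b\<in>B. infdist b A)"

definition reach :: "'a::euclidean_space set \<Rightarrow> ereal" where
  "reach D = Sup {ereal \<rho> |\<rho>. 0 \<le> \<rho> \<and> (\<forall>x. infdist x D < \<rho> \<longrightarrow> card (nearest_points D x) = 1)}"

text \<open>Signed measures are real-valued set functions. A signed Radon measure need only be
  defined on the bounded Borel sets, where it is countably additive; a finite signed measure is
  countably additive on all Borel sets. In both cases the empty set has measure \<open>0\<close>, since
  the constant sequence with value \<open>\<mu> {}\<close> is summable.\<close>

definition signed_radon_measure :: "('a::euclidean_space set \<Rightarrow> real) \<Rightarrow> bool" where
  "signed_radon_measure \<mu> \<longleftrightarrow>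
     (\<forall>F::nat \<Rightarrow> 'a set. range F \<subseteq> sets borel \<longrightarrow> disjoint_family F \<longrightarrow> bounded (\<Union>n. F n) \<longrightarrow>
        (\<lambda>n. \<mu> (F n)) sums \<mu> (\<Union>n. F n))"

definition finite_signed_measure :: "('a::euclidean_space set \<Rightarrow> real) \<Rightarrow> bool" where
  "finite_signed_measure \<mu> \<longleftrightarrow>
     (\<forall>F::nat \<Rightarrow> 'a set. range F \<subseteq> sets borel \<longrightarrow> disjoint_family F \<longrightarrow>
        (\<lambda>n. \<mu> (F n)) sums \<mu> (\<Union>n. F n))"

text \<open>Jordan decomposition: \<open>\<mu>\<^sup>+(E) = sup {\<mu>(F) | F \<subseteq> E Borel}\<close> and \<open>\<mu>\<^sup>- = (-\<mu>)\<^sup>+\<close>. The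
  truncation of negative values by \<open>ennreal\<close> is harmless, because \<open>F = {}\<close> contributes \<open>0\<close>.\<close>

definition positive_variation :: "('a::euclidean_space set \<Rightarrow> real) \<Rightarrow> 'a measure" where
  "positive_variation \<mu> =
     measure_of UNIV (sets borel) (\<lambda>E. SUP F\<in>{F \<in> sets borel. F \<subseteq> E}. ennreal (\<mu> F))"

definition signed_integral :: "('a::euclidean_space set \<Rightarrow> real) \<Rightarrow> ('a \<Rightarrow> real) \<Rightarrow> real" where
  "signed_integral \<mu> f =
     integral\<^sup>L (positive_variation \<mu>) f - integral\<^sup>L (positive_variation (\<lambda>E. - \<mu> E)) f"

text \<open>Weak convergence includes the assertion that the set functions involved really are finite
  signed measures (up to finitely many indices, which do not affect the limit).\<close>

definition weakly_converges ::
    "(nat \<Rightarrow> 'a::euclidean_space set \<Rightarrow> real) \<Rightarrow> ('a set \<Rightarrow> real) \<Rightarrow> bool" where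
  "weakly_converges \<mu>s \<mu> \<longleftrightarrow>
     finite_signed_measure \<mu> \<and> (\<forall>\<^sub>F n in sequentially. finite_signed_measure (\<mu>s n)) \<and>
     (\<forall>f::'a \<Rightarrow> real. continuous_on UNIV f \<longrightarrow> bounded (range f) \<longrightarrow>
        (\<lambda>n. signed_integral (\<mu>s n) f) \<longlonglongrightarrow> signed_integral \<mu> f)"

text \<open>The local Steiner formula. On \<open>parallel_set D \<rho>\<close> with \<open>\<rho> < reach D\<close> nearest points are
  unique, so there the library's \<open>closest_point D\<close> is the metric projection onto \<open>D\<close>.\<close>

definition local_steiner ::
    "'a::euclidean_space set \<Rightarrow> (nat \<Rightarrow> 'a set \<Rightarrow> real) \<Rightarrow> bool" where
  "local_steiner D C \<longleftrightarrow>
     (\<forall>i<DIM('a). signed_radon_measure (C i)) \<and>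
     (\<forall>F \<rho>. F \<in> sets borel \<longrightarrow> bounded F \<longrightarrow> 0 \<le> \<rho> \<longrightarrow> ereal \<rho> < reach D \<longrightarrow>
        measure lebesgue ((parallel_set D \<rho> - D) \<inter> closest_point D -` F) =
          (\<Sum>i=1..DIM('a). unit_ball_vol (real i) * \<rho> ^ i * C (DIM('a) - i) F))"

text \<open>For \<open>reach D > 0\<close> a family as in \<open>local_steiner\<close> exists (Federer), and its values for
  \<open>i < DIM('a)\<close> on bounded Borel sets are unique, being the coefficients of a polynomial in \<open>\<rho>\<close>.\<close>

definition curvature_measure :: "'a::euclidean_space set \<Rightarrow> nat \<Rightarrow> 'a set \<Rightarrow> real" where
  "curvature_measure D i F = (THE c. \<exists>C. local_steiner D C \<and> c = C i F)"

text \<open>The set \<open>D = closure (- parallel_set A r)\<close> is unbounded and \<open>curvature_measure D i\<close> is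
  determined on bounded Borel sets only. The limit is the unique extension to a finite signed
  measure on all Borel sets; for bounded \<open>F\<close> the sequence is eventually constant.\<close>

definition parallel_curvature_measure ::
    "'a::euclidean_space set \<Rightarrow> real \<Rightarrow> nat \<Rightarrow> 'a set \<Rightarrow> real" where
  "parallel_curvature_measure A r i F =
     (-1) ^ (DIM('a) - i - 1) *
     lim (\<lambda>m::nat. curvature_measure (closure (- parallel_set A r)) i (F \<inter> cball 0 (real m)))"

lemma parallel_curvature_measure_bounded:
  fixes A F :: "'a::euclidean_space set"
  assumes "bounded F"
  shows "parallel_curvature_measure A r i F =
     (-1) ^ (DIM('a) - i - 1) * curvature_measure (closure (- parallel_set A r)) i F"
proof -
  obtain b where b: "\<And>x. x \<in> F \<Longrightarrow> norm x \<le> b"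
    using assms by (auto simp: bounded_iff)
  obtain N :: nat where N: "b \<le> real N"
    using real_arch_simple by blast
  have *: "F \<inter> cball 0 (real m) = F" if "N \<le> m" for m :: nat
    using b N that by (force simp: dist_norm)
  let ?\<mu> = "curvature_measure (closure (- parallel_set A r)) i"
  have "(\<lambda>m::nat. ?\<mu> (F \<inter> cball 0 (real m))) \<longlonglongrightarrow> ?\<mu> F"
    by (rule tendsto_eventually, rule eventually_sequentiallyI[of N]) (simp add: *)
  from limI[OF this] show ?thesis
    by (simp add: parallel_curvature_measure_def)
qed

end

theory Submission
  imports Defs "HOL-Computational_Algebra.Polynomial"
begin

text \<open>
  Write \<open>D = exterior A r\<close> for the closure of the complement of the parallel set of \<open>A\<close>, and
  \<open>\<xi>\<close> for the projection onto \<open>D\<close>. By the local Steiner formula, the volume of the shell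
  \<open>{x. 0 < infdist x D \<le> t \<and> \<xi> x \<in> F}\<close> is a polynomial in \<open>t\<close>, whose coefficients are the
  curvature measures of \<open>F\<close> up to constants. Lagrange interpolation at \<open>d + 1\<close> fixed radii
  therefore writes every curvature measure as a fixed linear combination of image measures under
  \<open>\<xi>\<close> of Lebesgue measure on shells (\<open>parallel_curvature_measure_eq\<close>). If the reaches of the sets
  \<open>exterior (A n) r\<close> stay above some \<open>c > 0\<close>, the same radii serve for all \<open>n\<close>, and the claim is that
  the integrals of \<open>f \<circ> \<xi>\<close> over the shells converge. They do by dominated convergence
  (\<open>integral_shell_tendsto\<close>): distances to the exteriors and projections onto them converge
  pointwise, and the boundaries of the shells lie in level sets of distance functions, which are
  null sets (\<open>negligible_distance_level_set\<close>).

  The lower bound on the reach comes from compactness. If \<open>r\<close> is not a critical value of \<open>A\<close>, then at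
  every \<open>y\<close> at distance about \<open>r\<close> from \<open>A\<close> some unit direction \<open>v\<close> leads away from all nearly
  nearest points with a margin \<open>c\<close> that does not depend on \<open>y\<close>
  (\<open>noncritical_uniform_direction\<close>). This passes to all sets close to \<open>A\<close>; it excludes critical
  points at distance \<open>r\<close> from them and makes projections onto their exteriors unique within
  distance \<open>c\<close> (\<open>exterior_unique_nearest\<close>).

  The Steiner formula itself has to be proved, since the curvature measures are defined by it.
  The map \<open>T\<^sub>s x = s x + (1 - s) \<xi> x\<close> carries the shell of radius \<open>t\<close> onto the shell of radius
  \<open>s t\<close> (\<open>pull_closest_point_image\<close>); surjectivity means that normals extend up to the reach, which
  follows from Brouwer's fixed point theorem (\<open>nearest_points_ray\<close>). If \<open>\<xi>\<close> were differentiable, the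
  Jacobian \<open>det (s I + (1 - s) D\<xi>)\<close> would be a polynomial in \<open>s\<close> of degree at most \<open>d\<close>, and positive
  because \<open>\<xi>\<close> is monotone, so the volume of the image would be a polynomial in \<open>s\<close>.
  In general \<open>\<xi>\<close> is only continuous and monotone. Mollification keeps the monotonicity and makes it
  smooth, and polynomials of bounded degree are closed under pointwise limits, so the
  conclusion survives the limit (\<open>measure_pull_image_polynomial\<close>).
\<close>

section \<open>Functions that are polynomials of bounded degree on a set\<close>

definition lagrange_basis :: "real set \<Rightarrow> real \<Rightarrow> real poly" where
  "lagrange_basis N a = (\<Prod>b\<in>N - {a}. smult (inverse (a - b)) [:- b, 1:])"

lemma poly_lagrange_basis:
  assumes "finite N" "a \<in> N" "c \<in> N"
  shows "poly (lagrange_basis N a) c = (if c = a then 1 else 0)"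
proof (cases "c = a")
  case True
  have "inverse (a - b) * (a - b) = 1" if "b \<in> N - {a}" for b
    using that by (intro left_inverse) auto
  then show ?thesis
    using True by (simp add: lagrange_basis_def poly_prod algebra_simps)
next
  case False
  then have "\<exists>b\<in>N - {a}. poly (smult (inverse (a - b)) [:- b, 1:]) c = 0"
    using assms by (intro bexI[of _ c]) auto
  then show ?thesis
    using False assms by (auto simp: lagrange_basis_def poly_prod)
qed

lemma degree_lagrange_basis:
  assumes "finite N" "a \<in> N"
  shows "degree (lagrange_basis N a) < card N"
proof -
  have "degree (lagrange_basis N a) \<le> (\<Sum>b\<in>N - {a}. degree (smult (inverse (a - b)) [:- b, 1:]))"
    unfolding lagrange_basis_def
    by (rule order_trans[OF degree_prod_sum_le]) (use assms in \<open>auto simp: o_def simp del: smult_pCons\<close>)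
  also have "\<dots> \<le> (\<Sum>b\<in>N - {a}. 1)"
    by (intro sum_mono order_trans[OF degree_smult_le]) auto
  also have "\<dots> < card N"
    using card_Suc_Diff1[OF assms] by simp
  finally show ?thesis .
qed

lemma lagrange_interpolation:
  assumes "finite N" "degree q < card N"
  shows "q = (\<Sum>a\<in>N. smult (poly q a) (lagrange_basis N a))"
proof (rule poly_eqI_degree[of N])
  show "poly q x = poly (\<Sum>a\<in>N. smult (poly q a) (lagrange_basis N a)) x" if "x \<in> N" for x
    using that assms(1)
    by (simp add: poly_sum poly_lagrange_basis sum.delta' if_distrib cong: if_cong)
  have "degree (smult (poly q a) (lagrange_basis N a)) \<le> card N - 1" if "a \<in> N" for a
    using degree_smult_le[of "poly q a" "lagrange_basis N a"] degree_lagrange_basis[OF assms(1) that]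
    by linarith
  then have "degree (\<Sum>a\<in>N. smult (poly q a) (lagrange_basis N a)) \<le> card N - 1"
    by (intro degree_sum_le assms) auto
  then show "degree (\<Sum>a\<in>N. smult (poly q a) (lagrange_basis N a)) < card N"
    using assms(2) by linarith
qed (use assms in auto)

text \<open>Interpolation at \<open>d + 1\<close> nodes turns "polynomial of degree at most \<open>d\<close>" into linear relations between
  values. Such relations survive limits and integration, so no coefficients have to be followed
  through the approximations below.\<close>
definition poly_on :: "nat \<Rightarrow> real set \<Rightarrow> (real \<Rightarrow> real) \<Rightarrow> bool" where
  "poly_on d S p \<longleftrightarrow> (\<exists>q. degree q \<le> d \<and> (\<forall>s\<in>S. p s = poly q s))"

lemma poly_on_lagrange:
  assumes "poly_on d S p" "N \<subseteq> S" "finite N" "card N = Suc d" "s \<in> S"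
  shows "p s = (\<Sum>a\<in>N. p a * poly (lagrange_basis N a) s)"
proof -
  obtain q where q: "degree q \<le> d" "\<And>s. s \<in> S \<Longrightarrow> p s = poly q s"
    using assms(1) unfolding poly_on_def by blast
  have "poly q s = poly (\<Sum>a\<in>N. smult (poly q a) (lagrange_basis N a)) s"
    using lagrange_interpolation[of N q] assms q by simp
  also have "\<dots> = (\<Sum>a\<in>N. p a * poly (lagrange_basis N a) s)"
    using assms(2) q by (auto simp: poly_sum intro!: sum.cong)
  finally show ?thesis using q assms by simp
qed

lemma poly_onI_lagrange:
  assumes "finite N" "card N = Suc d"
    and "\<And>s. s \<in> S \<Longrightarrow> p s = (\<Sum>a\<in>N. p a * poly (lagrange_basis N a) s)"
  shows "poly_on d S p"
  unfolding poly_on_def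
proof (intro exI conjI ballI)
  have "degree (smult (p a) (lagrange_basis N a)) \<le> d" if "a \<in> N" for a
    using degree_smult_le[of "p a" "lagrange_basis N a"] degree_lagrange_basis[OF assms(1) that]
      assms(2) by linarith
  then show "degree (\<Sum>a\<in>N. smult (p a) (lagrange_basis N a)) \<le> d"
    by (intro degree_sum_le assms) auto
  show "p s = poly (\<Sum>a\<in>N. smult (p a) (lagrange_basis N a)) s" if "s \<in> S" for s
    using assms(3)[OF that] by (simp add: poly_sum)
qed

lemma poly_on_cong: "(\<And>s. s \<in> S \<Longrightarrow> p s = q s) \<Longrightarrow> poly_on d S p \<longleftrightarrow> poly_on d S q"
  unfolding poly_on_def by simp

lemma poly_on_const: "poly_on d S (\<lambda>_. c)"
  unfolding poly_on_def by (intro exI[of _ "[:c:]"]) simp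

lemma poly_on_add: "poly_on d S p \<Longrightarrow> poly_on d S q \<Longrightarrow> poly_on d S (\<lambda>s. p s + q s)"
  unfolding poly_on_def by (metis degree_add_le poly_add)

lemma poly_on_cmult: "poly_on d S p \<Longrightarrow> poly_on d S (\<lambda>s. c * p s)"
  unfolding poly_on_def by (metis degree_smult_le order_trans poly_smult)

lemma poly_on_diff: "poly_on d S p \<Longrightarrow> poly_on d S q \<Longrightarrow> poly_on d S (\<lambda>s. p s - q s)"
  using poly_on_add[of d S p "\<lambda>s. -1 * q s"] poly_on_cmult[of d S q "-1"] by simp

lemma poly_on_sum:
  "(\<And>i. i \<in> I \<Longrightarrow> poly_on d S (p i)) \<Longrightarrow> poly_on d S (\<lambda>s. \<Sum>i\<in>I. p i s)"
  by (induction I rule: infinite_finite_induct) (auto intro: poly_on_add poly_on_const)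

lemma poly_on_limit:
  assumes "infinite S" and "\<And>n::nat. poly_on d S (p n)"
    and lim: "\<And>s. s \<in> S \<Longrightarrow> (\<lambda>n. p n s) \<longlonglongrightarrow> q s"
  shows "poly_on d S q"
proof -
  obtain N where N: "N \<subseteq> S" "finite N" "card N = Suc d"
    using infinite_arbitrarily_large[OF assms(1)] by blast
  show ?thesis
  proof (rule poly_onI_lagrange[OF N(2,3)])
    fix s assume s: "s \<in> S"
    have "(\<lambda>n. \<Sum>a\<in>N. p n a * poly (lagrange_basis N a) s)
        \<longlonglongrightarrow> (\<Sum>a\<in>N. q a * poly (lagrange_basis N a) s)"
      using N by (intro tendsto_intros lim) auto
    then have "(\<lambda>n. p n s) \<longlonglongrightarrow> (\<Sum>a\<in>N. q a * poly (lagrange_basis N a) s)"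
      using poly_on_lagrange[OF assms(2) N s] by simp
    then show "q s = (\<Sum>a\<in>N. q a * poly (lagrange_basis N a) s)"
      using lim[OF s] LIMSEQ_unique by blast
  qed
qed

lemma poly_on_integral:
  assumes "infinite S" and "\<And>x. x \<in> space M \<Longrightarrow> poly_on d S (\<lambda>s. f s x)"
    and int: "\<And>s. s \<in> S \<Longrightarrow> integrable M (f s)"
  shows "poly_on d S (\<lambda>s. \<integral>x. f s x \<partial>M)"
proof -
  obtain N where N: "N \<subseteq> S" "finite N" "card N = Suc d"
    using infinite_arbitrarily_large[OF assms(1)] by blast
  show ?thesis
  proof (rule poly_onI_lagrange[OF N(2,3)])
    fix s assume s: "s \<in> S"
    have "(\<integral>x. f s x \<partial>M) = (\<integral>x. (\<Sum>a\<in>N. f a x * poly (lagrange_basis N a) s) \<partial>M)"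
      using poly_on_lagrange[OF assms(2) N s] by (intro Bochner_Integration.integral_cong) auto
    also have "\<dots> = (\<Sum>a\<in>N. (\<integral>x. f a x \<partial>M) * poly (lagrange_basis N a) s)"
      using N by (subst Bochner_Integration.integral_sum) (auto intro!: int integrable_mult_left)
    finally show "(\<integral>x. f s x \<partial>M) = (\<Sum>a\<in>N. (\<integral>x. f a x \<partial>M) * poly (lagrange_basis N a) s)" .
  qed
qed

lemma poly_on_det:
  fixes A B :: "real ^ 'n::finite ^ 'n"
  shows "poly_on CARD('n) S (\<lambda>s. det (s *\<^sub>R A + (1 - s) *\<^sub>R B))"
proof -
  define q where "q p = (\<Prod>i\<in>UNIV. [:B $ i $ p i, A $ i $ p i - B $ i $ p i:])" for p :: "'n \<Rightarrow> 'n"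
  have "degree (q p) \<le> (\<Sum>i\<in>(UNIV::'n set). 1)" for p
    unfolding q_def
    by (rule order_trans[OF degree_prod_sum_le]) (auto intro!: sum_mono simp: o_def simp del: sum_constant)
  then have "degree (q p) \<le> CARD('n)" for p by simp
  moreover have "(\<Prod>i\<in>UNIV. (s *\<^sub>R A + (1 - s) *\<^sub>R B) $ i $ p i) = poly (q p) s" for p s
    unfolding q_def poly_prod by (intro prod.cong) (auto simp: algebra_simps)
  ultimately have "poly_on CARD('n) S (\<lambda>s. \<Prod>i\<in>UNIV. (s *\<^sub>R A + (1 - s) *\<^sub>R B) $ i $ p i)" for p
    unfolding poly_on_def by blast
  then show ?thesis
    unfolding det_def by (intro poly_on_sum poly_on_cmult)
qed

section \<open>Change of variables in an abstract Euclidean space\<close>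

text \<open>Determinants and the change of variables formula refer to coordinate spaces \<open>real ^ 'n\<close> with a finite
  well-ordered index type. The natural numbers below the dimension form such a type for an
  abstract Euclidean space, which the isometry \<open>to_vec\<close> identifies with its coordinate space.\<close>
typedef (overloaded) 'a::euclidean_space basis_index = "{..<DIM('a)}"
  by (rule exI[of _ 0]) simp

instantiation basis_index :: (euclidean_space) "{finite, wellorder}"
begin

definition less_eq_basis_index :: "'a basis_index \<Rightarrow> 'a basis_index \<Rightarrow> bool" where
  "i \<le> j \<longleftrightarrow> Rep_basis_index i \<le> Rep_basis_index j"

definition less_basis_index :: "'a basis_index \<Rightarrow> 'a basis_index \<Rightarrow> bool" where
  "i < j \<longleftrightarrow> Rep_basis_index i < Rep_basis_index j"

instance
proof
  show "finite (UNIV :: 'a basis_index set)"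
    using type_definition.univ[OF type_definition_basis_index[where 'a='a]] by (metis finite_imageI finite_lessThan)
  fix P :: "'a basis_index \<Rightarrow> bool" and a
  assume step: "\<And>x. (\<And>y. y < x \<Longrightarrow> P y) \<Longrightarrow> P x"
  show "P a"
    by (induction a rule: measure_induct_rule[of Rep_basis_index])
      (auto intro: step simp: less_basis_index_def)
qed (auto simp: less_eq_basis_index_def less_basis_index_def Rep_basis_index_inject)

end

lemma ex_bij_basis_index: "\<exists>f. bij_betw f (UNIV :: 'a::euclidean_space basis_index set) (Basis :: 'a set)"
proof -
  have "bij_betw (Rep_basis_index :: 'a basis_index \<Rightarrow> nat) UNIV {..<DIM('a)}"
    by (auto simp: bij_betw_def inj_on_def Rep_basis_index_inject
        type_definition.Rep_range[OF type_definition_basis_index])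
  moreover obtain h where "bij_betw h {..<DIM('a)} (Basis :: 'a set)"
    using ex_bij_betw_nat_finite[of "Basis :: 'a set"] by (auto simp: lessThan_atLeast0)
  ultimately show ?thesis
    using bij_betw_trans by blast
qed

definition basis_of :: "'a::euclidean_space basis_index \<Rightarrow> 'a" where
  "basis_of = (SOME f. bij_betw f UNIV Basis)"

lemma bij_basis_of: "bij_betw basis_of UNIV (Basis :: 'a::euclidean_space set)"
  unfolding basis_of_def using someI_ex[OF ex_bij_basis_index] .

lemma card_basis_index: "CARD('a::euclidean_space basis_index) = DIM('a)"
  using bij_betw_same_card[OF bij_basis_of] by simp

lemma basis_of_in_Basis [simp]: "basis_of i \<in> Basis"
  using bij_basis_of by (auto simp: bij_betw_def)

lemma basis_of_inner: "basis_of i \<bullet> basis_of j = (if i = j then 1 else 0)"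
  using bij_basis_of by (auto simp: inner_Basis bij_betw_def dest: injD)

definition to_vec :: "'a::euclidean_space \<Rightarrow> real ^ 'a basis_index" where
  "to_vec x = (\<chi> i. x \<bullet> basis_of i)"

definition from_vec :: "real ^ 'a basis_index \<Rightarrow> 'a::euclidean_space" where
  "from_vec v = (\<Sum>i\<in>UNIV. v $ i *\<^sub>R basis_of i)"

lemma to_from_vec [simp]: "to_vec (from_vec v) = v"
  by (simp add: to_vec_def from_vec_def vec_eq_iff inner_sum_left basis_of_inner if_distrib cong: if_cong)

lemma from_to_vec [simp]: "from_vec (to_vec x) = x"
  using sum.reindex_bij_betw[OF bij_basis_of, of "\<lambda>b. (x \<bullet> b) *\<^sub>R b"]
  by (simp add: to_vec_def from_vec_def euclidean_representation)

lemma linear_to_vec: "linear to_vec"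
  by (rule linearI) (auto simp: to_vec_def vec_eq_iff inner_add_left)

lemma linear_from_vec: "linear from_vec"
  by (rule linearI) (auto simp: from_vec_def scaleR_left_distrib sum.distrib scaleR_sum_right)

lemma bounded_linear_to_vec: "bounded_linear to_vec"
  using linear_to_vec linear_conv_bounded_linear by blast

lemma bounded_linear_from_vec: "bounded_linear from_vec"
  using linear_from_vec linear_conv_bounded_linear by blast

lemma continuous_on_to_vec: "continuous_on S to_vec"
  by (rule linear_continuous_on[OF bounded_linear_to_vec])

lemma continuous_on_from_vec: "continuous_on S from_vec"
  by (rule linear_continuous_on[OF bounded_linear_from_vec])

lemma measurable_from_vec [measurable]: "from_vec \<in> borel_measurable borel"
  by (rule borel_measurable_continuous_onI[OF continuous_on_from_vec])

text \<open>Lebesgue measure is determined by boxes, and \<open>from_vec\<close> maps boxes to boxes with the same side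
  lengths.\<close>
lemma distr_from_vec: "distr lborel borel from_vec = (lborel :: 'a::euclidean_space measure)"
proof (rule lborel_eqI[symmetric])
  fix l u :: 'a assume le: "\<And>b. b \<in> Basis \<Longrightarrow> l \<bullet> b \<le> u \<bullet> b"
  have inner: "from_vec v \<bullet> basis_of i = v $ i" for v :: "real ^ 'a basis_index" and i
    by (simp add: from_vec_def inner_sum_left basis_of_inner if_distrib cong: if_cong)
  have Basis: "Basis = range (basis_of :: 'a basis_index \<Rightarrow> 'a)"
    using bij_basis_of by (auto simp: bij_betw_def)
  have mem: "from_vec v \<in> box l u \<longleftrightarrow> v \<in> box (to_vec l) (to_vec u)" for v
    unfolding mem_box_cart mem_box(1)[of "from_vec v"] Basis to_vec_def by (simp add: inner)
  have "emeasure (distr lborel borel from_vec) (box l u) = emeasure lborel (box (to_vec l) (to_vec u))"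
    by (subst emeasure_distr) (auto simp: mem vimage_def intro!: arg_cong2[of _ _ _ _ emeasure])
  also have "\<dots> = ennreal (\<Prod>b\<in>Basis. (to_vec u - to_vec l) \<bullet> b)"
    by (rule emeasure_lborel_box)
      (use le in \<open>auto simp: Basis_vec_def inner_axis to_vec_def\<close>)
  also have "(\<Prod>b\<in>Basis. (to_vec u - to_vec l) \<bullet> b) = (\<Prod>b\<in>range (\<lambda>i. axis i 1). (to_vec u - to_vec l) \<bullet> b)"
    by (intro prod.cong) (auto simp: Basis_vec_def)
  also have "\<dots> = (\<Prod>i\<in>UNIV. u \<bullet> basis_of i - l \<bullet> basis_of i)"
    by (subst prod.reindex) (auto simp: inj_on_def axis_eq_axis inner_axis to_vec_def)
  also have "\<dots> = (\<Prod>b\<in>Basis. (u - l) \<bullet> b)"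
    using prod.reindex_bij_betw[OF bij_basis_of, of "\<lambda>b. (u - l) \<bullet> b"]
    by (simp add: inner_diff_left)
  finally show "emeasure (distr lborel borel from_vec) (box l u) = (\<Prod>b\<in>Basis. (u - l) \<bullet> b)" .
qed simp

definition jacobian :: "('a::euclidean_space \<Rightarrow> 'a) \<Rightarrow> real" where
  "jacobian L = det (matrix (to_vec \<circ> L \<circ> from_vec))"

lemma poly_on_jacobian:
  fixes L :: "'a::euclidean_space \<Rightarrow> 'a"
  assumes "linear L"
  shows "poly_on DIM('a) S (\<lambda>s. jacobian (\<lambda>v. s *\<^sub>R v + (1 - s) *\<^sub>R L v))"
proof -
  have "matrix (to_vec \<circ> (\<lambda>v. s *\<^sub>R v + (1 - s) *\<^sub>R L v) \<circ> from_vec)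
      = s *\<^sub>R mat 1 + (1 - s) *\<^sub>R matrix (to_vec \<circ> L \<circ> from_vec)" for s
    by (simp add: matrix_def mat_def vec_eq_iff linear_add[OF linear_to_vec]
        linear_cmul[OF linear_to_vec] axis_def)
  then show ?thesis
    unfolding jacobian_def by (simp only: card_basis_index[symmetric] poly_on_det)
qed

lemma jacobian_nonzero:
  fixes L :: "'a::euclidean_space \<Rightarrow> 'a"
  assumes "linear L" "\<And>v. L v = 0 \<Longrightarrow> v = 0"
  shows "jacobian L \<noteq> 0"
proof -
  let ?G = "to_vec \<circ> L \<circ> from_vec"
  have lin: "linear ?G"
    by (intro linear_compose linear_to_vec linear_from_vec assms)
  have "inj ?G"
    unfolding linear_injective_0[OF lin]
  proof (intro allI impI)
    fix v assume "?G v = 0"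
    then have "L (from_vec v) = from_vec 0"
      by (metis comp_apply from_to_vec)
    then have "from_vec v = 0"
      using assms(2) by (simp add: linear_0[OF linear_from_vec])
    then have "to_vec (from_vec v) = 0"
      by (simp add: linear_0[OF linear_to_vec])
    then show "v = 0" by simp
  qed
  then show ?thesis
    unfolding jacobian_def using det_nz_iff_inj[OF lin] by blast
qed

text \<open>The quadratic form of \<open>s I + (1 - s) L\<close> is at least \<open>s |v|\<^sup>2\<close>, so its determinant has no zero for
  \<open>s\<close> in \<open>(0, 1]\<close>; at \<open>s = 1\<close> it equals 1. The sign allows the absolute value in the change of
  variables formula to be dropped, which leaves a polynomial in \<open>s\<close>.\<close>
lemma jacobian_pos:
  fixes L :: "'a::euclidean_space \<Rightarrow> 'a"
  assumes L: "linear L" and pos: "\<And>v. 0 \<le> L v \<bullet> v" and s: "0 < s" "s \<le> 1"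
  shows "0 < jacobian (\<lambda>v. s *\<^sub>R v + (1 - s) *\<^sub>R L v)"
proof -
  let ?J = "\<lambda>s. jacobian (\<lambda>v. s *\<^sub>R v + (1 - s) *\<^sub>R L v)"
  have nz: "?J t \<noteq> 0" if t: "0 < t" "t \<le> 1" for t
  proof (rule jacobian_nonzero)
    show "linear (\<lambda>v. t *\<^sub>R v + (1 - t) *\<^sub>R L v)"
      using L by (intro linear_compose_add linear_compose_scale_right) (auto simp: linear_id[unfolded id_def])
    fix v assume 0: "t *\<^sub>R v + (1 - t) *\<^sub>R L v = 0"
    have "t * (v \<bullet> v) + (1 - t) * (L v \<bullet> v) = 0"
      using arg_cong[OF 0, of "\<lambda>w. w \<bullet> v"] by (simp add: inner_add_left)
    moreover have "0 \<le> (1 - t) * (L v \<bullet> v)" using pos t by simp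
    moreover have "0 \<le> t * (v \<bullet> v)" using t by simp
    ultimately have "t * (v \<bullet> v) = 0" by linarith
    then show "v = 0" using t by simp
  qed
  have "to_vec \<circ> (\<lambda>v. 1 *\<^sub>R v + (1 - 1) *\<^sub>R L v) \<circ> from_vec = (id :: real ^ 'a basis_index \<Rightarrow> _)"
    by auto
  then have one: "?J 1 = 1"
    unfolding jacobian_def by (simp only: matrix_id det_I)
  obtain q where q: "\<And>t. ?J t = poly q t"
    using poly_on_jacobian[OF L, of UNIV] unfolding poly_on_def by auto
  show ?thesis
  proof (rule ccontr)
    assume "\<not> 0 < ?J s"
    then have "\<exists>t\<ge>s. t \<le> 1 \<and> poly q t = 0"
      using s one q[of 1] q[of s] by (intro IVT') (auto intro!: continuous_intros)
    then show False
      using nz s q by auto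
  qed
qed

lemma continuous_on_jacobian:
  fixes M :: "'b::topological_space \<Rightarrow> 'a::euclidean_space \<Rightarrow> 'a"
  assumes "\<And>v. continuous_on S (\<lambda>x. M x v)"
  shows "continuous_on S (\<lambda>x. jacobian (M x))"
  unfolding jacobian_def det_def matrix_def
  by (auto intro!: continuous_intros assms continuous_on_compose2[OF continuous_on_to_vec])

lemma integral_from_vec:
  fixes f :: "'a::euclidean_space \<Rightarrow> real"
  assumes [measurable]: "f \<in> borel_measurable borel"
  shows "(\<integral>v. f (from_vec v) \<partial>lborel) = (\<integral>x. f x \<partial>lborel)"
  by (subst (2) distr_from_vec[symmetric], subst integral_distr) auto

lemma integral_change_of_variables_compact:
  fixes g :: "'a::euclidean_space \<Rightarrow> 'a" and k :: "'a \<Rightarrow> real"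
  assumes K: "compact K"
    and g': "\<And>x. x \<in> K \<Longrightarrow> (g has_derivative g' x) (at x within K)"
    and inj: "inj_on g K"
    and cont: "continuous_on K (\<lambda>x. jacobian (g' x))" "continuous_on K k"
  shows "(\<integral>z\<in>g ` K. k (the_inv_into K g z) \<partial>lborel) = (\<integral>x\<in>K. \<bar>jacobian (g' x)\<bar> * k x \<partial>lborel)"
proof -
  let ?S = "to_vec ` K"
  let ?G = "to_vec \<circ> g \<circ> from_vec"
  let ?h = "the_inv_into K g"
  let ?f = "\<lambda>v. k (?h (from_vec v))"
  have S: "compact ?S"
    by (intro compact_continuous_image continuous_on_to_vec K)
  have contg: "continuous_on K g"
    using g' by (meson continuous_on_eq_continuous_within has_derivative_continuous)
  have gK: "compact (g ` K)" by (intro compact_continuous_image contg K)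
  have conth: "continuous_on (g ` K) ?h"
    by (intro continuous_on_inv contg K) (auto simp: the_inv_into_f_f[OF inj])
  have contkh: "continuous_on (g ` K) (\<lambda>z. k (?h z))"
    by (rule continuous_on_compose2[OF cont(2) conth]) (auto simp: the_inv_into_f_f[OF inj])
  have GS: "?G ` ?S = to_vec ` g ` K"
    by (auto simp: image_image)
  have cf: "continuous_on (?G ` ?S) ?f"
    unfolding GS by (rule continuous_on_compose2[OF contkh continuous_on_from_vec]) auto
  have GSc: "compact (?G ` ?S)"
    unfolding GS by (intro compact_continuous_image continuous_on_to_vec gK)
  have der: "(?G has_derivative (to_vec \<circ> g' (from_vec v) \<circ> from_vec)) (at v within ?S)" if v: "v \<in> ?S" for v
  proof -
    have 1: "(from_vec has_derivative from_vec) (at v within ?S)"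
      by (rule bounded_linear_imp_has_derivative[OF bounded_linear_from_vec])
    have im: "from_vec ` ?S = K" by (auto simp: image_image)
    have 2: "(g has_derivative g' (from_vec v)) (at (from_vec v) within from_vec ` ?S)"
      unfolding im using v by (intro g') auto
    have 3: "(to_vec has_derivative to_vec) (at ((g \<circ> from_vec) v) within UNIV)"
      by (rule bounded_linear_imp_has_derivative[OF bounded_linear_to_vec])
    show ?thesis
      using diff_chain_within[OF diff_chain_within[OF 1 2] has_derivative_subset[OF 3 subset_UNIV]]
      by (simp only: o_assoc)
  qed
  have injG: "inj_on ?G ?S"
  proof (rule inj_onI)
    fix v w assume vw: "v \<in> ?S" "w \<in> ?S" and eq: "?G v = ?G w"
    have "from_vec v \<in> K" "from_vec w \<in> K" using vw by auto
    moreover have "g (from_vec v) = g (from_vec w)"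
      using arg_cong[OF eq, of from_vec] by simp
    ultimately have "from_vec v = from_vec w"
      by (rule inj_onD[OF inj, rotated 1])
    from arg_cong[OF this, of to_vec] show "v = w" by simp
  qed
  have absf: "?f absolutely_integrable_on (?G ` ?S)"
    using borel_integrable_compact[OF GSc cf] unfolding set_integrable_def
    by (subst integrable_completion) (auto dest: borel_measurable_integrable)
  have "integral ?S (\<lambda>v. \<bar>det (matrix (to_vec \<circ> g' (from_vec v) \<circ> from_vec))\<bar> *\<^sub>R ?f (?G v)) = integral (?G ` ?S) ?f"
    using has_absolute_integral_change_of_variables[OF lmeasurable_compact[OF S, THEN fmeasurableD] der injG, of "\<lambda>v. vec (?f v) :: real ^ 1" "vec (integral (?G ` ?S) ?f)"] absf
    unfolding absolutely_integrable_on_1_iff integral_on_1_eq by (simp add: vec_eq_iff)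
  also have "integral ?S (\<lambda>v. \<bar>det (matrix (to_vec \<circ> g' (from_vec v) \<circ> from_vec))\<bar> *\<^sub>R ?f (?G v))
    = integral ?S (\<lambda>v. \<bar>jacobian (g' (from_vec v))\<bar> * k (from_vec v))"
    by (rule Henstock_Kurzweil_Integration.integral_cong) (auto simp: jacobian_def the_inv_into_f_f[OF inj])
  finally have eq: "integral (?G ` ?S) ?f = integral ?S (\<lambda>v. \<bar>jacobian (g' (from_vec v))\<bar> * k (from_vec v))" ..
  have transfer: "integral (to_vec ` C) (\<lambda>v. u (from_vec v)) = (\<integral>x\<in>C. u x \<partial>lborel)"
    if C: "compact C" and u: "continuous_on C u" for C and u :: "'a \<Rightarrow> real"
  proof -
    have 1: "compact (to_vec ` C)" by (intro compact_continuous_image continuous_on_to_vec C)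
    have 2: "continuous_on (to_vec ` C) (\<lambda>v. u (from_vec v))"
      by (rule continuous_on_compose2[OF u continuous_on_from_vec]) auto
    have mem: "v \<in> to_vec ` C \<longleftrightarrow> from_vec v \<in> C" for v
      by (metis from_to_vec image_iff to_from_vec)
    have "integral (to_vec ` C) (\<lambda>v. u (from_vec v)) = (\<integral>v\<in>to_vec ` C. u (from_vec v) \<partial>lborel)"
      using borel_integrable_compact[OF 1 2]
      by (intro set_borel_integral_eq_integral(2)[symmetric]) (simp add: set_integrable_def)
    also have "\<dots> = (\<integral>v. (\<lambda>x. indicator C x *\<^sub>R u x) (from_vec v) \<partial>lborel)"
      unfolding set_lebesgue_integral_def
      by (intro Bochner_Integration.integral_cong) (auto simp: indicator_def mem)
    also have "\<dots> = (\<integral>x. indicator C x *\<^sub>R u x \<partial>lborel)"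
      using borel_integrable_compact[OF C u] by (intro integral_from_vec) (auto dest: borel_measurable_integrable)
    finally show ?thesis by (simp add: set_lebesgue_integral_def)
  qed
  have "integral (?G ` ?S) ?f = (\<integral>z\<in>g ` K. k (?h z) \<partial>lborel)"
    unfolding GS by (rule transfer[OF gK contkh])
  moreover have "integral ?S (\<lambda>v. \<bar>jacobian (g' (from_vec v))\<bar> * k (from_vec v)) = (\<integral>x\<in>K. \<bar>jacobian (g' x)\<bar> * k x \<partial>lborel)"
    by (rule transfer[OF K]) (intro continuous_intros cont)
  ultimately show ?thesis using eq by simp
qed

section \<open>Mollification of monotone maps\<close>

text \<open>A nonnegative \<open>C\<^sup>1\<close> function supported in the ball of radius \<open>\<epsilon>\<close>; its integral is not normalised.\<close>
definition bump :: "real \<Rightarrow> 'a::euclidean_space \<Rightarrow> real" where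
  "bump \<epsilon> v = (max 0 (\<epsilon>\<^sup>2 - v \<bullet> v))\<^sup>2"

lemma bump_nonneg: "0 \<le> bump \<epsilon> v"
  by (simp add: bump_def)

lemma bump_eq_0: "0 \<le> \<epsilon> \<Longrightarrow> \<epsilon> \<le> norm v \<Longrightarrow> bump \<epsilon> v = 0"
  by (simp add: bump_def max_def power_mono dot_square_norm)

lemma bump_pos: "norm v < \<epsilon> \<Longrightarrow> 0 < bump \<epsilon> v"
  using power_strict_mono[of "norm v" \<epsilon> 2] by (simp add: bump_def max_def dot_square_norm)

lemma continuous_on_bump [continuous_intros]:
  "continuous_on S f \<Longrightarrow> continuous_on S (\<lambda>x. bump \<epsilon> (f x))"
  unfolding bump_def by (intro continuous_intros)

lemma has_real_derivative_max_0_squared: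
  "((\<lambda>t::real. (max 0 t)\<^sup>2) has_real_derivative 2 * max 0 t) (at t)"
proof (cases "t = 0")
  case True
  have "((\<lambda>h. ((max 0 (0 + h))\<^sup>2 - (max 0 0)\<^sup>2) / h) \<longlongrightarrow> 0) (at (0::real))"
  proof (rule Lim_null_comparison)
    show "\<forall>\<^sub>F h in at (0::real). norm (((max 0 (0 + h))\<^sup>2 - (max 0 0)\<^sup>2) / h) \<le> \<bar>h\<bar>"
      by (rule always_eventually) (auto simp: max_def power2_eq_square)
    show "((\<lambda>h. \<bar>h\<bar>) \<longlongrightarrow> 0) (at (0::real))"
      by (rule tendsto_eq_intros refl)+ simp
  qed
  then show ?thesis using True by (simp add: DERIV_def)
next
  case False
  show ?thesis
  proof (cases "t > 0")
    case True
    have "((\<lambda>t::real. t\<^sup>2) has_real_derivative 2 * max 0 t) (at t)"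
      using True by (auto intro!: derivative_eq_intros)
    then show ?thesis
      by (rule has_field_derivative_transform_within_open[of _ _ _ "{0<..}"]) (use True in auto)
  next
    case neg: False
    have "((\<lambda>t::real. 0) has_real_derivative 2 * max 0 t) (at t)"
      using neg by (auto intro!: derivative_eq_intros)
    then show ?thesis
      by (rule has_field_derivative_transform_within_open[of _ _ _ "{..<0}"]) (use neg False in auto)
  qed
qed

lemma has_derivative_bump:
  "((\<lambda>x. bump \<epsilon> (u - x)) has_derivative (\<lambda>h. 4 * max 0 (\<epsilon>\<^sup>2 - (u - x) \<bullet> (u - x)) * ((u - x) \<bullet> h))) (at x within S)"
proof -
  have 1: "((\<lambda>x. \<epsilon>\<^sup>2 - (u - x) \<bullet> (u - x)) has_derivative (\<lambda>h. 2 * ((u - x) \<bullet> h))) (at x within S)"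
    by (auto intro!: derivative_eq_intros simp: inner_commute)
  have 2: "((\<lambda>t::real. (max 0 t)\<^sup>2) has_derivative (*) (2 * max 0 (\<epsilon>\<^sup>2 - (u - x) \<bullet> (u - x))))
      (at (\<epsilon>\<^sup>2 - (u - x) \<bullet> (u - x)))"
    using has_real_derivative_max_0_squared by (simp add: has_field_derivative_def)
  show ?thesis
    using has_derivative_compose[OF 1 2] by (simp add: bump_def mult.assoc mult.left_commute)
qed

text \<open>Convolution with the normalised bump. On \<open>K\<close> the value at \<open>x\<close> is an average of the values
  \<open>\<Xi> (x + v)\<close> with \<open>|v| \<le> \<epsilon>\<close>, with weights independent of \<open>x\<close>; hence it inherits both the modulus
  of continuity and, as an average of inequalities, monotonicity.\<close>
proposition mollification:
  fixes \<Xi> :: "'a::euclidean_space \<Rightarrow> 'a" and K :: "'a set"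
  assumes cont: "continuous_on UNIV \<Xi>" and K: "bounded K" and \<epsilon>: "0 < \<epsilon>"
  obtains \<Phi> M where "\<And>x. (\<Phi> has_derivative M x) (at x)" "\<And>v. continuous_on UNIV (\<lambda>x. M x v)"
    "\<And>x e. x \<in> K \<Longrightarrow> (\<And>v. norm v \<le> \<epsilon> \<Longrightarrow> norm (\<Xi> (x + v) - \<Xi> x) \<le> e) \<Longrightarrow> norm (\<Phi> x - \<Xi> x) \<le> e"
    "\<And>x y. x \<in> K \<Longrightarrow> y \<in> K \<Longrightarrow> (\<And>v. norm v \<le> \<epsilon> \<Longrightarrow> 0 \<le> (\<Xi> (x + v) - \<Xi> (y + v)) \<bullet> (x - y)) \<Longrightarrow> 0 \<le> (\<Phi> x - \<Phi> y) \<bullet> (x - y)"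
proof -
  obtain B where B: "\<And>x. x \<in> K \<Longrightarrow> norm x \<le> B"
    using K by (auto simp: bounded_iff)
  have "bounded (cball (0::'a) (B + \<epsilon>))" by simp
  then obtain q where q: "cball (0::'a) (B + \<epsilon>) \<subseteq> cbox (- q) q"
    using bounded_subset_cbox_symmetric by blast
  (* The box contains the supports of all kernels centred in K. Integrating over this fixed box
     moves the dependence on x into the kernel and allows differentiation under the integral sign. *)
  define Q where "Q = cbox (- q) q"
  define Z where "Z = (\<integral>v. bump \<epsilon> v \<partial>(lborel :: 'a measure))"
  define \<Psi> where "\<Psi> x = integral Q (\<lambda>u. bump \<epsilon> (u - x) *\<^sub>R \<Xi> u)" for x
  define N where "N x u = blinfun_scaleR_left (\<Xi> u) o\<^sub>L
      blinfun_inner_left ((4 * max 0 (\<epsilon>\<^sup>2 - (u - x) \<bullet> (u - x))) *\<^sub>R (u - x))" for x u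
  have contN: "continuous_on (UNIV \<times> Q) (\<lambda>(x, u). N x u)"
    unfolding N_def case_prod_beta
    by (intro continuous_intros bounded_bilinear.continuous_on[OF bounded_bilinear_blinfun_compose]
       bounded_linear.continuous_on[OF bounded_linear_blinfun_scaleR_left]
       bounded_linear.continuous_on[OF bounded_linear_blinfun_inner_left]
       continuous_on_compose2[OF cont]) auto
  have derN: "((\<lambda>x. bump \<epsilon> (u - x) *\<^sub>R \<Xi> u) has_derivative blinfun_apply (N x u)) (at x within UNIV)" for x u
    by (rule has_derivative_eq_rhs[OF has_derivative_scaleR[OF has_derivative_bump has_derivative_const]])
      (auto simp: N_def inner_commute)
  have intble: "(\<lambda>u. bump \<epsilon> (u - x) *\<^sub>R \<Xi> u) integrable_on Q" for x
    unfolding Q_def by (intro integrable_continuous continuous_intros continuous_on_subset[OF cont]) auto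
  have der: "(\<Psi> has_derivative integral Q (N x)) (at x)" for x
    unfolding \<Psi>_def[abs_def] Q_def
    by (rule leibniz_rule[OF derN]) (use intble contN in \<open>auto simp: Q_def\<close>)
  have contM: "continuous_on UNIV (\<lambda>x. integral Q (N x))"
    using contN unfolding Q_def by (intro integral_continuous_on_param) (auto simp: case_prod_beta)
  have intv: "integrable lborel (\<lambda>v. bump \<epsilon> v *\<^sub>R f v)" if "continuous_on UNIV f"
    for f :: "'a \<Rightarrow> 'b::euclidean_space"
  proof -
    have "integrable lborel (\<lambda>v. indicator (cball 0 \<epsilon>) v *\<^sub>R (bump \<epsilon> v *\<^sub>R f v))"
      by (intro borel_integrable_compact continuous_intros continuous_on_subset[OF that]) auto
    also have "(\<lambda>v. indicator (cball 0 \<epsilon>) v *\<^sub>R (bump \<epsilon> v *\<^sub>R f v)) = (\<lambda>v. bump \<epsilon> v *\<^sub>R f v)"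
    proof
      show "indicator (cball 0 \<epsilon>) v *\<^sub>R (bump \<epsilon> v *\<^sub>R f v) = bump \<epsilon> v *\<^sub>R f v" for v
        using bump_eq_0[of \<epsilon> v] \<epsilon> by (cases "norm v \<le> \<epsilon>") auto
    qed
    finally show ?thesis .
  qed
  have intZ: "integrable lborel (bump \<epsilon> :: 'a \<Rightarrow> real)"
    using intv[of "\<lambda>_. 1 :: real"] by simp
  have Z: "0 < Z"
  proof -
    have "Z \<noteq> 0"
    proof
      assume "Z = 0"
      then have "AE v in lborel. bump \<epsilon> (v :: 'a) = 0"
        unfolding Z_def using intZ bump_nonneg by (subst (asm) integral_nonneg_eq_0_iff_AE) auto
      then have "AE v in lborel. (v :: 'a) \<notin> ball 0 \<epsilon>"
        by (rule AE_mp) (auto dest!: bump_pos)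
      then have "ball 0 \<epsilon> \<in> null_sets (lborel :: 'a measure)"
        by (subst AE_iff_null_sets) auto
      then have "negligible (ball (0::'a) \<epsilon>)"
        by (simp add: negligible_iff_null_sets null_sets_completionI)
      then show False
        using \<epsilon> open_not_negligible[of "ball (0::'a) \<epsilon>"] by auto
    qed
    moreover have "0 \<le> Z"
      unfolding Z_def by (simp add: bump_nonneg)
    ultimately show ?thesis by simp
  qed
  have contsh: "continuous_on UNIV (\<lambda>v. \<Xi> (x + v))" for x
    by (intro continuous_on_compose2[OF cont] continuous_intros) auto
  have \<Psi>: "\<Psi> x = (\<integral>v. bump \<epsilon> v *\<^sub>R \<Xi> (x + v) \<partial>lborel)" if x: "x \<in> K" for x
  proof -
    have "set_integrable lborel Q (\<lambda>u. bump \<epsilon> (u - x) *\<^sub>R \<Xi> u)"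
      unfolding set_integrable_def Q_def
      by (intro borel_integrable_compact continuous_intros continuous_on_subset[OF cont]) auto
    then have "\<Psi> x = (\<integral>u\<in>Q. bump \<epsilon> (u - x) *\<^sub>R \<Xi> u \<partial>lborel)"
      unfolding \<Psi>_def by (rule set_borel_integral_eq_integral(2)[symmetric])
    also have "\<dots> = (\<integral>u. bump \<epsilon> (u - x) *\<^sub>R \<Xi> u \<partial>lborel)"
      unfolding set_lebesgue_integral_def
    proof (intro Bochner_Integration.integral_cong refl)
      fix u
      have "bump \<epsilon> (u - x) = 0" if "u \<notin> Q"
      proof (rule bump_eq_0)
        have "\<not> norm u \<le> B + \<epsilon>"
          using that q unfolding Q_def by auto
        then show "\<epsilon> \<le> norm (u - x)"
          using B[OF x] norm_triangle_ineq2[of u x] by linarith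
      qed (use \<epsilon> in simp)
      then show "indicator Q u *\<^sub>R bump \<epsilon> (u - x) *\<^sub>R \<Xi> u = bump \<epsilon> (u - x) *\<^sub>R \<Xi> u"
        by (auto simp: indicator_def)
    qed
    also have "\<dots> = (\<integral>u. bump \<epsilon> (u - x) *\<^sub>R \<Xi> u \<partial>distr lborel borel ((+) x))"
      by (simp add: lborel_distr_plus)
    also have "\<dots> = (\<integral>v. bump \<epsilon> (x + v - x) *\<^sub>R \<Xi> (x + v) \<partial>lborel)"
      by (intro integral_distr borel_measurable_scaleR)
        (auto intro!: borel_measurable_continuous_onI continuous_intros cont)
    finally show ?thesis by simp
  qed
  define \<Phi> where "\<Phi> x = (1 / Z) *\<^sub>R \<Psi> x" for x
  define M where "M x h = (1 / Z) *\<^sub>R blinfun_apply (integral Q (N x)) h" for x h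
  show thesis
  proof (rule that[of \<Phi> M])
    show "(\<Phi> has_derivative M x) (at x)" for x
      unfolding \<Phi>_def[abs_def] M_def[abs_def]
      by (intro has_derivative_scaleR_right der)
    show "continuous_on UNIV (\<lambda>x. M x v)" for v
      unfolding M_def by (intro continuous_intros contM)
  next
    fix x e assume x: "x \<in> K" and e: "\<And>v. norm v \<le> \<epsilon> \<Longrightarrow> norm (\<Xi> (x + v) - \<Xi> x) \<le> e"
    have "\<Psi> x - Z *\<^sub>R \<Xi> x = (\<integral>v. bump \<epsilon> v *\<^sub>R \<Xi> (x + v) \<partial>lborel) - (\<integral>v. bump \<epsilon> v *\<^sub>R \<Xi> x \<partial>(lborel :: 'a measure))"
      unfolding \<Psi>[OF x] Z_def using intZ by simp
    also have "\<dots> = (\<integral>v. bump \<epsilon> v *\<^sub>R (\<Xi> (x + v) - \<Xi> x) \<partial>lborel)"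
      by (subst Bochner_Integration.integral_diff[symmetric])
        (auto intro!: intv contsh simp: scaleR_diff_right)
    finally have "norm (\<Psi> x - Z *\<^sub>R \<Xi> x) = norm \<dots>" by simp
    also have "\<dots> \<le> (\<integral>v. bump \<epsilon> v * e \<partial>(lborel :: 'a measure))"
    proof (rule Bochner_Integration.integral_norm_bound_integral)
      show "integrable lborel (\<lambda>v. bump \<epsilon> v *\<^sub>R (\<Xi> (x + v) - \<Xi> x))"
        by (intro intv continuous_intros contsh)
      show "integrable lborel (\<lambda>v::'a. bump \<epsilon> v * e)"
        using intZ by simp
      show "norm (bump \<epsilon> v *\<^sub>R (\<Xi> (x + v) - \<Xi> x)) \<le> bump \<epsilon> v * e" for v
      proof (cases "norm v \<le> \<epsilon>")
        case True
        then show ?thesis using e[OF True] by (simp add: bump_nonneg mult_left_mono)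
      next
        case False
        then show ?thesis using bump_eq_0[of \<epsilon> v] \<epsilon> by simp
      qed
    qed
    also have "\<dots> = Z * e" unfolding Z_def by simp
    finally have le: "norm (\<Psi> x - Z *\<^sub>R \<Xi> x) \<le> Z * e" .
    have "\<Phi> x - \<Xi> x = (1 / Z) *\<^sub>R (\<Psi> x - Z *\<^sub>R \<Xi> x)"
      using Z by (simp add: \<Phi>_def scaleR_diff_right)
    then have "norm (\<Phi> x - \<Xi> x) = norm (\<Psi> x - Z *\<^sub>R \<Xi> x) / Z"
      using Z by simp
    also have "\<dots> \<le> e" using le Z by (simp add: divide_le_eq mult.commute)
    finally show "norm (\<Phi> x - \<Xi> x) \<le> e" .
  next
    fix x y assume xy: "x \<in> K" "y \<in> K"
      and mono: "\<And>v. norm v \<le> \<epsilon> \<Longrightarrow> 0 \<le> (\<Xi> (x + v) - \<Xi> (y + v)) \<bullet> (x - y)"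
    have int: "integrable lborel (\<lambda>v. bump \<epsilon> v *\<^sub>R (\<Xi> (x + v) - \<Xi> (y + v)))"
      by (intro intv continuous_intros contsh)
    have "\<Psi> x - \<Psi> y = (\<integral>v. bump \<epsilon> v *\<^sub>R (\<Xi> (x + v) - \<Xi> (y + v)) \<partial>lborel)"
      unfolding \<Psi>[OF xy(1)] \<Psi>[OF xy(2)]
      by (subst Bochner_Integration.integral_diff[symmetric])
        (auto intro!: intv contsh simp: scaleR_diff_right)
    then have "(\<Psi> x - \<Psi> y) \<bullet> (x - y) = (\<integral>v. (bump \<epsilon> v *\<^sub>R (\<Xi> (x + v) - \<Xi> (y + v))) \<bullet> (x - y) \<partial>lborel)"
      using integral_inner_left[of "x - y", OF int] by simp
    also have "\<dots> \<ge> 0"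
    proof (rule Bochner_Integration.integral_nonneg)
      show "0 \<le> (bump \<epsilon> v *\<^sub>R (\<Xi> (x + v) - \<Xi> (y + v))) \<bullet> (x - y)" for v
      proof (cases "norm v \<le> \<epsilon>")
        case True
        then show ?thesis using mono[OF True] by (simp add: bump_nonneg)
      next
        case False
        then show ?thesis using bump_eq_0[of \<epsilon> v] \<epsilon> by simp
      qed
    qed
    finally have "0 \<le> (\<Psi> x - \<Psi> y) \<bullet> (x - y)" .
    moreover have "\<Phi> x - \<Phi> y = (1 / Z) *\<^sub>R (\<Psi> x - \<Psi> y)"
      by (simp add: \<Phi>_def scaleR_diff_right)
    ultimately show "0 \<le> (\<Phi> x - \<Phi> y) \<bullet> (x - y)"
      using Z by simp
  qed
qed

section \<open>Images under monotone maps\<close>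

text \<open>If \<open>f\<close> had no zero, then \<open>y \<mapsto> x - \<eta> f(y) / |f(y)|\<close> would map the ball into its boundary sphere. At
  a fixed point, \<open>f\<close> would point towards the centre, against coercivity.\<close>
lemma ball_coercive_zero:
  fixes f :: "'a::euclidean_space \<Rightarrow> 'a"
  assumes "0 < \<eta>" and cont: "continuous_on (cball x \<eta>) f"
    and coercive: "\<And>y. dist x y = \<eta> \<Longrightarrow> 0 < f y \<bullet> (y - x)"
  shows "\<exists>y\<in>cball x \<eta>. f y = 0"
proof (rule ccontr)
  assume "\<not> ?thesis"
  then have nz: "\<And>y. y \<in> cball x \<eta> \<Longrightarrow> f y \<noteq> 0" by blast
  let ?g = "\<lambda>y. x - (\<eta> / norm (f y)) *\<^sub>R f y"
  have dist: "dist x (?g y) = \<eta>" if "y \<in> cball x \<eta>" for y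
    using nz[OF that] \<open>0 < \<eta>\<close> by (simp add: dist_norm)
  obtain y where y: "y \<in> cball x \<eta>" "?g y = y"
  proof (rule brouwer_ball[OF \<open>0 < \<eta>\<close>, of x ?g])
    show "continuous_on (cball x \<eta>) ?g"
      using nz by (intro continuous_intros cont) auto
  qed (use dist in auto)
  have "y - x = - (\<eta> / norm (f y)) *\<^sub>R f y"
    using y(2) by (simp add: algebra_simps)
  then have "f y \<bullet> (y - x) = - (\<eta> / norm (f y)) * (f y \<bullet> f y)"
    by (simp add: inner_commute)
  also have "\<dots> < 0"
    using nz[OF y(1)] \<open>0 < \<eta>\<close> by simp
  finally show False
    using coercive[of y] dist[OF y(1)] y(2) by simp
qed

text \<open>The homothety of ratio \<open>s\<close> with centre \<open>\<xi> x\<close>, applied to \<open>x\<close>.\<close>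
definition pull :: "('a \<Rightarrow> 'a) \<Rightarrow> real \<Rightarrow> 'a \<Rightarrow> 'a::euclidean_space" where
  "pull \<xi> s x = s *\<^sub>R x + (1 - s) *\<^sub>R \<xi> x"

lemma pull_strongly_monotone:
  assumes "0 \<le> (\<xi> x - \<xi> y) \<bullet> (x - y)" "s \<le> 1"
  shows "s * (norm (x - y))\<^sup>2 \<le> (pull \<xi> s x - pull \<xi> s y) \<bullet> (x - y)"
proof -
  have "(pull \<xi> s x - pull \<xi> s y) \<bullet> (x - y) = s * (norm (x - y))\<^sup>2 + (1 - s) * ((\<xi> x - \<xi> y) \<bullet> (x - y))"
    by (simp add: pull_def power2_norm_eq_inner algebra_simps)
  moreover have "0 \<le> (1 - s) * ((\<xi> x - \<xi> y) \<bullet> (x - y))"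
    using assms by simp
  ultimately show ?thesis by linarith
qed

lemma strongly_monotone_expands:
  assumes "s * (norm (x - y))\<^sup>2 \<le> (w - z) \<bullet> (x - y)"
  shows "s * norm (x - y) \<le> norm (w - z)"
proof (cases "x = y")
  case False
  have "s * norm (x - y) * norm (x - y) \<le> norm (w - z) * norm (x - y)"
    using order_trans[OF assms norm_cauchy_schwarz] by (simp add: power2_eq_square mult.assoc)
  then show ?thesis using False by simp
qed simp

lemma derivative_of_monotone:
  fixes \<Phi> :: "'a::euclidean_space \<Rightarrow> 'a"
  assumes der: "(\<Phi> has_derivative L) (at x)" and "0 < \<delta>"
    and mono: "\<And>y. dist x y < \<delta> \<Longrightarrow> 0 \<le> (\<Phi> y - \<Phi> x) \<bullet> (y - x)"
  shows "0 \<le> L v \<bullet> v"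
proof -
  have 1: "((\<lambda>t. x + t *\<^sub>R v) has_derivative (\<lambda>t. t *\<^sub>R v)) (at (0::real))"
    by (auto intro!: derivative_eq_intros)
  have 2: "(\<Phi> has_derivative L) (at (x + 0 *\<^sub>R v))" using der by simp
  have "bounded_linear L" using der by (rule has_derivative_bounded_linear)
  then have "((\<lambda>t. \<Phi> (x + t *\<^sub>R v) \<bullet> v) has_real_derivative L v \<bullet> v) (at 0)"
    using has_derivative_inner_left[OF has_derivative_compose[OF 1 2], of v]
    by (simp add: has_field_derivative_def linear_simps mult_commute_abs)
  then have "((\<lambda>t. (\<Phi> (x + t *\<^sub>R v) \<bullet> v - \<Phi> x \<bullet> v) / t) \<longlongrightarrow> L v \<bullet> v) (at 0)"
    by (simp add: DERIV_def)
  then have lim: "((\<lambda>t. (\<Phi> (x + t *\<^sub>R v) \<bullet> v - \<Phi> x \<bullet> v) / t) \<longlongrightarrow> L v \<bullet> v) (at_right 0)"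
    by (rule filterlim_mono) (auto simp: at_le)
  show ?thesis
  proof (rule tendsto_lowerbound[OF lim])
    have "((\<lambda>t. norm (t *\<^sub>R v)) \<longlongrightarrow> norm (0 *\<^sub>R v)) (at_right (0::real))"
      by (intro tendsto_intros)
    then have "\<forall>\<^sub>F t in at_right (0::real). norm (t *\<^sub>R v) < \<delta>"
      using \<open>0 < \<delta>\<close> by (intro order_tendstoD(2)) auto
    moreover have "\<forall>\<^sub>F t in at_right (0::real). 0 < t"
      by (rule eventually_at_right_less)
    ultimately show "\<forall>\<^sub>F t in at_right 0. 0 \<le> (\<Phi> (x + t *\<^sub>R v) \<bullet> v - \<Phi> x \<bullet> v) / t"
    proof eventually_elim
      case (elim t)
      have "0 \<le> (\<Phi> (x + t *\<^sub>R v) - \<Phi> x) \<bullet> (t *\<^sub>R v)"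
        using mono[of "x + t *\<^sub>R v"] elim by (simp add: dist_norm)
      then show ?case
        using elim by (simp add: zero_le_mult_iff inner_diff_left)
    qed
  qed simp
qed

text \<open>Strong monotonicity makes the inverse maps uniformly Lipschitz, so preimages of \<open>z\<close> under the
  approximating maps are close to the preimage under \<open>T\<close>. The one delicate point is that \<open>z\<close> has
  such preimages at all: where \<open>k\<close> does not vanish, the preimage under \<open>T\<close> is interior to \<open>K\<close>, and
  coercivity on a small ball yields one.\<close>
lemma strongly_monotone_inverse_converges:
  fixes T :: "'a::euclidean_space \<Rightarrow> 'a" and k :: "'a \<Rightarrow> real"
  assumes K: "compact K" and s: "0 < s"
    and contT: "continuous_on K T" and contTn: "\<And>n::nat. continuous_on K (Tn n)"
    and T: "\<And>x y. x \<in> K \<Longrightarrow> y \<in> K \<Longrightarrow> s * (norm (x - y))\<^sup>2 \<le> (T x - T y) \<bullet> (x - y)"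
    and Tn: "\<And>n x y. x \<in> K \<Longrightarrow> y \<in> K \<Longrightarrow> s * (norm (x - y))\<^sup>2 \<le> (Tn n x - Tn n y) \<bullet> (x - y)"
    and unif: "\<And>e. 0 < e \<Longrightarrow> \<forall>\<^sub>F n in sequentially. \<forall>x\<in>K. norm (Tn n x - T x) < e"
    and k: "continuous_on UNIV k" "\<And>x. k x \<noteq> 0 \<Longrightarrow> x \<in> K"
  shows "(\<lambda>n. indicator (Tn n ` K) z *\<^sub>R k (the_inv_into K (Tn n) z))
      \<longlonglongrightarrow> indicator (T ` K) z *\<^sub>R k (the_inv_into K T z)"
proof -
  have inj: "inj_on f K" if "\<And>x y. x \<in> K \<Longrightarrow> y \<in> K \<Longrightarrow> s * (norm (x - y))\<^sup>2 \<le> (f x - f y) \<bullet> (x - y)" for f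
  proof (rule inj_onI)
    fix x y assume "x \<in> K" "y \<in> K" "f x = f y"
    then have "s * (norm (x - y))\<^sup>2 \<le> 0" using that[of x y] by simp
    then show "x = y" using s by (simp add: mult_le_0_iff)
  qed
  note injT = inj[of T, OF T] and injTn = inj[of "Tn n" for n, OF Tn]
  show ?thesis
  proof (cases "z \<in> T ` K")
    case False
    have "closed (T ` K)"
      by (intro compact_imp_closed compact_continuous_image contT K)
    then obtain e where e: "0 < e" "\<And>y. y \<in> T ` K \<Longrightarrow> e \<le> dist z y"
      using separate_point_closed[OF _ False] by blast
    from unif[OF e(1)] have "\<forall>\<^sub>F n in sequentially. indicator (Tn n ` K) z *\<^sub>R k (the_inv_into K (Tn n) z) = 0"
    proof eventually_elim
      case (elim n)
      have "z \<notin> Tn n ` K"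
      proof
        assume "z \<in> Tn n ` K"
        then obtain x where x: "x \<in> K" "z = Tn n x" by blast
        then show False using elim e(2)[of "T x"] by (force simp: dist_norm)
      qed
      then show ?case by simp
    qed
    then show ?thesis using False by (simp add: tendsto_eventually)
  next
    case True
    then obtain x where x: "x \<in> K" and z: "z = T x" by blast
    have "(\<lambda>n. indicator (Tn n ` K) z *\<^sub>R k (the_inv_into K (Tn n) z)) \<longlonglongrightarrow> k x"
    proof (rule tendstoI)
      fix e :: real assume e: "0 < e"
      have "isCont k x" using k(1) by (simp add: continuous_on_eq_continuous_at)
      then obtain \<eta>1 where \<eta>1: "0 < \<eta>1" "\<And>y. dist y x < \<eta>1 \<Longrightarrow> dist (k y) (k x) < e"
        using e unfolding continuous_at_eps_delta by blast
      have "open (k -` (- {0}))"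
        using k(1) by (intro open_vimage) auto
      then have "\<exists>\<eta>2>0. k x \<noteq> 0 \<longrightarrow> cball x \<eta>2 \<subseteq> K"
      proof (cases "k x = 0")
        case False
        then obtain \<eta>2 where "0 < \<eta>2" "cball x \<eta>2 \<subseteq> k -` (- {0})"
          using \<open>open (k -` (- {0}))\<close> open_contains_cball by blast
        then show ?thesis using k(2) by (intro exI[of _ \<eta>2]) auto
      qed (auto intro: exI[of _ 1])
      then obtain \<eta>2 where \<eta>2: "0 < \<eta>2" "k x \<noteq> 0 \<Longrightarrow> cball x \<eta>2 \<subseteq> K" by blast
      define \<eta> where "\<eta> = min \<eta>1 \<eta>2 / 2"
      have \<eta>: "0 < \<eta>" "\<eta> < \<eta>1" "\<eta> < \<eta>2" using \<eta>1 \<eta>2 by (auto simp: \<eta>_def min_def)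
      have "0 < s * \<eta>" using s \<eta> by simp
      from unif[OF this] show "\<forall>\<^sub>F n in sequentially. dist (indicator (Tn n ` K) z *\<^sub>R k (the_inv_into K (Tn n) z)) (k x) < e"
      proof eventually_elim
        case (elim n)
        show ?case
        proof (cases "z \<in> Tn n ` K")
          case True
          then obtain y where y: "y \<in> K" "z = Tn n y" by blast
          have "s * norm (y - x) \<le> norm (T y - T x)"
            by (rule strongly_monotone_expands[OF T[OF y(1) x]])
          also have "\<dots> < s * \<eta>"
            using elim y z by (auto simp: norm_minus_commute)
          finally have "dist y x < \<eta>1" using s \<eta> by (simp add: dist_norm)
          then show ?thesis
            using \<eta>1(2) y True by (simp add: the_inv_into_f_f[OF injTn])
        next
          case False
          have "k x = 0"
          proof (rule ccontr)
            assume "k x \<noteq> 0"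
            then have sub: "cball x \<eta> \<subseteq> K" using \<eta>2(2) \<eta> by force
            have "\<exists>y\<in>cball x \<eta>. Tn n y - z = 0"
            proof (rule ball_coercive_zero[OF \<eta>(1)])
              show "continuous_on (cball x \<eta>) (\<lambda>y. Tn n y - z)"
                by (intro continuous_intros continuous_on_subset[OF contTn sub])
              fix y assume y: "dist x y = \<eta>"
              then have yK: "y \<in> K" using sub by auto
              have n: "norm (y - x) = \<eta>" using y by (simp add: dist_norm norm_minus_commute)
              have "s * \<eta>\<^sup>2 \<le> (Tn n y - Tn n x) \<bullet> (y - x)"
                using Tn[OF yK x, of n] n by simp
              moreover have "- ((Tn n x - z) \<bullet> (y - x)) \<le> norm (Tn n x - z) * \<eta>"
                using norm_cauchy_schwarz[of "- (Tn n x - z)" "y - x"] n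
                by (simp add: norm_minus_commute inner_diff_left)
              moreover have "norm (Tn n x - z) * \<eta> < s * \<eta> * \<eta>"
                using elim x z \<eta> by simp
              ultimately show "0 < (Tn n y - z) \<bullet> (y - x)"
                by (simp add: power2_eq_square inner_diff_left)
            qed
            then show False using False sub by auto
          qed
          then show ?thesis using False e by simp
        qed
      qed
    qed
    then show ?thesis
      using x by (simp add: z the_inv_into_f_f[OF injT])
  qed
qed

lemma continuous_on_pull [continuous_intros]:
  "continuous_on S \<xi> \<Longrightarrow> continuous_on S (pull \<xi> s)"
  unfolding pull_def[abs_def] by (intro continuous_intros)

lemma inj_on_pull:
  assumes "\<And>x y. x \<in> K \<Longrightarrow> y \<in> K \<Longrightarrow> 0 \<le> (\<xi> x - \<xi> y) \<bullet> (x - y)" "0 < s" "s \<le> 1"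
  shows "inj_on (pull \<xi> s) K"
proof (rule inj_onI)
  fix x y assume "x \<in> K" "y \<in> K" and eq: "pull \<xi> s x = pull \<xi> s y"
  then have "s * norm (x - y) \<le> norm (pull \<xi> s x - pull \<xi> s y)"
    by (intro strongly_monotone_expands pull_strongly_monotone assms)
  then show "x = y" using eq assms by (simp add: mult_le_0_iff)
qed

text \<open>Change of variables turns the integral into that of \<open>k\<close> against the Jacobian, which is
  positive and, for each point, a polynomial in \<open>s\<close>.\<close>
lemma integral_pull_image_smooth:
  fixes \<Phi> :: "'a::euclidean_space \<Rightarrow> 'a" and k :: "'a \<Rightarrow> real"
  assumes K: "compact K" and "0 < \<delta>"
    and der: "\<And>x. (\<Phi> has_derivative M x) (at x)" and contM: "\<And>v. continuous_on UNIV (\<lambda>x. M x v)"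
    and mono: "\<And>x y. x \<in> K \<Longrightarrow> dist x y < \<delta> \<Longrightarrow> 0 \<le> (\<Phi> y - \<Phi> x) \<bullet> (y - x)"
    and monoK: "\<And>x y. x \<in> K \<Longrightarrow> y \<in> K \<Longrightarrow> 0 \<le> (\<Phi> x - \<Phi> y) \<bullet> (x - y)"
    and k: "continuous_on K k"
  shows "poly_on DIM('a) {0<..1} (\<lambda>s. \<integral>z\<in>pull \<Phi> s ` K. k (the_inv_into K (pull \<Phi> s) z) \<partial>lborel)"
proof -
  let ?J = "\<lambda>s x. jacobian (\<lambda>v. s *\<^sub>R v + (1 - s) *\<^sub>R M x v)"
  have lin: "linear (M x)" for x
    using der by (rule has_derivative_linear)
  have derT: "(pull \<Phi> s has_derivative (\<lambda>v. s *\<^sub>R v + (1 - s) *\<^sub>R M x v)) (at x within K)" for s x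
    unfolding pull_def[abs_def]
    by (intro has_derivative_add has_derivative_scaleR_right has_derivative_ident
        has_derivative_at_withinI[OF der])
  have contJ: "continuous_on K (?J s)" for s
    by (intro continuous_on_jacobian continuous_intros continuous_on_subset[OF contM]) auto
  have pos: "0 < ?J s x" if "x \<in> K" "s \<in> {0<..1}" for s x
    using that derivative_of_monotone[OF der \<open>0 < \<delta>\<close> mono] by (intro jacobian_pos lin) auto
  have "poly_on DIM('a) {0<..1} (\<lambda>s. \<integral>x. indicator K x *\<^sub>R (?J s x * k x) \<partial>lborel)"
  proof (rule poly_on_integral)
    show "infinite {0<..1::real}" by simp
    show "integrable lborel (\<lambda>x. indicator K x *\<^sub>R (?J s x * k x))" for s
      by (intro borel_integrable_compact K continuous_intros contJ k)
    show "poly_on DIM('a) {0<..1} (\<lambda>s. indicator K x *\<^sub>R (?J s x * k x))" for x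
    proof -
      have "poly_on DIM('a) {0<..1} (\<lambda>s. (indicator K x * k x) * ?J s x)"
        by (intro poly_on_cmult poly_on_jacobian lin)
      then show ?thesis by (simp add: mult_ac)
    qed
  qed
  also have "?this \<longleftrightarrow> ?thesis"
  proof (rule poly_on_cong)
    fix s :: real assume s: "s \<in> {0<..1}"
    have "(\<integral>z\<in>pull \<Phi> s ` K. k (the_inv_into K (pull \<Phi> s) z) \<partial>lborel) = (\<integral>x\<in>K. \<bar>?J s x\<bar> * k x \<partial>lborel)"
      using s by (intro integral_change_of_variables_compact K derT contJ k inj_on_pull monoK) auto
    also have "\<dots> = (\<integral>x. indicator K x *\<^sub>R (?J s x * k x) \<partial>lborel)"
      unfolding set_lebesgue_integral_def using pos s
      by (intro Bochner_Integration.integral_cong) (auto simp: indicator_def abs_of_pos)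
    finally show "(\<integral>x. indicator K x *\<^sub>R (?J s x * k x) \<partial>lborel) =
      (\<integral>z\<in>pull \<Phi> s ` K. k (the_inv_into K (pull \<Phi> s) z) \<partial>lborel)" ..
  qed
  finally show ?thesis .
qed

lemma borel_measurable_pull_image:
  fixes T :: "'a::euclidean_space \<Rightarrow> 'a" and k :: "'a \<Rightarrow> real"
  assumes "compact K" "continuous_on K T" "inj_on T K" "continuous_on K k"
  shows "integrable lborel (\<lambda>z. indicator (T ` K) z *\<^sub>R k (the_inv_into K T z))"
proof (rule borel_integrable_compact)
  show "compact (T ` K)" by (intro compact_continuous_image assms)
  have "continuous_on (T ` K) (the_inv_into K T)"
    using assms by (intro continuous_on_inv) (auto simp: the_inv_into_f_f)
  then show "continuous_on (T ` K) (\<lambda>z. k (the_inv_into K T z))"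
    by (rule continuous_on_compose2[OF assms(4)]) (auto simp: the_inv_into_f_f[OF assms(3)])
qed

text \<open>The smooth case applied to mollifications of \<open>\<xi>\<close>, followed by dominated convergence.\<close>
proposition integral_pull_image_polynomial:
  fixes \<xi> :: "'a::euclidean_space \<Rightarrow> 'a" and k :: "'a \<Rightarrow> real"
  assumes U: "open U" and cont: "continuous_on U \<xi>"
    and mono: "\<And>x y. x \<in> U \<Longrightarrow> y \<in> U \<Longrightarrow> 0 \<le> (\<xi> x - \<xi> y) \<bullet> (x - y)"
    and K: "compact K" "K \<subseteq> U" and k: "continuous_on UNIV k" "\<And>x. k x \<noteq> 0 \<Longrightarrow> x \<in> K"
  shows "poly_on DIM('a) {0<..1} (\<lambda>s. \<integral>z\<in>pull \<xi> s ` K. k (the_inv_into K (pull \<xi> s) z) \<partial>lborel)"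
proof (cases "K = {}")
  case True
  then show ?thesis by (simp add: poly_on_const set_lebesgue_integral_def)
next
  case False
  obtain e where e: "0 < e" "(\<Union>x\<in>K. cball x e) \<subseteq> U"
    using compact_subset_open_imp_cball_epsilon_subset[OF K(1) U K(2)] .
  let ?h = "\<lambda>\<xi> s z. indicator (pull \<xi> s ` K) z *\<^sub>R k (the_inv_into K (pull \<xi> s) z)"
  let ?H = "\<lambda>\<xi> s. \<integral>z\<in>pull \<xi> s ` K. k (the_inv_into K (pull \<xi> s) z) \<partial>lborel"
  define \<delta> where "\<delta> = e / 2"
  have \<delta>: "0 < \<delta>" using e by (simp add: \<delta>_def)
  define N where "N c = {x. infdist x K \<le> c}" for c
  have compN: "compact (N c)" if "0 < c" for c
    unfolding N_def using compact_infdist_le[OF False K(1) that] .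
  have KN: "K \<subseteq> N c" if "0 < c" for c using that by (auto simp: N_def)
  have NU: "N e \<subseteq> U"
  proof
    fix x assume x: "x \<in> N e"
    obtain a where "a \<in> K" "infdist x K = dist x a"
      using infdist_attains_inf[OF compact_imp_closed[OF K(1)] False] by blast
    moreover from this have "x \<in> cball a e" using x by (simp add: N_def dist_commute)
    ultimately show "x \<in> U" using e(2) by blast
  qed
  have NN: "x + v \<in> N e" if "x \<in> N \<delta>" "norm v \<le> \<delta>" for x v
    using infdist_triangle[of "x + v" K x] that by (simp add: N_def \<delta>_def dist_norm)
  obtain \<Xi> where \<Xi>: "continuous_on UNIV \<Xi>" "\<And>x. x \<in> N e \<Longrightarrow> \<Xi> x = \<xi> x"
    using Tietze_unbounded[of "N e" \<xi> UNIV] continuous_on_subset[OF cont NU] compact_imp_closed[OF compN[OF e(1)]]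
    by auto
  (* All requirements on the n-th mollification in one predicate, so that a sequence can be chosen. *)
  define smooth where "smooth n p \<longleftrightarrow> (case p of (\<Phi>, M) \<Rightarrow>
       (\<forall>x. (\<Phi> has_derivative M x) (at x)) \<and> (\<forall>v. continuous_on UNIV (\<lambda>x. M x v)) \<and>
       (\<forall>x c. x \<in> N \<delta> \<longrightarrow> (\<forall>v. norm v \<le> \<delta> / (real n + 1) \<longrightarrow> norm (\<Xi> (x + v) - \<Xi> x) \<le> c) \<longrightarrow>
          norm (\<Phi> x - \<Xi> x) \<le> c) \<and>
       (\<forall>x y. x \<in> N \<delta> \<longrightarrow> y \<in> N \<delta> \<longrightarrow>
          (\<forall>v. norm v \<le> \<delta> / (real n + 1) \<longrightarrow> 0 \<le> (\<Xi> (x + v) - \<Xi> (y + v)) \<bullet> (x - y)) \<longrightarrow>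
          0 \<le> (\<Phi> x - \<Phi> y) \<bullet> (x - y)))"
    for n :: nat and p :: "('a \<Rightarrow> 'a) \<times> ('a \<Rightarrow> 'a \<Rightarrow> 'a)"
  have "\<exists>p. smooth n p" for n
  proof -
    have "0 < \<delta> / (real n + 1)" using \<delta> by simp
    then obtain \<Phi> M where "\<And>x. (\<Phi> has_derivative M x) (at x)" "\<And>v. continuous_on UNIV (\<lambda>x. M x v)"
      "\<And>x c. x \<in> N \<delta> \<Longrightarrow> (\<And>v. norm v \<le> \<delta> / (real n + 1) \<Longrightarrow> norm (\<Xi> (x + v) - \<Xi> x) \<le> c) \<Longrightarrow>
        norm (\<Phi> x - \<Xi> x) \<le> c"
      "\<And>x y. x \<in> N \<delta> \<Longrightarrow> y \<in> N \<delta> \<Longrightarrow>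
        (\<And>v. norm v \<le> \<delta> / (real n + 1) \<Longrightarrow> 0 \<le> (\<Xi> (x + v) - \<Xi> (y + v)) \<bullet> (x - y)) \<Longrightarrow>
        0 \<le> (\<Phi> x - \<Phi> y) \<bullet> (x - y)"
      using mollification[OF \<Xi>(1) compact_imp_bounded[OF compN[OF \<delta>]]] by metis
    then have "smooth n (\<Phi>, M)" unfolding smooth_def by simp
    then show ?thesis ..
  qed
  then obtain p where p: "\<And>n. smooth n (p n)" by metis
  define \<Phi> where "\<Phi> n = fst (p n)" for n
  define M where "M n = snd (p n)" for n
  have sm: "smooth n (\<Phi> n, M n)" for n using p by (simp add: \<Phi>_def M_def)
  have der: "(\<Phi> n has_derivative M n x) (at x)" for n x
    using sm[of n] unfolding smooth_def by simp
  have contM: "continuous_on UNIV (\<lambda>x. M n x v)" for n v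
    using sm[of n] unfolding smooth_def by simp
  have near: "norm (\<Phi> n x - \<Xi> x) \<le> c"
    if "x \<in> N \<delta>" "\<And>v. norm v \<le> \<delta> / (real n + 1) \<Longrightarrow> norm (\<Xi> (x + v) - \<Xi> x) \<le> c" for n x c
    using sm[of n] that unfolding smooth_def by simp
  have mono\<Phi>': "0 \<le> (\<Phi> n x - \<Phi> n y) \<bullet> (x - y)"
    if "x \<in> N \<delta>" "y \<in> N \<delta>"
      "\<And>v. norm v \<le> \<delta> / (real n + 1) \<Longrightarrow> 0 \<le> (\<Xi> (x + v) - \<Xi> (y + v)) \<bullet> (x - y)" for n x y
    using sm[of n] that unfolding smooth_def by simp
  have small: "\<delta> / (real n + 1) \<le> \<delta>" for n using \<delta> by (simp add: divide_le_eq)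
  have mono\<Phi>: "0 \<le> (\<Phi> n x - \<Phi> n y) \<bullet> (x - y)" if "x \<in> N \<delta>" "y \<in> N \<delta>" for n x y
  proof (rule mono\<Phi>'[OF that])
    fix v :: 'a assume "norm v \<le> \<delta> / (real n + 1)"
    then have v: "norm v \<le> \<delta>" using small order_trans by blast
    show "0 \<le> (\<Xi> (x + v) - \<Xi> (y + v)) \<bullet> (x - y)"
      using mono[of "x + v" "y + v"] NN[OF that(1) v] NN[OF that(2) v] NU \<Xi>(2) by auto
  qed
  have unif: "\<forall>\<^sub>F n in sequentially. \<forall>x\<in>K. norm (\<Phi> n x - \<xi> x) < c" if "0 < c" for c
  proof -
    have "uniformly_continuous_on (N e) \<Xi>"
      by (intro compact_uniformly_continuous continuous_on_subset[OF \<Xi>(1)] compN e) auto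
    then obtain d where d: "0 < d" "\<And>x y. x \<in> N e \<Longrightarrow> y \<in> N e \<Longrightarrow> dist y x < d \<Longrightarrow> dist (\<Xi> y) (\<Xi> x) < c / 2"
      using \<open>0 < c\<close> unfolding uniformly_continuous_on_def by (metis half_gt_zero)
    have "(\<lambda>n. \<delta> / (real n + 1)) \<longlonglongrightarrow> 0"
      using tendsto_mult_right_zero[OF LIMSEQ_inverse_real_of_nat, of \<delta>]
      by (simp add: divide_inverse add.commute)
    then have "\<forall>\<^sub>F n in sequentially. \<delta> / (real n + 1) < d"
      using d(1) by (rule order_tendstoD(2))
    then show ?thesis
    proof eventually_elim
      case (elim n)
      show ?case
      proof
        fix x assume "x \<in> K"
        then have x: "x \<in> N \<delta>" "x \<in> N e" using KN \<delta> e by auto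
        have "norm (\<Phi> n x - \<Xi> x) \<le> c / 2"
        proof (rule near[OF x(1)])
          fix v :: 'a assume v: "norm v \<le> \<delta> / (real n + 1)"
          then have "x + v \<in> N e" using NN[OF x(1)] small[of n] by auto
          then show "norm (\<Xi> (x + v) - \<Xi> x) \<le> c / 2"
            using d(2)[OF x(2), of "x + v"] v elim by (simp add: dist_norm)
        qed
        then show "norm (\<Phi> n x - \<xi> x) < c" using \<Xi>(2)[OF x(2)] \<open>0 < c\<close> by simp
      qed
    qed
  qed
  have K\<delta>: "K \<subseteq> N \<delta>" using KN[OF \<delta>] .
  have cont\<xi>: "continuous_on K \<xi>" using continuous_on_subset[OF cont K(2)] .
  have monoK: "0 \<le> (\<xi> x - \<xi> y) \<bullet> (x - y)" if "x \<in> K" "y \<in> K" for x y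
    using mono that K(2) by blast
  have cont\<Phi>: "continuous_on S (\<Phi> n)" for n S
    using der by (meson continuous_at_imp_continuous_on has_derivative_continuous)
  have contk: "continuous_on K k" by (rule continuous_on_subset[OF k(1)]) auto
  have poly: "poly_on DIM('a) {0<..1} (\<lambda>s. ?H (\<Phi> n) s)" for n
  proof (rule integral_pull_image_smooth[OF K(1) \<delta> der contM])
    fix x y assume "x \<in> K" "dist x y < \<delta>"
    then show "0 \<le> (\<Phi> n y - \<Phi> n x) \<bullet> (y - x)"
      using infdist_le2[of x K y \<delta>] K\<delta> by (intro mono\<Phi>) (auto simp: N_def dist_commute)
  qed (use mono\<Phi> K\<delta> contk in auto)
  obtain Ck where Ck: "\<And>x. x \<in> K \<Longrightarrow> \<bar>k x\<bar> \<le> Ck"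
    using compact_continuous_image[OF contk K(1), THEN compact_imp_bounded] by (auto simp: bounded_iff)
  obtain B where B: "\<And>x. x \<in> K \<Longrightarrow> norm x \<le> B"
    using K(1)[THEN compact_imp_bounded] by (auto simp: bounded_iff)
  obtain B' where B': "\<And>x. x \<in> K \<Longrightarrow> norm (\<xi> x) \<le> B'"
    using compact_continuous_image[OF cont\<xi> K(1), THEN compact_imp_bounded] by (auto simp: bounded_iff)
  obtain n0 where n0: "\<And>n x. n0 \<le> n \<Longrightarrow> x \<in> K \<Longrightarrow> norm (\<Phi> n x - \<xi> x) < 1"
    using unif[of 1] by (auto simp: eventually_sequentially)
  show ?thesis
  proof (rule poly_on_limit)
    show "infinite {0<..1::real}" by simp
    show "poly_on DIM('a) {0<..1} (\<lambda>s. ?H (\<Phi> (n + n0)) s)" for n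
      by (rule poly)
    fix s :: real assume "s \<in> {0<..1}"
    then have s: "0 < s" "s \<le> 1" by auto
    show "(\<lambda>n. ?H (\<Phi> (n + n0)) s)
      \<longlonglongrightarrow> (?H \<xi> s)"
      unfolding set_lebesgue_integral_def
    proof (rule integral_dominated_convergence[where w="\<lambda>z. indicator (cball 0 (B + B' + 1)) z *\<^sub>R Ck"])
      have inj: "inj_on (pull (\<Phi> n) s) K" for n
        using s mono\<Phi> K\<delta> by (intro inj_on_pull) auto
      show "(\<lambda>z. ?h \<xi> s z) \<in> borel_measurable lborel"
        using s by (intro borel_measurable_integrable borel_measurable_pull_image K continuous_on_pull
            cont\<xi> inj_on_pull monoK contk)
      show "(\<lambda>z. ?h (\<Phi> (n + n0)) s z) \<in> borel_measurable lborel" for n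
        by (intro borel_measurable_integrable borel_measurable_pull_image K continuous_on_pull cont\<Phi> inj contk)
      show "integrable lborel (\<lambda>z. indicator (cball (0::'a) (B + B' + 1)) z *\<^sub>R Ck)"
        by (intro borel_integrable_compact) auto
      show "AE z in lborel. norm (?h (\<Phi> (n + n0)) s z)
          \<le> indicator (cball 0 (B + B' + 1)) z *\<^sub>R Ck" for n
      proof (rule AE_I2)
        fix z
        let ?n = "n + n0"
        show "norm (?h (\<Phi> ?n) s z)
          \<le> indicator (cball 0 (B + B' + 1)) z *\<^sub>R Ck"
        proof (cases "z \<in> pull (\<Phi> ?n) s ` K")
          case True
          then obtain x where x: "x \<in> K" "z = pull (\<Phi> ?n) s x" by blast
          have "norm (\<Phi> ?n x) \<le> B' + 1"
            using n0[of ?n x] B'[OF x(1)] x(1) norm_triangle_ineq2[of "\<Phi> ?n x" "\<xi> x"] by auto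
          then have "norm z \<le> s * B + (1 - s) * (B' + 1)"
            unfolding x(2) pull_def using s B[OF x(1)]
            by (intro norm_triangle_le add_mono) (auto intro!: mult_left_mono)
          also have "\<dots> \<le> 1 * B + 1 * (B' + 1)"
            using s B[OF x(1)] B'[OF x(1)] norm_ge_zero[of x] norm_ge_zero[of "\<xi> x"]
            by (intro add_mono mult_right_mono) linarith+
          finally have "z \<in> cball 0 (B + B' + 1)" by simp
          then show ?thesis using True x Ck by (simp add: the_inv_into_f_f[OF inj])
        next
          case False
          have "0 \<le> Ck" using Ck \<open>K \<noteq> {}\<close> by force
          then show ?thesis using False by simp
        qed
      qed
      show "AE z in lborel. (\<lambda>n. ?h (\<Phi> (n + n0)) s z)
         \<longlonglongrightarrow> ?h \<xi> s z"
      proof (rule AE_I2, rule LIMSEQ_ignore_initial_segment, rule strongly_monotone_inverse_converges[OF K(1) s(1)])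
        show "s * (norm (x - y))\<^sup>2 \<le> (pull \<xi> s x - pull \<xi> s y) \<bullet> (x - y)" if "x \<in> K" "y \<in> K" for x y
          using that s by (intro pull_strongly_monotone monoK)
        show "s * (norm (x - y))\<^sup>2 \<le> (pull (\<Phi> n) s x - pull (\<Phi> n) s y) \<bullet> (x - y)" if "x \<in> K" "y \<in> K" for x y n
          using that s K\<delta> by (intro pull_strongly_monotone mono\<Phi>) auto
        fix c :: real assume "0 < c"
        from unif[OF this] show "\<forall>\<^sub>F n in sequentially. \<forall>x\<in>K. norm (pull (\<Phi> n) s x - pull \<xi> s x) < c"
        proof eventually_elim
          case (elim n)
          show ?case
          proof
            fix x assume x: "x \<in> K"
            have "pull (\<Phi> n) s x - pull \<xi> s x = (1 - s) *\<^sub>R (\<Phi> n x - \<xi> x)"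
              by (simp add: pull_def scaleR_diff_right)
            then have "norm (pull (\<Phi> n) s x - pull \<xi> s x) = (1 - s) * norm (\<Phi> n x - \<xi> x)"
              using s by simp
            also have "\<dots> \<le> 1 * norm (\<Phi> n x - \<xi> x)"
              using s by (intro mult_right_mono) auto
            finally show "norm (pull (\<Phi> n) s x - pull \<xi> s x) < c"
              using elim x by force
          qed
        qed
      qed (intro continuous_on_pull cont\<xi> cont\<Phi> k | assumption)+
    qed
  qed
qed

text \<open>The indicator function of \<open>E\<close> is a decreasing limit of continuous functions supported near \<open>E\<close>.\<close>
theorem measure_pull_image_polynomial:
  fixes \<xi> :: "'a::euclidean_space \<Rightarrow> 'a"
  assumes U: "open U" and cont: "continuous_on U \<xi>"
    and mono: "\<And>x y. x \<in> U \<Longrightarrow> y \<in> U \<Longrightarrow> 0 \<le> (\<xi> x - \<xi> y) \<bullet> (x - y)"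
    and E: "compact E" "E \<subseteq> U"
  shows "poly_on DIM('a) {0<..1} (\<lambda>s. measure lborel (pull \<xi> s ` E))"
proof (cases "E = {}")
  case True
  then show ?thesis by (simp add: poly_on_const)
next
  case False
  obtain e where e: "0 < e" "(\<Union>x\<in>E. cball x e) \<subseteq> U"
    using compact_subset_open_imp_cball_epsilon_subset[OF E(1) U E(2)] .
  define K where "K = {x. infdist x E \<le> e}"
  have K: "compact K" unfolding K_def using compact_infdist_le[OF False E(1) e(1)] .
  have KU: "K \<subseteq> U"
  proof
    fix x assume x: "x \<in> K"
    obtain a where "a \<in> E" "infdist x E = dist x a"
      using infdist_attains_inf[OF compact_imp_closed[OF E(1)] False] by blast
    moreover from this have "x \<in> cball a e" using x by (simp add: K_def dist_commute)
    ultimately show "x \<in> U" using e(2) by blast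
  qed
  have EK: "E \<subseteq> K" using e by (auto simp: K_def)
  define k where "k n x = max 0 (1 - (real n + 1) / e * infdist x E)" for n :: nat and x
  have contk: "continuous_on S (k n)" for n S
    unfolding k_def[abs_def] by (intro continuous_intros)
  have suppk: "x \<in> K" if "k n x \<noteq> 0" for n x
  proof (rule ccontr)
    assume "x \<notin> K"
    then have "1 \<le> infdist x E / e" using e by (simp add: K_def le_divide_eq)
    also have "\<dots> \<le> (real n + 1) * (infdist x E / e)"
      using e infdist_nonneg[of x E] mult_right_mono[of 1 "real n + 1" "infdist x E / e"] by simp
    finally show False using that by (simp add: k_def)
  qed
  have k01: "0 \<le> k n x" "k n x \<le> 1" for n x
    using e infdist_nonneg[of x E] by (auto simp: k_def)
  have limk: "(\<lambda>n. k n x) \<longlonglongrightarrow> indicator E x" for x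
  proof (cases "x \<in> E")
    case True
    then show ?thesis by (simp add: k_def)
  next
    case False
    then have pos: "0 < infdist x E / e"
      using e \<open>E \<noteq> {}\<close> in_closed_iff_infdist_zero[OF compact_imp_closed[OF E(1)]] infdist_nonneg[of x E]
      by (auto simp: less_le)
    obtain m where m: "1 < real m * (infdist x E / e)"
      using reals_Archimedean3[OF pos] by blast
    have "k n x = 0" if "m \<le> n" for n
    proof -
      have "1 \<le> real m * (infdist x E / e)" using m by simp
      also have "\<dots> \<le> (real n + 1) * (infdist x E / e)"
        using that pos by (intro mult_right_mono) auto
      finally show ?thesis by (simp add: k_def)
    qed
    then have "\<forall>\<^sub>F n in sequentially. k n x = 0"
      by (auto simp: eventually_sequentially)
    then show ?thesis using False by (simp add: tendsto_eventually)
  qed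
  have cont\<xi>: "continuous_on K \<xi>" using continuous_on_subset[OF cont KU] .
  have monoK: "0 \<le> (\<xi> x - \<xi> y) \<bullet> (x - y)" if "x \<in> K" "y \<in> K" for x y
    using mono that KU by blast
  show ?thesis
  proof (rule poly_on_limit)
    show "infinite {0<..1::real}" by simp
    show "poly_on DIM('a) {0<..1} (\<lambda>s. \<integral>z\<in>pull \<xi> s ` K. k n (the_inv_into K (pull \<xi> s) z) \<partial>lborel)" for n
      by (rule integral_pull_image_polynomial[OF U cont mono K KU contk suppk])
    fix s :: real assume "s \<in> {0<..1}"
    then have s: "0 < s" "s \<le> 1" by auto
    have inj: "inj_on (pull \<xi> s) K"
      using s by (intro inj_on_pull monoK) auto
    have comp: "compact (pull \<xi> s ` K)" "compact (pull \<xi> s ` E)"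
      by (intro compact_continuous_image continuous_on_pull continuous_on_subset[OF cont\<xi>] K E EK order_refl)+
    have "(\<lambda>n. \<integral>z\<in>pull \<xi> s ` K. k n (the_inv_into K (pull \<xi> s) z) \<partial>lborel)
       \<longlonglongrightarrow> (\<integral>z. indicator (pull \<xi> s ` E) z \<partial>lborel)"
      unfolding set_lebesgue_integral_def
    proof (rule integral_dominated_convergence[where w="indicator (pull \<xi> s ` K)"])
      show "(\<lambda>z. indicator (pull \<xi> s ` K) z *\<^sub>R k n (the_inv_into K (pull \<xi> s) z)) \<in> borel_measurable lborel" for n
        by (intro borel_measurable_integrable borel_measurable_pull_image K continuous_on_pull cont\<xi> inj contk)
      show "(indicator (pull \<xi> s ` E) :: 'a \<Rightarrow> real) \<in> borel_measurable lborel"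
        using comp by (auto intro!: borel_measurable_indicator borel_compact)
      show "integrable lborel (indicator (pull \<xi> s ` K) :: 'a \<Rightarrow> real)"
        using emeasure_compact_finite[OF comp(1)] comp(1)
        by (intro integrable_real_indicator) (auto intro: borel_compact)
      show "AE z in lborel. norm (indicator (pull \<xi> s ` K) z *\<^sub>R k n (the_inv_into K (pull \<xi> s) z)) \<le> indicator (pull \<xi> s ` K) z" for n
        using k01 by (intro AE_I2) (auto simp: indicator_def)
      show "AE z in lborel. (\<lambda>n. indicator (pull \<xi> s ` K) z *\<^sub>R k n (the_inv_into K (pull \<xi> s) z)) \<longlonglongrightarrow> indicator (pull \<xi> s ` E) z"
      proof (rule AE_I2)
        fix z
        show "(\<lambda>n. indicator (pull \<xi> s ` K) z *\<^sub>R k n (the_inv_into K (pull \<xi> s) z)) \<longlonglongrightarrow> indicator (pull \<xi> s ` E) z"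
        proof (cases "z \<in> pull \<xi> s ` K")
          case True
          then obtain x where x: "x \<in> K" "z = pull \<xi> s x" by blast
          have "z \<in> pull \<xi> s ` E \<longleftrightarrow> x \<in> E"
            using x inj EK by (auto dest: inj_onD)
          then show ?thesis
            using limk[of x] x by (simp add: the_inv_into_f_f[OF inj] indicator_def)
        next
          case False
          then show ?thesis using EK by (auto simp: indicator_def)
        qed
      qed
    qed
    also have "(\<integral>z. indicator (pull \<xi> s ` E) z \<partial>lborel) = measure lborel (pull \<xi> s ` E)"
      by simp
    finally show "(\<lambda>n. \<integral>z\<in>pull \<xi> s ` K. k n (the_inv_into K (pull \<xi> s) z) \<partial>lborel)
       \<longlonglongrightarrow> measure lborel (pull \<xi> s ` E)" .
  qed
qed

section \<open>Nearest points\<close>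

lemma dist_closest_point:
  assumes "closed D" "D \<noteq> {}"
  shows "dist x (closest_point D x) = infdist x D"
  using assms closest_point_exists[OF assms, of x]
  by (intro antisym infdist_le) (auto simp: infdist_notempty intro: cINF_greatest)

lemma closest_point_in_nearest_points:
  assumes "closed D" "D \<noteq> {}"
  shows "closest_point D x \<in> nearest_points D x"
  using dist_closest_point[OF assms] closest_point_in_set[OF assms] by (simp add: nearest_points_def)

lemma nearest_pointsI:
  assumes "y \<in> D" "\<And>z. z \<in> D \<Longrightarrow> dist x y \<le> dist x z"
  shows "y \<in> nearest_points D x"
proof -
  have "D \<noteq> {}" using assms(1) by blast
  then have "dist x y \<le> infdist x D"
    using assms(2) by (auto simp: infdist_notempty intro: cINF_greatest)
  then show ?thesis
    using assms(1) infdist_le[OF assms(1), of x] by (simp add: nearest_points_def)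
qed

lemma nearest_points_dist_le: "y \<in> nearest_points D x \<Longrightarrow> z \<in> D \<Longrightarrow> dist x y \<le> dist x z"
  by (simp add: nearest_points_def infdist_le)

text \<open>Exchanging the two nearest points cannot decrease the sum of the squared distances.\<close>
lemma nearest_points_monotone:
  assumes "y \<in> nearest_points D x" "y' \<in> nearest_points D x'"
  shows "0 \<le> (y - y') \<bullet> (x - x')"
proof -
  have mem: "y \<in> D" "y' \<in> D" using assms by (auto simp: nearest_points_def)
  have "(dist x y)\<^sup>2 \<le> (dist x y')\<^sup>2" "(dist x' y')\<^sup>2 \<le> (dist x' y)\<^sup>2"
    using nearest_points_dist_le[OF assms(1) mem(2)] nearest_points_dist_le[OF assms(2) mem(1)]
    by (auto intro!: power_mono)
  then show ?thesis
    by (simp add: dist_norm power2_norm_eq_inner algebra_simps inner_commute)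
qed

lemma nearest_points_segment:
  assumes "y \<in> nearest_points D x" "0 \<le> s" "s \<le> 1"
  shows "y \<in> nearest_points D (y + s *\<^sub>R (x - y))" "infdist (y + s *\<^sub>R (x - y)) D = s * infdist x D"
proof -
  have y: "y \<in> D" "dist x y = infdist x D" using assms by (auto simp: nearest_points_def)
  have d: "dist (y + s *\<^sub>R (x - y)) y = s * dist x y" using assms by (simp add: dist_norm)
  have d': "dist x (y + s *\<^sub>R (x - y)) = (1 - s) * dist x y"
  proof -
    have "x - (y + s *\<^sub>R (x - y)) = (1 - s) *\<^sub>R (x - y)" by (simp add: algebra_simps)
    then show ?thesis using assms by (simp add: dist_norm)
  qed
  show *: "y \<in> nearest_points D (y + s *\<^sub>R (x - y))"
  proof (rule nearest_pointsI[OF y(1)])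
    fix z assume "z \<in> D"
    have "dist x y \<le> dist x z" by (rule nearest_points_dist_le[OF assms(1) \<open>z \<in> D\<close>])
    also have "\<dots> \<le> (1 - s) * dist x y + dist (y + s *\<^sub>R (x - y)) z"
      using dist_triangle[of x z "y + s *\<^sub>R (x - y)"] d' by simp
    finally show "dist (y + s *\<^sub>R (x - y)) y \<le> dist (y + s *\<^sub>R (x - y)) z"
      unfolding d by (simp add: algebra_simps)
  qed
  show "infdist (y + s *\<^sub>R (x - y)) D = s * infdist x D"
    using * d y by (simp add: nearest_points_def)
qed

definition unique_nearest_within :: "'a::euclidean_space set \<Rightarrow> real \<Rightarrow> bool" where
  "unique_nearest_within D R \<longleftrightarrow> (\<forall>x. infdist x D < R \<longrightarrow> card (nearest_points D x) = 1)"

lemma nearest_points_unique: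
  assumes "closed D" "D \<noteq> {}" "unique_nearest_within D R" "infdist x D < R"
  shows "nearest_points D x = {closest_point D x}"
  using assms closest_point_in_nearest_points[OF assms(1,2), of x]
  by (metis card_1_singletonE singletonD unique_nearest_within_def)

lemma less_reach_unique:
  assumes "ereal \<rho> < reach D"
  obtains R where "\<rho> < R" "unique_nearest_within D R"
proof -
  obtain R where "ereal \<rho> < ereal R" "\<forall>x. infdist x D < R \<longrightarrow> card (nearest_points D x) = 1"
    using assms unfolding reach_def less_Sup_iff by blast
  then show thesis using that by (simp add: unique_nearest_within_def)
qed

lemma unique_le_reach:
  assumes "unique_nearest_within D R" "0 \<le> R"
  shows "ereal R \<le> reach D"
  using assms unfolding reach_def unique_nearest_within_def by (intro Sup_upper) blast

text \<open>Every subsequential limit of projections of points tending to \<open>x\<close> is a nearest point of \<open>x\<close>, and there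
  is only one.\<close>
lemma continuous_on_closest_point_unique:
  assumes D: "closed D" "D \<noteq> {}" and u: "unique_nearest_within D R"
  shows "continuous_on {x. infdist x D < R} (closest_point D)"
  unfolding continuous_on_sequentially
proof (intro allI ballI impI, elim conjE)
  fix X x assume x: "x \<in> {x. infdist x D < R}" and X: "\<forall>n. X n \<in> {x. infdist x D < R}" "X \<longlonglongrightarrow> x"
  show "(closest_point D \<circ> X) \<longlonglongrightarrow> closest_point D x"
  proof (rule ccontr)
    assume "\<not> ?thesis"
    then obtain e where e: "0 < e" "\<exists>\<^sub>F n in sequentially. e \<le> dist (closest_point D (X n)) (closest_point D x)"
      unfolding tendsto_iff by (auto simp: frequently_def not_le)
    have "infinite {n. e \<le> dist (closest_point D (X n)) (closest_point D x)}"
      using e(2) unfolding frequently_def cofinite_eq_sequentially[symmetric] eventually_cofinite by simp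
    then obtain r :: "nat \<Rightarrow> nat" where r: "strict_mono r" "\<And>n. e \<le> dist (closest_point D (X (r n))) (closest_point D x)"
      using infinite_enumerate by blast
    have Xr: "(X \<circ> r) \<longlonglongrightarrow> x" using X(2) r(1) LIMSEQ_subseq_LIMSEQ by blast
    have inf: "(\<lambda>n. infdist ((X \<circ> r) n) D) \<longlonglongrightarrow> infdist x D"
      by (intro tendsto_intros Xr)
    have "bounded (range (\<lambda>n. closest_point D ((X \<circ> r) n)))"
    proof -
      obtain B1 where B1: "\<And>n. norm ((X \<circ> r) n) \<le> B1"
        using convergent_imp_bounded[OF Xr] by (auto simp: bounded_iff)
      have "norm (closest_point D ((X \<circ> r) n)) \<le> B1 + R" for n
      proof -
        let ?x = "(X \<circ> r) n"
        have "norm (closest_point D ?x) \<le> norm ?x + dist ?x (closest_point D ?x)"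
          by norm
        moreover have "infdist ?x D < R" using X(1) by simp
        ultimately show ?thesis using dist_closest_point[OF D, of ?x] B1[of n] by linarith
      qed
      then show ?thesis by (auto simp: bounded_iff)
    qed
    then obtain l q where q: "strict_mono (q :: nat \<Rightarrow> nat)" "((\<lambda>n. closest_point D ((X \<circ> r) n)) \<circ> q) \<longlonglongrightarrow> l"
      using bounded_imp_convergent_subsequence by blast
    have "l \<in> D"
      by (rule closed_sequentially[OF D(1) _ q(2)]) (auto intro: closest_point_in_set[OF D])
    moreover have "dist x l = infdist x D"
    proof (rule LIMSEQ_unique)
      show "(\<lambda>n. dist ((X \<circ> r \<circ> q) n) (((\<lambda>n. closest_point D ((X \<circ> r) n)) \<circ> q) n)) \<longlonglongrightarrow> dist x l"
        by (intro tendsto_dist q(2) LIMSEQ_subseq_LIMSEQ[OF Xr q(1)])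
      show "(\<lambda>n. dist ((X \<circ> r \<circ> q) n) (((\<lambda>n. closest_point D ((X \<circ> r) n)) \<circ> q) n)) \<longlonglongrightarrow> infdist x D"
        using LIMSEQ_subseq_LIMSEQ[OF inf q(1)] by (simp add: dist_closest_point[OF D] o_def)
    qed
    ultimately have "l = closest_point D x"
      using nearest_points_unique[OF D u, of x] x by (auto simp: nearest_points_def)
    moreover have "e \<le> dist l (closest_point D x)"
      by (rule tendsto_lowerbound[OF tendsto_dist[OF q(2) tendsto_const]])
        (use r(2) in auto)
    ultimately show False using e by simp
  qed
qed

text \<open>Suppose that the normal ray from \<open>y\<close> through \<open>x\<close> stopped projecting to \<open>y\<close> at a point \<open>x\<^sub>0\<close> closer to
  \<open>D\<close> than \<open>R\<close>. Sending \<open>x'\<close> to the point at distance \<open>\<epsilon>\<close> from \<open>x\<^sub>0\<close> opposite to the projection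
  of \<open>x'\<close> is a continuous self-map of a small ball. At a fixed point \<open>x\<^sub>1\<close>, the point \<open>x\<^sub>0\<close> lies on the
  segment from \<open>x\<^sub>1\<close> to its projection, so both have the projection \<open>y\<close>, and \<open>x\<^sub>1\<close> extends
  the ray beyond \<open>x\<^sub>0\<close>.\<close>
proposition nearest_points_ray:
  assumes D: "closed D" "D \<noteq> {}" and u: "unique_nearest_within D R"
    and y: "y \<in> nearest_points D x" and x: "x \<notin> D" and l: "1 \<le> c" "c * infdist x D < R"
  shows "y \<in> nearest_points D (y + c *\<^sub>R (x - y))"
proof -
  define n where "n = (x - y) /\<^sub>R norm (x - y)"
  define d where "d = infdist x D"
  define t1 where "t1 = c * d"
  have yD: "y \<in> D" and d: "d = norm (x - y)" using y by (auto simp: nearest_points_def d_def dist_norm)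
  have d0: "0 < d" using x yD d by auto
  have nn: "norm n = 1" using d d0 by (simp add: n_def)
  have xn: "x = y + d *\<^sub>R n" using d d0 by (simp add: n_def)
  define S where "S = {t. 0 \<le> t \<and> t \<le> t1 \<and> y \<in> nearest_points D (y + t *\<^sub>R n)}"
  have dS: "d \<in> S" using xn y d0 l by (auto simp: S_def t1_def)
  have Siff: "y \<in> nearest_points D (y + t *\<^sub>R n) \<longleftrightarrow> infdist (y + t *\<^sub>R n) D = t" if "0 \<le> t" for t
    using yD nn that by (auto simp: nearest_points_def dist_norm)
  have "closed {t. 0 \<le> t \<and> t \<le> t1 \<and> infdist (y + t *\<^sub>R n) D = t}"
    by (intro closed_Collect_conj closed_Collect_le closed_Collect_eq continuous_intros)
  also have "{t. 0 \<le> t \<and> t \<le> t1 \<and> infdist (y + t *\<^sub>R n) D = t} = S"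
    using Siff by (auto simp: S_def)
  finally have "closed S" .
  have bdd: "bdd_above S" by (auto simp: S_def bdd_above_def)
  define \<tau> where "\<tau> = Sup S"
  have \<tau>S: "\<tau> \<in> S" unfolding \<tau>_def using dS bdd \<open>closed S\<close> by (intro closed_contains_Sup) auto
  have d\<tau>: "d \<le> \<tau>" unfolding \<tau>_def by (intro cSup_upper dS bdd)
  have "\<tau> = t1"
  proof (rule ccontr)
    assume "\<tau> \<noteq> t1"
    then have \<tau>t1: "\<tau> < t1" using \<tau>S by (auto simp: S_def)
    define x0 where "x0 = y + \<tau> *\<^sub>R n"
    have y0: "y \<in> nearest_points D x0" and inf0: "infdist x0 D = \<tau>"
      using \<tau>S Siff[of \<tau>] by (auto simp: S_def x0_def)
    define \<epsilon> where "\<epsilon> = min \<tau> (t1 - \<tau>) / 2"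
    have \<epsilon>: "0 < \<epsilon>" "\<epsilon> < \<tau>" "\<tau> + \<epsilon> < t1"
      using d0 d\<tau> \<tau>t1 by (auto simp: \<epsilon>_def min_def field_simps)
    have t1R: "t1 < R" using l by (simp add: t1_def d_def)
    let ?\<xi> = "closest_point D"
    have near: "infdist x' D < R" if "x' \<in> cball x0 \<epsilon>" for x'
      using infdist_triangle[of x' D x0] that inf0 \<epsilon> t1R by (simp add: dist_commute)
    have apart: "\<tau> \<le> norm (x0 - ?\<xi> x')" for x'
      using infdist_le[OF closest_point_in_set[OF D], of x0 x'] inf0 by (simp add: dist_norm)
    let ?g = "\<lambda>x'. x0 + (\<epsilon> / norm (x0 - ?\<xi> x')) *\<^sub>R (x0 - ?\<xi> x')"
    obtain x1 where x1: "x1 \<in> cball x0 \<epsilon>" "?g x1 = x1"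
    proof (rule brouwer_ball[OF \<epsilon>(1), of x0 ?g])
      have "continuous_on (cball x0 \<epsilon>) ?\<xi>"
        by (rule continuous_on_subset[OF continuous_on_closest_point_unique[OF D u]]) (use near in auto)
      moreover have "norm (x0 - ?\<xi> x') \<noteq> 0" for x'
        using less_le_trans[OF order.strict_trans[OF \<epsilon>(1,2)] apart[of x']] by simp
      ultimately show "continuous_on (cball x0 \<epsilon>) ?g"
        by (intro continuous_intros) auto
      show "?g \<in> cball x0 \<epsilon> \<rightarrow> cball x0 \<epsilon>"
        using \<epsilon> by (auto simp: dist_norm)
    qed
    define p where "p = ?\<xi> x1"
    define m where "m = norm (x0 - p)"
    have m: "0 < m"
      using less_le_trans[OF order.strict_trans[OF \<epsilon>(1,2)] apart[of x1]] unfolding m_def p_def .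
    have x1p: "x1 - p = ((m + \<epsilon>) / m) *\<^sub>R (x0 - p)"
    proof -
      have "x1 - p = (x0 - p) + (\<epsilon> / m) *\<^sub>R (x0 - p)"
        using x1(2) by (simp add: p_def m_def algebra_simps)
      also have "\<dots> = (1 + \<epsilon> / m) *\<^sub>R (x0 - p)" by (simp add: scaleR_left_distrib)
      also have "1 + \<epsilon> / m = (m + \<epsilon>) / m" using m by (simp add: field_simps)
      finally show ?thesis .
    qed
    have x0p: "x0 = p + (m / (m + \<epsilon>)) *\<^sub>R (x1 - p)"
      using m \<epsilon> by (simp add: x1p)
    have pN: "p \<in> nearest_points D x1"
      unfolding p_def by (rule closest_point_in_nearest_points[OF D])
    then have "p \<in> nearest_points D x0"
      unfolding x0p using m \<epsilon> by (intro nearest_points_segment) (auto simp: divide_le_eq)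
    moreover have "infdist x0 D < R" using inf0 \<tau>t1 t1R by simp
    ultimately have "p = y"
      using y0 nearest_points_unique[OF D u, of x0] by auto
    have "m = \<tau>" using nn d0 d\<tau> by (simp add: m_def \<open>p = y\<close> x0_def)
    have "x1 = y + (\<tau> + \<epsilon>) *\<^sub>R n"
    proof -
      have "x1 = y + ((\<tau> + \<epsilon>) / \<tau>) *\<^sub>R (\<tau> *\<^sub>R n)"
        using x1p \<open>p = y\<close> \<open>m = \<tau>\<close> by (simp add: x0_def algebra_simps)
      then show ?thesis using d0 d\<tau> by simp
    qed
    then have "\<tau> + \<epsilon> \<in> S"
      using pN \<open>p = y\<close> \<epsilon> by (auto simp: S_def)
    then have "\<tau> + \<epsilon> \<le> \<tau>" unfolding \<tau>_def by (intro cSup_upper bdd)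
    then show False using \<epsilon> by simp
  qed
  moreover have "y + c *\<^sub>R (x - y) = y + t1 *\<^sub>R n"
    using xn by (simp add: t1_def)
  ultimately show ?thesis using \<tau>S by (simp add: S_def)
qed

text \<open>Points of the segment from \<open>x\<close> to its projection have the same projection; conversely, a point within
  distance \<open>s t\<close> arises from the point on its normal at \<open>1 / s\<close> times the distance, which still lies
  below the reach.\<close>
lemma pull_closest_point_image:
  assumes D: "closed D" "D \<noteq> {}" and u: "unique_nearest_within D R"
    and t: "0 \<le> t" "t < R" and s: "0 < s" "s \<le> 1"
  shows "pull (closest_point D) s ` {x. infdist x D \<le> t \<and> closest_point D x \<in> F}
       = {z. infdist z D \<le> s * t \<and> closest_point D z \<in> F}"
proof (intro equalityI subsetI)
  let ?\<xi> = "closest_point D"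
  have pull: "pull ?\<xi> s x = ?\<xi> x + s *\<^sub>R (x - ?\<xi> x)" for x
    by (simp add: pull_def algebra_simps)
  {
    fix z assume "z \<in> pull ?\<xi> s ` {x. infdist x D \<le> t \<and> ?\<xi> x \<in> F}"
    then obtain x where x: "z = ?\<xi> x + s *\<^sub>R (x - ?\<xi> x)" "infdist x D \<le> t" "?\<xi> x \<in> F"
      using pull by auto
    note seg = nearest_points_segment[OF closest_point_in_nearest_points[OF D], of s x, folded x(1)]
    have inf: "infdist z D = s * infdist x D" using seg s by simp
    also have "\<dots> \<le> s * t" using s x by simp
    finally have le: "infdist z D \<le> s * t" .
    also have "\<dots> \<le> t" using s t by (simp add: mult_left_le_one_le)
    finally have "infdist z D < R" using t by simp
    then have "?\<xi> z = ?\<xi> x"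
      using seg(1) s nearest_points_unique[OF D u] by auto
    then show "z \<in> {z. infdist z D \<le> s * t \<and> ?\<xi> z \<in> F}" using le x by simp
  next
    fix z assume "z \<in> {z. infdist z D \<le> s * t \<and> ?\<xi> z \<in> F}"
    then have z: "infdist z D \<le> s * t" "?\<xi> z \<in> F" by auto
    define x where "x = ?\<xi> z + (1 / s) *\<^sub>R (z - ?\<xi> z)"
    have le: "1 / s * infdist z D \<le> t" using z s by (simp add: divide_le_eq mult.commute)
    have "?\<xi> z \<in> nearest_points D x"
    proof (cases "z \<in> D")
      case True
      then have "?\<xi> z = z" by (rule closest_point_self)
      then show ?thesis using closest_point_in_nearest_points[OF D, of z] by (simp add: x_def)
    next
      case False
      then show ?thesis
        unfolding x_def using s le t
        by (intro nearest_points_ray[OF D u closest_point_in_nearest_points[OF D]]) auto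
    qed
    moreover have inf: "infdist x D \<le> t"
      using \<open>?\<xi> z \<in> nearest_points D x\<close> le s dist_closest_point[OF D, of z]
      by (auto simp: nearest_points_def x_def dist_norm)
    ultimately have \<xi>x: "?\<xi> x = ?\<xi> z"
      using nearest_points_unique[OF D u, of x] t by auto
    moreover have "pull ?\<xi> s x = z"
      using s by (simp add: pull \<xi>x) (simp add: x_def)
    ultimately show "z \<in> pull ?\<xi> s ` {x. infdist x D \<le> t \<and> ?\<xi> x \<in> F}"
      using inf z(2) by (intro image_eqI[of _ _ x]) auto
  }
qed

section \<open>Level sets of distance functions\<close>

text \<open>The inverse of \<open>pull \<xi> s\<close> is Lipschitz with constant \<open>1 / s\<close>, and \<open>pull \<xi> s\<close> maps the level \<open>r\<close> into the
  level \<open>s r\<close>. Within a ball only countably many levels have positive measure, so for some \<open>s\<close> the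
  target level is a null set, and so is its Lipschitz image, the level \<open>r\<close>.\<close>
lemma negligible_distance_level_set:
  fixes A :: "'a::euclidean_space set"
  assumes A: "closed A" "A \<noteq> {}" and r: "0 < r"
  shows "negligible {x. infdist x A = r}"
proof -
  let ?\<xi> = "closest_point A"
  have "negligible ({x. infdist x A = r} \<inter> cball 0 (real m))" (is "negligible ?E") for m
  proof -
    define M where "M = distr (restrict_space lborel (cball (0::'a) (real m + r))) borel (\<lambda>x. infdist x A)"
    interpret R: finite_measure "restrict_space lborel (cball (0::'a) (real m + r))"
      by (rule finite_measureI) (use emeasure_bounded_finite[of "cball (0::'a) (real m + r)"] in
          \<open>simp add: emeasure_restrict_space space_restrict_space less_top\<close>)
    have meas: "(\<lambda>x. infdist x A) \<in> restrict_space lborel (cball (0::'a) (real m + r)) \<rightarrow>\<^sub>M borel"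
    proof (rule measurable_restrict_space1)
      have "(\<lambda>x. infdist x A) \<in> borel_measurable borel"
        by (intro borel_measurable_continuous_onI continuous_intros)
      then show "(\<lambda>x. infdist x A) \<in> borel_measurable lborel" by simp
    qed
    interpret M: finite_measure M
      unfolding M_def by (rule R.finite_measure_distr[OF meas])
    have "uncountable {r / 2..r}"
      using r by (simp add: uncountable_closed_interval)
    then have "\<not> {r / 2..r} \<subseteq> {t. measure M {t} \<noteq> 0}"
      using M.countable_support countable_subset by blast
    then obtain t where t: "r / 2 \<le> t" "t \<le> r" "measure M {t} = 0" by auto
    define s where "s = t / r"
    have s: "0 < s" "s \<le> 1" and st: "t = s * r" using t r by (auto simp: s_def)
    define L where "L = {x. infdist x A = t} \<inter> cball 0 (real m + r)"
    have Lb: "L \<in> sets borel"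
      unfolding L_def by (intro sets.Int borel_closed closed_Collect_eq continuous_intros) auto
    have "emeasure M {t} = emeasure lborel L"
      unfolding M_def
      by (subst emeasure_distr[OF meas], simp, subst emeasure_restrict_space)
        (auto simp: L_def space_restrict_space intro!: arg_cong2[of _ _ _ _ emeasure])
    then have "emeasure lborel L = 0"
      using t(3) M.emeasure_eq_measure by simp
    then have negL: "negligible L"
      using Lb by (auto simp: negligible_iff_null_sets intro!: null_sets_completionI null_setsI)
    have "pull ?\<xi> s ` ?E \<subseteq> L"
    proof
      fix z assume "z \<in> pull ?\<xi> s ` ?E"
      then obtain x where x: "infdist x A = r" "norm x \<le> real m" "z = pull ?\<xi> s x" by auto
      have z: "z = ?\<xi> x + s *\<^sub>R (x - ?\<xi> x)" by (simp add: x(3) pull_def algebra_simps)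
      have "infdist z A = t"
        unfolding z st using s x by (subst nearest_points_segment(2)[OF closest_point_in_nearest_points[OF A]]) auto
      moreover have "norm z \<le> real m + r"
      proof -
        have "z = x - (1 - s) *\<^sub>R (x - ?\<xi> x)" by (simp add: z algebra_simps)
        then have "norm z \<le> norm x + (1 - s) * norm (x - ?\<xi> x)"
          using norm_triangle_ineq4[of x "(1 - s) *\<^sub>R (x - ?\<xi> x)"] s by simp
        also have "norm (x - ?\<xi> x) = r" using dist_closest_point[OF A, of x] x by (simp add: dist_norm)
        also have "norm x + (1 - s) * r \<le> real m + 1 * r"
          using x r s by (intro add_mono mult_right_mono) auto
        finally show ?thesis by simp
      qed
      ultimately show "z \<in> L" by (simp add: L_def)
    qed
    then have neg: "negligible (pull ?\<xi> s ` ?E)" using negL negligible_subset by blast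
    have mono: "0 \<le> (?\<xi> x - ?\<xi> y) \<bullet> (x - y)" for x y
      by (rule nearest_points_monotone[OF closest_point_in_nearest_points[OF A] closest_point_in_nearest_points[OF A]])
    have inj: "inj_on (pull ?\<xi> s) ?E" using s by (intro inj_on_pull mono)
    have "negligible (the_inv_into ?E (pull ?\<xi> s) ` pull ?\<xi> s ` ?E)"
    proof (rule negligible_locally_Lipschitz_image[OF order_refl neg])
      fix z assume "z \<in> pull ?\<xi> s ` ?E"
      then obtain x where x: "x \<in> ?E" "z = pull ?\<xi> s x" by blast
      show "\<exists>T B. open T \<and> z \<in> T \<and> (\<forall>y\<in>pull ?\<xi> s ` ?E \<inter> T.
          norm (the_inv_into ?E (pull ?\<xi> s) y - the_inv_into ?E (pull ?\<xi> s) z) \<le> B * norm (y - z))"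
      proof (intro exI[of _ UNIV] exI[of _ "1 / s"] conjI ballI)
        fix y assume "y \<in> pull ?\<xi> s ` ?E \<inter> UNIV"
        then obtain w where w: "w \<in> ?E" "y = pull ?\<xi> s w" by blast
        have "s * norm (w - x) \<le> norm (y - z)"
          unfolding w x using s by (intro strongly_monotone_expands pull_strongly_monotone mono)
        then show "norm (the_inv_into ?E (pull ?\<xi> s) y - the_inv_into ?E (pull ?\<xi> s) z) \<le> 1 / s * norm (y - z)"
          using s by (simp only: w(2) x(2) the_inv_into_f_f[OF inj w(1)] the_inv_into_f_f[OF inj x(1)])
            (simp add: le_divide_eq mult.commute)
      qed auto
    qed
    then show ?thesis by (simp only: the_inv_into_onto[OF inj])
  qed
  then have "negligible (\<Union>m. {x. infdist x A = r} \<inter> cball 0 (real m))"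
    by (intro negligible_countable_Union) auto
  also have "(\<Union>m. {x. infdist x A = r} \<inter> cball 0 (real m)) = {x. infdist x A = r}"
    using real_arch_simple by (auto simp: dist_norm)
  finally show ?thesis .
qed

section \<open>The local Steiner formula\<close>

text \<open>The set whose volume the local Steiner formula expands.\<close>
definition shell :: "'a::euclidean_space set \<Rightarrow> real \<Rightarrow> 'a set \<Rightarrow> 'a set" where
  "shell D t F = (parallel_set D t - D) \<inter> closest_point D -` F"

lemma borel_closest_point_preimage:
  assumes D: "closed D" "D \<noteq> {}" and u: "unique_nearest_within D R" and t: "t < R" and F: "F \<in> sets borel"
  shows "{x. infdist x D \<le> t \<and> closest_point D x \<in> F} \<in> sets borel"
proof -
  let ?C = "{x. infdist x D \<le> t}"
  have C: "?C \<in> sets borel"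
    by (intro borel_closed closed_Collect_le continuous_intros)
  have "continuous_on ?C (closest_point D)"
    by (rule continuous_on_subset[OF continuous_on_closest_point_unique[OF D u]]) (use t in auto)
  then have "closest_point D \<in> borel_measurable (restrict_space borel ?C)"
    by (rule borel_measurable_continuous_on_restrict)
  from measurable_sets[OF this F] have "closest_point D -` F \<inter> ?C \<in> sets (restrict_space borel ?C)"
    by (simp add: space_restrict_space)
  then have "closest_point D -` F \<inter> ?C \<in> sets borel"
    using C by (simp add: sets_restrict_space_iff)
  also have "closest_point D -` F \<inter> ?C = {x. infdist x D \<le> t \<and> closest_point D x \<in> F}" by auto
  finally show ?thesis .
qed

lemma shell_eq: "shell D t F = {x. infdist x D \<le> t \<and> closest_point D x \<in> F} - D"
  by (auto simp: shell_def parallel_set_def)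

lemma borel_shell:
  assumes "closed D" "D \<noteq> {}" "unique_nearest_within D R" "t < R" "F \<in> sets borel"
  shows "shell D t F \<in> sets borel"
  unfolding shell_eq using borel_closest_point_preimage[OF assms] assms(1) by auto

lemma bounded_closest_point_preimage:
  assumes D: "closed D" "D \<noteq> {}" and F: "bounded F"
  shows "bounded {x. infdist x D \<le> t \<and> closest_point D x \<in> F}"
proof -
  obtain B where B: "\<And>x. x \<in> F \<Longrightarrow> norm x \<le> B" using F by (auto simp: bounded_iff)
  have "norm x \<le> t + B" if "infdist x D \<le> t" "closest_point D x \<in> F" for x
    using that B[OF that(2)] dist_closest_point[OF D, of x] norm_triangle_ineq2[of x "closest_point D x"]
    by (simp add: dist_norm)
  then show ?thesis by (auto simp: bounded_iff)
qed

lemma bounded_shell: "closed D \<Longrightarrow> D \<noteq> {} \<Longrightarrow> bounded F \<Longrightarrow> bounded (shell D t F)"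
  unfolding shell_eq by (rule bounded_subset[OF bounded_closest_point_preimage]) auto

lemma fmeasurable_shell:
  assumes "closed D" "D \<noteq> {}" "unique_nearest_within D R" "t < R" "F \<in> sets borel" "bounded F"
  shows "shell D t F \<in> fmeasurable lborel"
  using borel_shell[OF assms(1-5)] emeasure_bounded_finite[OF bounded_shell[OF assms(1,2,6)], of t]
  by (auto simp: fmeasurable_def)

lemma shell_0: "closed D \<Longrightarrow> D \<noteq> {} \<Longrightarrow> shell D 0 F = {}"
  using in_closed_iff_infdist_zero[of D] infdist_nonneg[of _ D] by (auto simp: shell_eq intro: antisym)

lemma poly_on_scale:
  assumes "poly_on d S p" "\<And>t. t \<in> T \<Longrightarrow> t / c \<in> S"
  shows "poly_on d T (\<lambda>t. p (t / c))"
proof -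
  obtain q where q: "degree q \<le> d" "\<And>s. s \<in> S \<Longrightarrow> p s = poly q s"
    using assms(1) unfolding poly_on_def by blast
  have "degree (pcompose q [:0, 1 / c:]) \<le> degree q * 1"
    unfolding degree_pcompose by (intro mult_left_mono) auto
  then show ?thesis
    unfolding poly_on_def using q assms(2)
    by (intro exI[of _ "pcompose q [:0, 1 / c:]"]) (auto simp: poly_pcompose)
qed

text \<open>For compact \<open>F\<close> the points within distance \<open>t\<close> of \<open>D\<close> that project into \<open>F\<close> form a compact set, whose image
  under \<open>pull \<xi> s\<close> is the corresponding set for \<open>s t\<close>. It differs from the shell by the fixed set
  \<open>F \<inter> D\<close>. The point \<open>s = 0\<close> is added by continuity of measure, because the shells shrink to the
  empty set.\<close>
lemma shell_measure_polynomial_compact: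
  fixes D :: "'a::euclidean_space set"
  assumes D: "closed D" "D \<noteq> {}" and u: "unique_nearest_within D R"
    and t: "0 < t" "t < R" and F: "compact F"
  shows "poly_on DIM('a) {0..t} (\<lambda>s. measure lborel (shell D s F))"
proof -
  let ?\<xi> = "closest_point D"
  define P where "P c = {x. infdist x D \<le> c \<and> ?\<xi> x \<in> F}" for c
  have Fb: "F \<in> sets borel" using F by (rule borel_compact)
  have bP: "bounded (P c)" for c
    unfolding P_def by (rule bounded_closest_point_preimage[OF D compact_imp_bounded[OF F]])
  have "continuous_on {x. infdist x D \<le> t} ?\<xi>"
    by (rule continuous_on_subset[OF continuous_on_closest_point_unique[OF D u]]) (use t in auto)
  then have "closed ({x. infdist x D \<le> t} \<inter> ?\<xi> -` F)"
    by (intro continuous_closed_preimage closed_Collect_le continuous_intros compact_imp_closed F)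
  also have "{x. infdist x D \<le> t} \<inter> ?\<xi> -` F = P t" by (auto simp: P_def)
  finally have cP: "compact (P t)" using bP by (simp add: compact_eq_bounded_closed)
  have bor: "P c \<in> sets borel" if "c < R" for c
    unfolding P_def by (rule borel_closest_point_preimage[OF D u that Fb])
  have poly: "poly_on DIM('a) {0<..1} (\<lambda>s. measure lborel (pull ?\<xi> s ` P t))"
  proof (rule measure_pull_image_polynomial[OF _ continuous_on_closest_point_unique[OF D u] _ cP])
    show "open {x. infdist x D < R}" by (intro open_Collect_less continuous_intros)
    show "P t \<subseteq> {x. infdist x D < R}" using t by (auto simp: P_def)
    show "0 \<le> (?\<xi> x - ?\<xi> y) \<bullet> (x - y)" for x y
      by (rule nearest_points_monotone[OF closest_point_in_nearest_points[OF D] closest_point_in_nearest_points[OF D]])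
  qed
  have eq: "measure lborel (pull ?\<xi> s ` P t) - measure lborel (F \<inter> D) = measure lborel (shell D (s * t) F)"
    if s: "s \<in> {0<..1}" for s
  proof -
    have st: "s * t < R" using s t by (intro le_less_trans[OF _ t(2)]) (simp add: mult_left_le_one_le)
    have im: "pull ?\<xi> s ` P t = P (s * t)"
      unfolding P_def using s t by (intro pull_closest_point_image[OF D u]) auto
    have FD: "F \<inter> D \<subseteq> P (s * t)" using s t by (auto simp: P_def closest_point_self)
    have sh: "shell D (s * t) F = P (s * t) - F \<inter> D"
      by (auto simp: shell_eq P_def closest_point_self)
    have "measure lborel (P (s * t) - F \<inter> D) = measure lborel (P (s * t)) - measure lborel (F \<inter> D)"
    proof (rule measure_Diff)
      show "emeasure lborel (P (s * t)) \<noteq> \<infinity>"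
        using emeasure_bounded_finite[OF bP, of "s * t"] by simp
    qed (use bor[OF st] FD D(1) Fb in auto)
    then show ?thesis by (simp add: im sh)
  qed
  have poly1: "poly_on DIM('a) {0<..1} (\<lambda>s. measure lborel (shell D (s * t) F))"
    using poly_on_diff[OF poly poly_on_const[of _ _ "measure lborel (F \<inter> D)"]]
    by (rule iffD1[OF poly_on_cong, rotated]) (simp add: eq)
  then obtain q where q: "degree q \<le> DIM('a)" "\<And>s. s \<in> {0<..1} \<Longrightarrow> measure lborel (shell D (s * t) F) = poly q s"
    unfolding poly_on_def by blast
  have "poly q 0 = 0"
  proof -
    define S where "S n = shell D (inverse (real (Suc n)) * t) F" for n
    have le1: "inverse (real (Suc n)) \<in> {0<..1}" for n by (simp add: inverse_le_1_iff)
    have "(\<lambda>n. measure lborel (S n)) \<longlonglongrightarrow> measure lborel (\<Inter>n. S n)"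
    proof (rule Lim_measure_decseq)
      show "range S \<subseteq> sets lborel"
      proof clarify
        fix n
        have "inverse (real (Suc n)) * t < R" using le1[of n] t by (intro le_less_trans[OF _ t(2)]) (simp add: mult_left_le_one_le)
        then show "S n \<in> sets lborel" unfolding S_def using borel_shell[OF D u _ Fb] by simp
      qed
      show "decseq S"
      proof (rule decseq_SucI)
        fix n
        have "inverse (real (Suc (Suc n))) * t \<le> inverse (real (Suc n)) * t"
          using t by (intro mult_right_mono) (auto simp: field_simps)
        then show "S (Suc n) \<subseteq> S n" unfolding S_def shell_eq by auto
      qed
      show "emeasure lborel (S n) \<noteq> \<infinity>" for n
        unfolding S_def using emeasure_bounded_finite[OF bounded_shell[OF D compact_imp_bounded[OF F]]]
        by (simp add: less_top)
    qed
    also have "(\<Inter>n. S n) = {}"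
    proof (rule ccontr)
      assume "(\<Inter>n. S n) \<noteq> {}"
      then obtain x where x: "\<And>n. x \<in> S n" by blast
      have "infdist x D \<le> inverse (real (Suc n)) * t" for n using x[of n] by (simp add: S_def shell_eq)
      moreover have "(\<lambda>n. inverse (real (Suc n)) * t) \<longlonglongrightarrow> 0"
        by (intro tendsto_mult_left_zero LIMSEQ_inverse_real_of_nat)
      ultimately have "infdist x D \<le> 0" by (intro LIMSEQ_le_const[of _ 0]) auto
      then have "x \<in> D" using in_closed_iff_infdist_zero[OF D] infdist_nonneg[of x D] by auto
      then show False using x[of 0] by (simp add: S_def shell_eq)
    qed
    finally have "(\<lambda>n. poly q (inverse (real (Suc n)))) \<longlonglongrightarrow> 0"
      using q(2)[OF le1] by (simp add: S_def)
    moreover have "(\<lambda>n. poly q (inverse (real (Suc n)))) \<longlonglongrightarrow> poly q 0"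
      by (intro isCont_tendsto_compose[OF _ LIMSEQ_inverse_real_of_nat]) simp
    ultimately show ?thesis using LIMSEQ_unique by blast
  qed
  then have "measure lborel (shell D (s * t) F) = poly q s" if "s \<in> {0..1}" for s
    using that q(2)[of s] shell_0[OF D, of F] by (cases "s = 0") auto
  then have "poly_on DIM('a) {0..1} (\<lambda>s. measure lborel (shell D (s * t) F))"
    unfolding poly_on_def using q(1) by blast
  from poly_on_scale[OF this, of "{0..t}" t] show ?thesis
    using t by simp
qed

text \<open>The sets \<open>F\<close> for which the claim holds are closed under complements within a ball and under
  countable disjoint unions, and contain the compact sets.\<close>
lemma shell_measure_polynomial:
  fixes D :: "'a::euclidean_space set"
  assumes D: "closed D" "D \<noteq> {}" and u: "unique_nearest_within D R"
    and t: "0 < t" "t < R" and F: "F \<in> sets borel" "bounded F"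
  shows "poly_on DIM('a) {0..t} (\<lambda>s. measure lborel (shell D s F))"
proof -
  obtain m where "\<And>x. x \<in> F \<Longrightarrow> norm x \<le> m" using F(2) by (auto simp: bounded_iff)
  then have m: "F \<subseteq> cball 0 m" by auto
  let ?K = "cball (0::'a) m"
  have cong: "poly_on DIM('a) {0..t} p = poly_on DIM('a) {0..t} p'" if "\<And>s. 0 \<le> s \<Longrightarrow> s < R \<Longrightarrow> p s = p' s" for p p'
    by (rule poly_on_cong) (use that t in auto)
  have fm: "shell D s B \<in> fmeasurable lborel" if "s < R" "B \<in> sets borel" "B \<subseteq> ?K" for s B
    by (rule fmeasurable_shell[OF D u that(1,2) bounded_subset[OF bounded_cball that(3)]])
  have "poly_on DIM('a) {0..t} (\<lambda>s. measure lborel (shell D s (F \<inter> ?K)))"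
  proof (rule sigma_sets_induct_disjoint[of "Collect closed" UNIV F])
    show "Int_stable (Collect closed :: 'a set set)" by (auto simp: Int_stable_def)
    show "F \<in> sigma_sets UNIV (Collect closed)"
      using F(1) by (simp add: borel_eq_closed)
    show "poly_on DIM('a) {0..t} (\<lambda>s. measure lborel (shell D s (B \<inter> ?K)))" if "B \<in> Collect closed" for B
      using that by (intro shell_measure_polynomial_compact[OF D u t]) (auto intro: closed_Int_compact)
    show "poly_on DIM('a) {0..t} (\<lambda>s. measure lborel (shell D s ({} \<inter> ?K)))"
      by (simp add: shell_def poly_on_const)
  next
    fix B assume B: "B \<in> sigma_sets UNIV (Collect closed)"
      and poly: "poly_on DIM('a) {0..t} (\<lambda>s. measure lborel (shell D s (B \<inter> ?K)))"
    have Bb: "B \<in> sets borel" using B by (simp add: borel_eq_closed)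
    have "measure lborel (shell D s ?K) - measure lborel (shell D s (B \<inter> ?K)) = measure lborel (shell D s ((UNIV - B) \<inter> ?K))"
      if "0 \<le> s" "s < R" for s
    proof -
      have "shell D s ((UNIV - B) \<inter> ?K) = shell D s ?K - shell D s (B \<inter> ?K)"
        by (auto simp: shell_def)
      moreover have "measure lborel (shell D s ?K - shell D s (B \<inter> ?K)) = measure lborel (shell D s ?K) - measure lborel (shell D s (B \<inter> ?K))"
        using fm[of s ?K] fm[of s "B \<inter> ?K"] that Bb
        by (intro measure_Diff) (auto simp: fmeasurable_def less_top shell_def)
      ultimately show ?thesis by simp
    qed
    then show "poly_on DIM('a) {0..t} (\<lambda>s. measure lborel (shell D s ((UNIV - B) \<inter> ?K)))"
      using poly_on_diff[OF shell_measure_polynomial_compact[OF D u t compact_cball[of 0 m]] poly]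
      by (rule iffD1[OF cong])
  next
    fix B :: "nat \<Rightarrow> 'a set" assume disj: "disjoint_family B" and B: "range B \<subseteq> sigma_sets UNIV (Collect closed)"
      and poly: "\<And>i. poly_on DIM('a) {0..t} (\<lambda>s. measure lborel (shell D s (B i \<inter> ?K)))"
    have Bb: "B i \<in> sets borel" for i using B by (auto simp: borel_eq_closed)
    show "poly_on DIM('a) {0..t} (\<lambda>s. measure lborel (shell D s (\<Union> (range B) \<inter> ?K)))"
    proof (rule poly_on_limit)
      show "infinite {0..t}" using t by simp
      show "poly_on DIM('a) {0..t} (\<lambda>s. \<Sum>i<n. measure lborel (shell D s (B i \<inter> ?K)))" for n
        by (intro poly_on_sum poly)
      fix s assume "s \<in> {0..t}"
      then have s: "0 \<le> s" "s < R" using t by auto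
      have "(\<lambda>i. measure lborel (shell D s (B i \<inter> ?K))) sums measure lborel (\<Union>i. shell D s (B i \<inter> ?K))"
      proof (rule measure_UNION)
        have "shell D s (B i \<inter> ?K) \<in> fmeasurable lborel" for i
          using Bb by (intro fm s) auto
        then show "range (\<lambda>i. shell D s (B i \<inter> ?K)) \<subseteq> sets lborel"
          using fmeasurableD by blast
        show "disjoint_family (\<lambda>i. shell D s (B i \<inter> ?K))"
          using disj by (fastforce simp: disjoint_family_on_def shell_def)
        have "(\<Union>i. shell D s (B i \<inter> ?K)) = shell D s ((\<Union>i. B i) \<inter> ?K)" by (auto simp: shell_def)
        then show "emeasure lborel (\<Union>i. shell D s (B i \<inter> ?K)) \<noteq> \<infinity>"
          using fm[OF s(2), of "(\<Union>i. B i) \<inter> ?K"] Bb by (auto simp: fmeasurable_def less_top)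
      qed
      also have "(\<Union>i. shell D s (B i \<inter> ?K)) = shell D s (\<Union> (range B) \<inter> ?K)" by (auto simp: shell_def)
      finally show "(\<lambda>n. \<Sum>i<n. measure lborel (shell D s (B i \<inter> ?K))) \<longlonglongrightarrow> measure lborel (shell D s (\<Union> (range B) \<inter> ?K))"
        by (simp add: sums_def)
    qed
  qed simp
  moreover have "F \<inter> ?K = F" using m by auto
  ultimately show ?thesis by simp
qed

lemma poly_eq_sum_le:
  fixes p :: "real poly"
  assumes "degree p \<le> d"
  shows "poly p x = (\<Sum>i\<le>d. coeff p i * x ^ i)"
  unfolding poly_altdef using assms
  by (intro sum.mono_neutral_left) (auto simp: not_le coeff_eq_0)

section \<open>Curvature measures\<close>

text \<open>The node 0, where the shell is empty, accounts for the missing constant term of the polynomial.\<close>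
definition steiner_nodes :: "nat \<Rightarrow> real \<Rightarrow> real set" where
  "steiner_nodes d \<tau> = (\<lambda>j. \<tau> * real j / real d) ` {..d}"

lemma steiner_nodes:
  assumes "0 < d" "0 < \<tau>"
  shows "finite (steiner_nodes d \<tau>)" "card (steiner_nodes d \<tau>) = Suc d" "steiner_nodes d \<tau> \<subseteq> {0..\<tau>}"
proof -
  show "finite (steiner_nodes d \<tau>)" by (simp add: steiner_nodes_def)
  show "card (steiner_nodes d \<tau>) = Suc d"
    unfolding steiner_nodes_def using assms by (subst card_image) (auto simp: inj_on_def)
  show "steiner_nodes d \<tau> \<subseteq> {0..\<tau>}"
    using assms by (auto simp: steiner_nodes_def divide_le_eq)
qed

text \<open>Lagrange interpolation makes the coefficient of \<open>t ^ (d - i)\<close> in the volume of the shell a linear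
  combination of the volumes at the nodes; dividing by the volume of the unit ball of dimension
  \<open>d - i\<close> gives the \<open>i\<close>-th curvature measure.\<close>
definition steiner_weight :: "nat \<Rightarrow> real \<Rightarrow> nat \<Rightarrow> real \<Rightarrow> real" where
  "steiner_weight d \<tau> i a = coeff (lagrange_basis (steiner_nodes d \<tau>) a) (d - i) / unit_ball_vol (real (d - i))"

definition steiner_measure :: "'a::euclidean_space set \<Rightarrow> real \<Rightarrow> nat \<Rightarrow> 'a set \<Rightarrow> real" where
  "steiner_measure D \<tau> i F =
     (\<Sum>a\<in>steiner_nodes DIM('a) \<tau>. steiner_weight DIM('a) \<tau> i a * measure lborel (shell D a F))"

lemma degree_lagrange_steiner:
  assumes "0 < d" "0 < \<tau>" "a \<in> steiner_nodes d \<tau>"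
  shows "degree (lagrange_basis (steiner_nodes d \<tau>) a) \<le> d"
  using degree_lagrange_basis[OF steiner_nodes(1)[OF assms(1,2)] assms(3)] steiner_nodes(2)[OF assms(1,2)] by simp

text \<open>The nodes stay in \<open>{0..\<tau>}\<close> while \<open>\<rho>\<close> may be anywhere below \<open>R\<close>: the interpolation identity holds on the
  larger of the intervals \<open>{0..\<tau>}\<close> and \<open>{0..\<rho>}\<close>. The constant coefficient vanishes because the shell of
  radius 0 is empty.\<close>
lemma steiner_formula:
  fixes D :: "'a::euclidean_space set"
  assumes D: "closed D" "D \<noteq> {}" and u: "unique_nearest_within D R"
    and t: "0 < \<tau>" "\<tau> < R" and \<rho>: "0 \<le> \<rho>" "\<rho> < R" and F: "F \<in> sets borel" "bounded F"
  shows "measure lborel (shell D \<rho> F) =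
    (\<Sum>i=1..DIM('a). unit_ball_vol (real i) * \<rho> ^ i * steiner_measure D \<tau> (DIM('a) - i) F)"
proof -
  let ?d = "DIM('a)"
  let ?N = "steiner_nodes ?d \<tau>"
  let ?L = "lagrange_basis ?N"
  let ?m = "\<lambda>t. measure lborel (shell D t F)"
  define T where "T = max \<tau> \<rho>"
  have T: "0 < T" "T < R" "\<tau> \<le> T" "\<rho> \<le> T" using t \<rho> by (auto simp: T_def)
  note N = steiner_nodes[OF DIM_positive[where 'a='a] t(1)]
  have NT: "?N \<subseteq> {0..T}" using N(3) T by auto
  have coeffs: "?m x = (\<Sum>i\<le>?d. (\<Sum>a\<in>?N. ?m a * coeff (?L a) i) * x ^ i)" if "x \<in> {0..T}" for x
  proof -
    have "?m x = (\<Sum>a\<in>?N. ?m a * poly (?L a) x)"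
      by (rule poly_on_lagrange[OF shell_measure_polynomial[OF D u T(1,2) F] NT N(1,2) that])
    also have "\<dots> = (\<Sum>a\<in>?N. ?m a * (\<Sum>i\<le>?d. coeff (?L a) i * x ^ i))"
      using degree_lagrange_steiner[OF DIM_positive[where 'a='a] t(1)]
      by (intro sum.cong refl arg_cong2[where f="(*)"] poly_eq_sum_le) auto
    also have "\<dots> = (\<Sum>i\<le>?d. (\<Sum>a\<in>?N. ?m a * coeff (?L a) i) * x ^ i)"
      by (simp add: sum_distrib_left sum_distrib_right mult.assoc sum.swap[of _ "{..?d}"])
    finally show ?thesis .
  qed
  have "?m 0 = 0" using shell_0[OF D] by simp
  then have zero: "(\<Sum>a\<in>?N. ?m a * coeff (?L a) 0) = 0"
    using coeffs[of 0] T by (simp add: power_0_left if_distrib cong: if_cong)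
  have "?m \<rho> = (\<Sum>i\<le>?d. (\<Sum>a\<in>?N. ?m a * coeff (?L a) i) * \<rho> ^ i)"
    using coeffs[of \<rho>] \<rho> T by simp
  also have "\<dots> = (\<Sum>i=1..?d. (\<Sum>a\<in>?N. ?m a * coeff (?L a) i) * \<rho> ^ i)"
    using zero by (intro sum.mono_neutral_right) (auto simp: not_le)
  also have "\<dots> = (\<Sum>i=1..?d. unit_ball_vol (real i) * \<rho> ^ i * steiner_measure D \<tau> (?d - i) F)"
  proof (intro sum.cong refl)
    fix i assume i: "i \<in> {1..?d}"
    have v: "unit_ball_vol (real i) \<noteq> 0"
      by (metis less_irrefl of_nat_0_le_iff unit_ball_vol_pos)
    show "(\<Sum>a\<in>?N. ?m a * coeff (?L a) i) * \<rho> ^ i = unit_ball_vol (real i) * \<rho> ^ i * steiner_measure D \<tau> (?d - i) F"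
      using i v unfolding steiner_measure_def steiner_weight_def sum_distrib_left sum_distrib_right
      by (intro sum.cong) auto
  qed
  finally show ?thesis .
qed

lemma shell_measure_sums:
  assumes "closed D" "D \<noteq> {}" "unique_nearest_within D R" "a < R"
    and F: "range F \<subseteq> sets borel" "disjoint_family F" and fin: "bounded (shell D a (\<Union>n. F n))"
  shows "(\<lambda>n. measure lborel (shell D a (F n))) sums measure lborel (shell D a (\<Union>n. F n))"
proof -
  have eq: "shell D a (\<Union>n. F n) = (\<Union>n. shell D a (F n))" by (auto simp: shell_def)
  show ?thesis
    unfolding eq
  proof (rule measure_UNION)
    show "range (\<lambda>n. shell D a (F n)) \<subseteq> sets lborel"
      using borel_shell[OF assms(1-4)] F(1) by auto
    show "disjoint_family (\<lambda>n. shell D a (F n))"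
      using F(2) by (fastforce simp: disjoint_family_on_def shell_def)
    show "emeasure lborel (\<Union>n. shell D a (F n)) \<noteq> \<infinity>"
      using emeasure_bounded_finite[OF fin] by (simp add: eq)
  qed
qed

lemma steiner_measure_sums:
  fixes D :: "'a::euclidean_space set"
  assumes D: "closed D" "D \<noteq> {}" and u: "unique_nearest_within D R" and t: "0 < \<tau>" "\<tau> < R"
    and F: "range F \<subseteq> sets borel" "disjoint_family F" and fin: "bounded (shell D \<tau> (\<Union>n. F n))"
  shows "(\<lambda>n. steiner_measure D \<tau> i (F n)) sums steiner_measure D \<tau> i (\<Union>n. F n)"
  unfolding steiner_measure_def
proof (intro sums_sum sums_mult shell_measure_sums[OF D u _ F])
  fix a assume "a \<in> steiner_nodes DIM('a) \<tau>"
  then have "a \<le> \<tau>" using steiner_nodes(3)[OF DIM_positive[where 'a='a] t(1)] by auto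
  then show "a < R" "bounded (shell D a (\<Union>n. F n))"
    using t by (simp, intro bounded_subset[OF fin]) (auto simp: shell_eq)
qed

lemma local_steiner_steiner_measure:
  fixes D :: "'a::euclidean_space set"
  assumes D: "closed D" "D \<noteq> {}" and t: "0 < \<tau>" "ereal \<tau> < reach D"
  shows "local_steiner D (steiner_measure D \<tau>)"
  unfolding local_steiner_def
proof (intro conjI allI impI)
  obtain R where R: "\<tau> < R" "unique_nearest_within D R" using less_reach_unique[OF t(2)] .
  show "signed_radon_measure (steiner_measure D \<tau> i)" for i
    unfolding signed_radon_measure_def
    by (intro allI impI steiner_measure_sums[OF D R(2) t(1) R(1)] bounded_shell[OF D])
  fix F :: "'a set" and \<rho> assume F: "F \<in> sets borel" "bounded F" and \<rho>: "0 \<le> \<rho>" "ereal \<rho> < reach D"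
  obtain R' where R': "\<rho> < R'" "unique_nearest_within D R'" using less_reach_unique[OF \<rho>(2)] .
  have u: "unique_nearest_within D (max R R')"
    using R(2) R'(2) by (auto simp: unique_nearest_within_def max_def)
  have "measure lebesgue (shell D \<rho> F) = measure lborel (shell D \<rho> F)"
    using borel_shell[OF D R'(2,1) F(1)] by (simp add: measure_completion)
  also have "\<dots> = (\<Sum>i=1..DIM('a). unit_ball_vol (real i) * \<rho> ^ i * steiner_measure D \<tau> (DIM('a) - i) F)"
    using R R' by (intro steiner_formula[OF D u t(1) _ \<rho>(1) _ F]) auto
  finally show "measure lebesgue ((parallel_set D \<rho> - D) \<inter> closest_point D -` F) =
     (\<Sum>i=1..DIM('a). unit_ball_vol (real i) * \<rho> ^ i * steiner_measure D \<tau> (DIM('a) - i) F)"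
    by (simp add: shell_def)
qed

lemma local_steiner_unique:
  fixes D :: "'a::euclidean_space set"
  assumes C: "local_steiner D C" and C': "local_steiner D C'" and t: "0 < \<tau>" "ereal \<tau> < reach D"
    and F: "F \<in> sets borel" "bounded F" and i: "i < DIM('a)"
  shows "C i F = C' i F"
proof -
  let ?d = "DIM('a)"
  define q where "q C = (\<Sum>j=1..?d. monom (unit_ball_vol (real j) * C (?d - j) F) j)" for C :: "nat \<Rightarrow> 'a set \<Rightarrow> real"
  have q: "measure lebesgue ((parallel_set D \<rho> - D) \<inter> closest_point D -` F) = poly (q C) \<rho>"
    if "local_steiner D C" "\<rho> \<in> {0..\<tau>}" for C \<rho>
  proof -
    have "ereal \<rho> < reach D" using that(2) by (intro le_less_trans[OF _ t(2)]) simp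
    then have "measure lebesgue ((parallel_set D \<rho> - D) \<inter> closest_point D -` F) =
        (\<Sum>j=1..?d. unit_ball_vol (real j) * \<rho> ^ j * C (?d - j) F)"
      using that F unfolding local_steiner_def by auto
    also have "\<dots> = poly (q C) \<rho>"
      by (simp add: q_def poly_sum poly_monom mult_ac)
    finally show ?thesis .
  qed
  have "q C = q C'"
  proof (rule ccontr)
    assume "q C \<noteq> q C'"
    then have "finite {x. poly (q C - q C') x = 0}" by (intro poly_roots_finite) simp
    moreover have "{0..\<tau>} \<subseteq> {x. poly (q C - q C') x = 0}" using q[OF C] q[OF C'] by auto
    ultimately show False using t(1) by (meson finite_subset infinite_Icc)
  qed
  then have "coeff (q C) (?d - i) = coeff (q C') (?d - i)" by simp
  moreover have "coeff (q C) (?d - i) = unit_ball_vol (real (?d - i)) * C i F" for C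
    using i by (simp add: q_def coeff_sum if_distrib sum.delta cong: if_cong) 
  moreover have "unit_ball_vol (real (?d - i)) \<noteq> 0"
    by (metis less_irrefl of_nat_0_le_iff unit_ball_vol_pos)
  ultimately show ?thesis by simp
qed

lemma curvature_measure_eq:
  fixes D :: "'a::euclidean_space set"
  assumes "closed D" "D \<noteq> {}" "0 < \<tau>" "ereal \<tau> < reach D" "F \<in> sets borel" "bounded F" "i < DIM('a)"
  shows "curvature_measure D i F = steiner_measure D \<tau> i F"
  unfolding curvature_measure_def
proof (rule the_equality)
  show "\<exists>C. local_steiner D C \<and> steiner_measure D \<tau> i F = C i F"
    using local_steiner_steiner_measure[OF assms(1-4)] by blast
  show "c = steiner_measure D \<tau> i F" if "\<exists>C. local_steiner D C \<and> c = C i F" for c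
    using that local_steiner_unique[OF _ local_steiner_steiner_measure[OF assms(1-4)] assms(3-7)] by blast
qed

definition exterior :: "'a::euclidean_space set \<Rightarrow> real \<Rightarrow> 'a set" where
  "exterior A r = closure (- parallel_set A r)"

lemma bounded_parallel_set:
  assumes "compact A" "A \<noteq> {}"
  shows "bounded (parallel_set A r)"
proof (rule bounded_subset[of "{x. infdist x A \<le> max r 1}"])
  show "bounded {x. infdist x A \<le> max r 1}"
    using compact_infdist_le[OF assms(2,1), of "max r 1"] by (simp add: compact_imp_bounded)
qed (auto simp: parallel_set_def)

lemma closed_exterior: "closed (exterior A r)"
  by (simp add: exterior_def)

lemma exterior_nonempty:
  fixes A :: "'a::euclidean_space set"
  assumes "compact A" "A \<noteq> {}"
  shows "exterior A r \<noteq> {}"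
proof
  assume "exterior A r = {}"
  then have "parallel_set A r = UNIV" unfolding exterior_def by auto
  then show False using bounded_parallel_set[OF assms, of r] not_bounded_UNIV by simp
qed

lemma shell_exterior_subset: "shell (exterior A r) a F \<subseteq> parallel_set A r"
  using closure_subset[of "- parallel_set A r"] by (auto simp: shell_def exterior_def)

text \<open>The shells lie in the bounded parallel set and hence project into a ball, so intersecting \<open>F\<close> with a
  large ball changes nothing.\<close>
lemma parallel_curvature_measure_eq:
  fixes A :: "'a::euclidean_space set"
  assumes A: "compact A" "A \<noteq> {}" and t: "0 < \<tau>" "ereal \<tau> < reach (exterior A r)"
    and F: "F \<in> sets borel" and i: "i < DIM('a)"
  shows "parallel_curvature_measure A r i F = (-1) ^ (DIM('a) - i - 1) * steiner_measure (exterior A r) \<tau> i F"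
proof -
  let ?D = "exterior A r"
  note D = closed_exterior[of A r] exterior_nonempty[OF A, of r]
  obtain B where B: "\<And>x. x \<in> parallel_set A r \<Longrightarrow> norm x \<le> B"
    using bounded_parallel_set[OF A, of r] unfolding bounded_iff by blast
  obtain M :: nat where M: "B + \<tau> \<le> real M" using real_arch_simple by blast
  have sh: "shell ?D a (F \<inter> cball 0 (real m)) = shell ?D a F" if "M \<le> m" "a \<le> \<tau>" for m a
  proof -
    have "closest_point ?D x \<in> cball 0 (real m)" if x: "x \<in> shell ?D a F" for x
    proof -
      have "norm x \<le> B" using B shell_exterior_subset x by blast
      moreover have "dist x (closest_point ?D x) \<le> \<tau>"
        using x \<open>a \<le> \<tau>\<close> by (simp add: shell_eq dist_closest_point[OF D])
      ultimately have "norm (closest_point ?D x) \<le> B + \<tau>"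
        using norm_triangle_ineq2[of "closest_point ?D x" x] by (simp add: dist_norm norm_minus_commute)
      then show ?thesis using M \<open>M \<le> m\<close> by simp
    qed
    then show ?thesis by (auto simp: shell_def)
  qed
  have ev: "curvature_measure ?D i (F \<inter> cball 0 (real m)) = steiner_measure ?D \<tau> i F" if "M \<le> m" for m
  proof -
    have "curvature_measure ?D i (F \<inter> cball 0 (real m)) = steiner_measure ?D \<tau> i (F \<inter> cball 0 (real m))"
      using F i by (intro curvature_measure_eq[OF D t]) (auto intro: bounded_Int)
    also have "\<dots> = steiner_measure ?D \<tau> i F"
      unfolding steiner_measure_def
      using sh[OF that] steiner_nodes(3)[OF DIM_positive[where 'a='a] t(1)]
      by (intro sum.cong) auto
    finally show ?thesis .
  qed
  have "(\<lambda>m. curvature_measure ?D i (F \<inter> cball 0 (real m))) \<longlonglongrightarrow> steiner_measure ?D \<tau> i F"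
    by (rule tendsto_eventually, rule eventually_sequentiallyI[of M], rule ev)
  from limI[OF this] show ?thesis
    by (simp add: parallel_curvature_measure_def exterior_def)
qed

section \<open>Noncritical values and reach\<close>

lemma infdist_le_hausdorff_dist:
  assumes "compact A" "a \<in> A"
  shows "infdist a B \<le> hausdorff_dist A B" "infdist a B \<le> hausdorff_dist B A"
proof -
  have "bdd_above ((\<lambda>a. infdist a B) ` A)"
    by (intro bounded_imp_bdd_above compact_imp_bounded compact_continuous_image continuous_intros assms)
  then have "infdist a B \<le> (SUP a\<in>A. infdist a B)"
    using assms(2) by (intro cSUP_upper) auto
  then show "infdist a B \<le> hausdorff_dist A B" "infdist a B \<le> hausdorff_dist B A"
    by (auto simp: hausdorff_dist_def)
qed

lemma infdist_hausdorff_dist: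
  assumes A: "compact A" "A \<noteq> {}" and B: "compact B" "B \<noteq> {}"
  shows "\<bar>infdist x A - infdist x B\<bar> \<le> hausdorff_dist A B"
proof -
  have *: "infdist x A \<le> infdist x B + infdist b A" if "b \<in> B" "infdist x B = dist x b" for A B :: "'a set" and b
    using infdist_triangle[of x A b] that by simp
  obtain a where a: "a \<in> A" "infdist x A = dist x a"
    using infdist_attains_inf[OF compact_imp_closed[OF A(1)] A(2)] by blast
  obtain b where b: "b \<in> B" "infdist x B = dist x b"
    using infdist_attains_inf[OF compact_imp_closed[OF B(1)] B(2)] by blast
  show ?thesis
    using *[OF a, of B] *[OF b, of A] infdist_le_hausdorff_dist(1)[OF A(1) a(1), of B]
      infdist_le_hausdorff_dist(2)[OF B(1) b(1), of A] by linarith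
qed

text \<open>Noncriticality of the value \<open>r\<close> with a margin: some direction of unit length leads away from all
  nearest points with slope at least \<open>c\<close>.\<close>
definition transversal :: "'a::euclidean_space set \<Rightarrow> real \<Rightarrow> real \<Rightarrow> bool" where
  "transversal A r c \<longleftrightarrow>
     (\<forall>y. infdist y A = r \<longrightarrow> (\<exists>v. norm v = 1 \<and> (\<forall>a\<in>nearest_points A y. c \<le> v \<bullet> (y - a))))"

text \<open>A hyperplane separates \<open>y\<close> from the closed convex hull of its nearest points.\<close>
lemma noncritical_direction:
  assumes A: "compact A" "A \<noteq> {}" and nc: "\<not> critical_point A y"
  shows "\<exists>v. norm v = 1 \<and> (\<forall>a\<in>nearest_points A y. 0 < v \<bullet> (y - a))"
proof -
  let ?S = "closure (convex hull nearest_points A y)"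
  have "y \<notin> ?S" using nc by (simp add: critical_point_def)
  then obtain n b where n: "n \<bullet> y < b" "\<And>x. x \<in> ?S \<Longrightarrow> b < n \<bullet> x"
    using separating_hyperplane_closed_point[of ?S y] by (auto simp: convex_closure)
  have mem: "a \<in> ?S" if "a \<in> nearest_points A y" for a
    using that by (meson closure_subset hull_inc subsetD)
  have cp: "closest_point A y \<in> nearest_points A y"
    using A by (intro closest_point_in_nearest_points compact_imp_closed)
  have "n \<noteq> 0" using n(1) n(2)[OF mem[OF cp]] by auto
  show ?thesis
  proof (intro exI[of _ "- (n /\<^sub>R norm n)"] conjI ballI)
    show "norm (- (n /\<^sub>R norm n)) = 1" using \<open>n \<noteq> 0\<close> by simp
    fix a assume "a \<in> nearest_points A y"
    then have "n \<bullet> y < n \<bullet> a" using n(1) n(2)[OF mem] by fastforce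
    then show "0 < - (n /\<^sub>R norm n) \<bullet> (y - a)"
      using \<open>n \<noteq> 0\<close> by (simp add: inner_diff_right mult_less_0_iff)
  qed
qed

text \<open>Otherwise there are \<open>y\<^sub>n\<close> violating the claim with margins tending to 0. A limit point \<open>z\<close> of
  them has distance \<open>r\<close> from \<open>A\<close>, and the direction that is good at \<open>z\<close> fails at a limit of bad points
  \<open>a\<^sub>n\<close>, which is a nearest point of \<open>z\<close>. The slack \<open>c\<close> in the hypotheses on \<open>y\<close> and \<open>a\<close> is what lets
  the statement pass to sets that are Hausdorff close to \<open>A\<close>.\<close>
proposition noncritical_uniform_direction:
  fixes A :: "'a::euclidean_space set"
  assumes A: "compact A" "A \<noteq> {}" and r: "0 < r" "r \<notin> critical_values A"
  obtains c where "0 < c" "\<And>y. \<bar>infdist y A - r\<bar> \<le> c \<Longrightarrow>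
     \<exists>v. norm v = 1 \<and> (\<forall>a. infdist a A \<le> c \<longrightarrow> dist y a \<le> r + c \<longrightarrow> c \<le> v \<bullet> (y - a))"
proof -
  let ?good = "\<lambda>c. \<forall>y. \<bar>infdist y A - r\<bar> \<le> c \<longrightarrow>
     (\<exists>v. norm v = 1 \<and> (\<forall>a. infdist a A \<le> c \<longrightarrow> dist y a \<le> r + c \<longrightarrow> c \<le> v \<bullet> (y - a)))"
  have "\<exists>c>0. ?good c"
  proof (rule ccontr)
    define c where "c n = inverse (real (Suc n))" for n
    have c: "0 < c n" "c n \<le> 1" for n by (auto simp: c_def inverse_le_1_iff)
    have c0: "c \<longlonglongrightarrow> 0" unfolding c_def[abs_def] by (rule LIMSEQ_inverse_real_of_nat)
    assume "\<not> (\<exists>c>0. ?good c)"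
    then have "\<exists>y. \<bar>infdist y A - r\<bar> \<le> c n \<and>
       (\<forall>v. norm v = 1 \<longrightarrow> (\<exists>a. infdist a A \<le> c n \<and> dist y a \<le> r + c n \<and> v \<bullet> (y - a) < c n))" for n
      using c(1)[of n] by (meson not_le)
    then obtain y where y: "\<And>n. \<bar>infdist (y n) A - r\<bar> \<le> c n"
      and bad: "\<And>n v. norm v = 1 \<Longrightarrow> \<exists>a. infdist a A \<le> c n \<and> dist (y n) a \<le> r + c n \<and> v \<bullet> (y n - a) < c n"
      by metis
    have "compact {x. infdist x A \<le> r + 1}" using compact_infdist_le[OF A(2,1)] r by simp
    moreover have "\<forall>n. y n \<in> {x. infdist x A \<le> r + 1}"
      using y c by (smt (verit) mem_Collect_eq)
    ultimately obtain z q where q: "strict_mono (q :: nat \<Rightarrow> nat)" "(y \<circ> q) \<longlonglongrightarrow> z"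
      unfolding compact_def by blast
    have cq: "(\<lambda>n. c (q n)) \<longlonglongrightarrow> 0" using LIMSEQ_subseq_LIMSEQ[OF c0 q(1)] by (simp add: o_def)
    have yq: "(\<lambda>n. y (q n)) \<longlonglongrightarrow> z" using q(2) by (simp add: o_def)
    have "(\<lambda>n. infdist (y (q n)) A - r) \<longlonglongrightarrow> 0"
      by (rule Lim_null_comparison[OF _ cq]) (use y in auto)
    moreover have "(\<lambda>n. infdist (y (q n)) A - r) \<longlonglongrightarrow> infdist z A - r"
      by (intro tendsto_intros yq)
    ultimately have z: "infdist z A = r" using LIMSEQ_unique by fastforce
    then have "\<not> critical_point A z" using r by (auto simp: critical_values_def)
    then obtain v where v: "norm v = 1" "\<And>a. a \<in> nearest_points A z \<Longrightarrow> 0 < v \<bullet> (z - a)"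
      using noncritical_direction[OF A] by blast
    obtain a where a: "\<And>n. infdist (a n) A \<le> c n" "\<And>n. dist (y n) (a n) \<le> r + c n" "\<And>n. v \<bullet> (y n - a n) < c n"
      using bad[OF v(1)] by metis
    have "compact {x. infdist x A \<le> 1}" using compact_infdist_le[OF A(2,1)] by simp
    moreover have "\<forall>n. a (q n) \<in> {x. infdist x A \<le> 1}" using a(1) c(2) order_trans by blast
    ultimately obtain b p where p: "strict_mono (p :: nat \<Rightarrow> nat)" "((\<lambda>n. a (q n)) \<circ> p) \<longlonglongrightarrow> b"
      unfolding compact_def by (metis (no_types, lifting))
    have aq: "(\<lambda>n. a (q (p n))) \<longlonglongrightarrow> b" using p(2) by (simp add: o_def)
    have yp: "(\<lambda>n. y (q (p n))) \<longlonglongrightarrow> z" using LIMSEQ_subseq_LIMSEQ[OF yq p(1)] by (simp add: o_def)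
    have cp: "(\<lambda>n. c (q (p n))) \<longlonglongrightarrow> 0" using LIMSEQ_subseq_LIMSEQ[OF cq p(1)] by (simp add: o_def)
    have "infdist b A \<le> 0"
      by (rule LIMSEQ_le[OF tendsto_infdist[OF aq] cp]) (use a(1) in auto)
    then have bA: "b \<in> A"
      using in_closed_iff_infdist_zero[OF compact_imp_closed[OF A(1)] A(2)] infdist_nonneg[of b A] by auto
    have "(\<lambda>n. r + c (q (p n))) \<longlonglongrightarrow> r + 0" by (intro tendsto_intros cp)
    then have "dist z b \<le> r + 0"
      by (rule LIMSEQ_le[OF tendsto_dist[OF yp aq]]) (use a(2) in auto)
    then have "b \<in> nearest_points A z"
      using bA z infdist_le[OF bA, of z] by (simp add: nearest_points_def)
    moreover have "v \<bullet> (z - b) \<le> 0"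
      by (rule LIMSEQ_le[OF tendsto_inner[OF tendsto_const tendsto_diff[OF yp aq]] cp])
        (use a(3) less_imp_le in blast)
    ultimately show False using v(2) by fastforce
  qed
  then show thesis using that by blast
qed

lemma transversal_hausdorff:
  assumes A: "compact A" "A \<noteq> {}" and B: "compact B" "B \<noteq> {}"
    and c: "\<And>y. \<bar>infdist y A - r\<bar> \<le> c \<Longrightarrow>
     \<exists>v. norm v = 1 \<and> (\<forall>a. infdist a A \<le> c \<longrightarrow> dist y a \<le> r + c \<longrightarrow> c \<le> v \<bullet> (y - a))"
    and h: "hausdorff_dist B A \<le> c"
  shows "transversal B r c"
  unfolding transversal_def
proof (intro allI impI)
  fix y assume y: "infdist y B = r"
  have "0 \<le> c"
    using h infdist_hausdorff_dist[OF B A, of y] by linarith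
  have "\<bar>infdist y A - r\<bar> \<le> c"
    using infdist_hausdorff_dist[OF B A, of y] y h by linarith
  from c[OF this] obtain v where v: "norm v = 1"
    "\<And>a. infdist a A \<le> c \<Longrightarrow> dist y a \<le> r + c \<Longrightarrow> c \<le> v \<bullet> (y - a)" by blast
  show "\<exists>v. norm v = 1 \<and> (\<forall>a\<in>nearest_points B y. c \<le> v \<bullet> (y - a))"
  proof (intro exI conjI ballI, rule v(1), rule v(2))
    fix a assume "a \<in> nearest_points B y"
    then have a: "a \<in> B" "dist y a = r" using y by (auto simp: nearest_points_def)
    show "infdist a A \<le> c" using infdist_le_hausdorff_dist(1)[OF B(1) a(1), of A] h by linarith
    show "dist y a \<le> r + c" using a \<open>0 \<le> c\<close> by simp
  qed
qed

lemma transversal_not_critical: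
  assumes "transversal A r c" "0 < c"
  shows "r \<notin> critical_values A"
proof
  assume "r \<in> critical_values A"
  then obtain y where y: "y \<in> closure (convex hull nearest_points A y)" "infdist y A = r"
    by (auto simp: critical_values_def critical_point_def)
  obtain v where v: "\<And>a. a \<in> nearest_points A y \<Longrightarrow> c \<le> v \<bullet> (y - a)"
    using assms(1) y(2) unfolding transversal_def by blast
  let ?H = "{x. v \<bullet> x \<le> v \<bullet> y - c}"
  have "nearest_points A y \<subseteq> ?H" using v by (force simp: inner_diff_right)
  then have "closure (convex hull nearest_points A y) \<subseteq> ?H"
    by (intro closure_minimal hull_minimal convex_halfspace_le closed_halfspace_le)
  then show False using y(1) assms(2) by auto
qed

text \<open>The points of \<open>A\<close> that \<open>w\<close> does not lead away from form a compact set without nearest points of \<open>y\<close>,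
  so they are farther than \<open>r\<close> by a fixed gap; all other points recede.\<close>
lemma distance_increases:
  assumes A: "compact A" "A \<noteq> {}" and y: "infdist y A = r" and r: "0 \<le> r"
    and w: "\<And>a. a \<in> nearest_points A y \<Longrightarrow> 0 < w \<bullet> (y - a)"
  obtains e where "0 < e" "\<And>t. 0 < t \<Longrightarrow> t < e \<Longrightarrow> r < infdist (y + t *\<^sub>R w) A"
proof -
  define C where "C = {a \<in> A. w \<bullet> (y - a) \<le> 0}"
  have "closed {a. w \<bullet> (y - a) \<le> 0}" by (intro closed_Collect_le continuous_intros)
  then have C: "compact C" unfolding C_def using compact_Int_closed[OF A(1), of "{a. w \<bullet> (y - a) \<le> 0}"] by (simp add: Int_def)
  have dC: "r < dist y a" if "a \<in> C" for a
  proof -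
    have "a \<in> A" "a \<notin> nearest_points A y" using that w by (force simp: C_def)+
    then show ?thesis using infdist_le[of a A y] y by (auto simp: nearest_points_def)
  qed
  obtain g where g: "0 < g" "\<And>a. a \<in> C \<Longrightarrow> r + g \<le> dist y a"
  proof (cases "C = {}")
    case True
    then show thesis using that[of 1] by simp
  next
    case False
    obtain a where a: "a \<in> C" "infdist y C = dist y a"
      using infdist_attains_inf[OF compact_imp_closed[OF C] False] by blast
    show thesis
    proof (rule that[of "dist y a - r"])
      show "r + (dist y a - r) \<le> dist y b" if "b \<in> C" for b
        using infdist_le[OF that, of y] a by simp
    qed (use dC[OF a(1)] in simp)
  qed
  show thesis
  proof (rule that[of "g / (norm w + 1)"])
    show "0 < g / (norm w + 1)" using g norm_ge_zero[of w] by (intro divide_pos_pos) linarith+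
    fix t assume t: "0 < t" "t < g / (norm w + 1)"
    obtain a where a: "a \<in> A" "infdist (y + t *\<^sub>R w) A = dist (y + t *\<^sub>R w) a"
      using infdist_attains_inf[OF compact_imp_closed[OF A(1)] A(2)] by blast
    have "r < dist (y + t *\<^sub>R w) a"
    proof (cases "a \<in> C")
      case True
      have "norm w + 1 > 0" using norm_ge_zero[of w] by linarith
      then have "t * (norm w + 1) < g" using t by (simp add: less_divide_eq)
      then have "t * norm w < g" using t by (simp add: distrib_left)
      moreover have "dist y a \<le> t * norm w + dist (y + t *\<^sub>R w) a"
        using dist_triangle[of y a "y + t *\<^sub>R w"] t by (simp add: dist_norm)
      ultimately show ?thesis using g(2)[OF True] by linarith
    next
      case False
      then have pos: "0 < w \<bullet> (y - a)" using a by (auto simp: C_def)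
      have "(dist (y + t *\<^sub>R w) a)\<^sup>2 = (dist y a)\<^sup>2 + 2 * t * (w \<bullet> (y - a)) + t * t * (w \<bullet> w)"
        by (simp add: dist_norm power2_norm_eq_inner algebra_simps inner_commute)
      moreover have "0 < 2 * t * (w \<bullet> (y - a))" using t pos by simp
      moreover have "0 \<le> t * t * (w \<bullet> w)" by simp
      moreover have "r\<^sup>2 \<le> (dist y a)\<^sup>2" using infdist_le[OF a(1), of y] y r by (intro power_mono) auto
      ultimately have "r\<^sup>2 < (dist (y + t *\<^sub>R w) a)\<^sup>2" by linarith
      then show ?thesis by (rule power2_less_imp_less) simp
    qed
    then show "r < infdist (y + t *\<^sub>R w) A" using a by simp
  qed
qed

lemma exterior_bounds:
  "{x. r < infdist x A} \<subseteq> exterior A r" "exterior A r \<subseteq> {x. r \<le> infdist x A}"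
proof -
  show "{x. r < infdist x A} \<subseteq> exterior A r"
    using closure_subset by (fastforce simp: exterior_def parallel_set_def)
  show "exterior A r \<subseteq> {x. r \<le> infdist x A}"
    unfolding exterior_def by (intro closure_minimal closed_Collect_le continuous_intros) (auto simp: parallel_set_def)
qed

text \<open>A point at distance exactly \<open>r\<close> can be moved along its transversal direction to points at larger
  distance.\<close>
lemma exterior_eq:
  assumes A: "compact A" "A \<noteq> {}" and r: "0 < r" and tr: "transversal A r c" and c: "0 < c"
  shows "exterior A r = {x. r \<le> infdist x A}"
proof (rule antisym[OF exterior_bounds(2)], clarify)
  fix y assume "r \<le> infdist y A"
  show "y \<in> exterior A r"
  proof (cases "infdist y A = r")
    case True
    then obtain v where v: "norm v = 1" "\<And>a. a \<in> nearest_points A y \<Longrightarrow> c \<le> v \<bullet> (y - a)"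
      using tr by (auto simp: transversal_def)
    obtain e where e: "0 < e" "\<And>t. 0 < t \<Longrightarrow> t < e \<Longrightarrow> r < infdist (y + t *\<^sub>R v) A"
    proof (rule distance_increases[OF A True])
      show "0 < v \<bullet> (y - a)" if "a \<in> nearest_points A y" for a
        using v(2)[OF that] c by linarith
    qed (use r in auto)
    show ?thesis
      unfolding exterior_def closure_approachable
    proof (intro allI impI)
      fix d :: real assume "0 < d"
      define t where "t = min d e / 2"
      have t: "0 < t" "t < d" "t < e" using \<open>0 < d\<close> e(1) by (auto simp: t_def min_def)
      show "\<exists>x\<in>- parallel_set A r. dist x y < d"
        using e(2)[OF t(1,3)] t v(1) by (intro bexI[of _ "y + t *\<^sub>R v"]) (auto simp: parallel_set_def dist_norm)
    qed
  next
    case False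
    then show ?thesis using exterior_bounds(1)[of r A] \<open>r \<le> infdist y A\<close> by auto
  qed
qed

text \<open>Let \<open>y\<close> and \<open>z\<close> be nearest points of \<open>x\<close> in \<open>D\<close>, at distance \<open>\<rho> < c\<close>. Every direction \<open>w\<close> leading away
  from all nearest points of \<open>y\<close> in \<open>A\<close> enters \<open>D\<close>, so \<open>(x - y) \<bullet> w \<le> 0\<close>. Since \<open>z\<close> is outside the balls
  of radius \<open>r\<close> around the points of \<open>A\<close>, the vector \<open>z - y\<close> is such a direction up to a
  quadratic error, which adding \<open>\<kappa> v\<close> with \<open>\<kappa> > |z - y|\<^sup>2 / (2 c)\<close> repairs. This gives
  \<open>(x - y) \<bullet> (z - y) \<le> \<kappa> \<rho>\<close>, whereas \<open>|x - y| = |x - z|\<close> forces the left-hand side to be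
  \<open>|z - y|\<^sup>2 / 2\<close>; for \<open>\<kappa> < |z - y|\<^sup>2 / (2 \<rho>)\<close> this is a contradiction.\<close>
proposition exterior_unique_nearest:
  fixes A :: "'a::euclidean_space set"
  assumes A: "compact A" "A \<noteq> {}" and r: "0 < r" and tr: "transversal A r c" and c: "0 < c"
  shows "unique_nearest_within (exterior A r) c"
  unfolding unique_nearest_within_def
proof (intro allI impI)
  let ?D = "exterior A r"
  note D = closed_exterior[of A r] exterior_nonempty[OF A, of r]
  note Deq = exterior_eq[OF A r tr c]
  fix x assume x: "infdist x ?D < c"
  define y where "y = closest_point ?D x"
  define \<rho> where "\<rho> = dist x y"
  have yN: "y \<in> nearest_points ?D x" unfolding y_def by (rule closest_point_in_nearest_points[OF D])
  have yD: "y \<in> ?D" and \<rho>: "infdist x ?D = \<rho>" using yN by (auto simp: nearest_points_def \<rho>_def)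
  have "z = y" if zN: "z \<in> nearest_points ?D x" for z
  proof (rule ccontr)
    assume "z \<noteq> y"
    have zD: "z \<in> ?D" and z\<rho>: "dist x z = \<rho>" using zN \<rho> by (auto simp: nearest_points_def)
    have \<rho>0: "0 < \<rho>" using \<open>z \<noteq> y\<close> z\<rho> by (auto simp: \<rho>_def) 
    have yr: "infdist y A = r"
    proof (rule ccontr)
      assume "infdist y A \<noteq> r"
      then have gt: "r < infdist y A" using yD Deq by auto
      define t where "t = min 1 ((infdist y A - r) / \<rho>)"
      have t: "0 < t" "t \<le> 1" "t * \<rho> \<le> infdist y A - r"
        using gt \<rho>0 by (auto simp: t_def min_def field_simps)
      have "infdist y A \<le> infdist (y + t *\<^sub>R (x - y)) A + t * \<rho>"
        using infdist_triangle[of y A "y + t *\<^sub>R (x - y)"] t by (simp add: dist_norm \<rho>_def)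
      then have "y + t *\<^sub>R (x - y) \<in> ?D" using t Deq by simp
      then have "\<rho> \<le> dist x (y + t *\<^sub>R (x - y))" using infdist_le[of _ ?D x] \<rho> by simp
      also have "x - (y + t *\<^sub>R (x - y)) = (1 - t) *\<^sub>R (x - y)" by (simp add: algebra_simps)
      then have "dist x (y + t *\<^sub>R (x - y)) = (1 - t) * \<rho>" using t by (simp add: dist_norm \<rho>_def)
      finally have "t * \<rho> \<le> 0" by (simp add: algebra_simps)
      then show False using t \<rho>0 by (simp add: mult_le_0_iff)
    qed
    have cone: "(x - y) \<bullet> w \<le> 0" if w: "\<And>a. a \<in> nearest_points A y \<Longrightarrow> 0 < w \<bullet> (y - a)" for w
    proof -
      obtain e where e: "0 < e" "\<And>t. 0 < t \<Longrightarrow> t < e \<Longrightarrow> r < infdist (y + t *\<^sub>R w) A"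
        by (rule distance_increases[OF A yr _ w]) (use r in auto)
      have le: "(x - y) \<bullet> w \<le> t * (w \<bullet> w) / 2" if t: "0 < t" "t < e" for t
      proof -
        have "y + t *\<^sub>R w \<in> ?D" using e(2)[OF t] Deq by simp
        then have "\<rho> \<le> dist x (y + t *\<^sub>R w)" using infdist_le[of _ ?D x] \<rho> by simp
        then have "\<rho>\<^sup>2 \<le> (dist x (y + t *\<^sub>R w))\<^sup>2" using \<rho>0 by (intro power_mono) auto
        also have "\<dots> = \<rho>\<^sup>2 - 2 * t * ((x - y) \<bullet> w) + t * t * (w \<bullet> w)"
          by (simp add: \<rho>_def dist_norm power2_norm_eq_inner algebra_simps inner_commute)
        finally have "t * (2 * ((x - y) \<bullet> w)) \<le> t * (t * (w \<bullet> w))" by (simp add: mult_ac)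
        then show ?thesis using t by simp
      qed
      have lim: "((\<lambda>t. t * (w \<bullet> w) / 2) \<longlongrightarrow> 0 * (w \<bullet> w) / 2) (at_right 0)"
        by (intro tendsto_intros) auto
      have "\<forall>\<^sub>F t in at_right 0. (x - y) \<bullet> w \<le> t * (w \<bullet> w) / 2"
        using e(1) le by (auto simp: eventually_at_right[of 0 1] intro!: exI[of _ e])
      then have "(x - y) \<bullet> w \<le> 0 * (w \<bullet> w) / 2"
        using tendsto_lowerbound[OF lim] by simp
      then show ?thesis by simp
    qed
    obtain v where v: "norm v = 1" "\<And>a. a \<in> nearest_points A y \<Longrightarrow> c \<le> v \<bullet> (y - a)"
      using tr yr by (auto simp: transversal_def)
    define m where "m = (z - y) \<bullet> (z - y)"
    have m: "0 < m" using \<open>z \<noteq> y\<close> by (simp add: m_def)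
    (* Strictly between m / (2 c) and m / (2 \<rho>), which is possible because \<rho> < c. *)
    define \<kappa> where "\<kappa> = m / (c + \<rho>)"
    have \<rho>c: "\<rho> < c" using x \<rho> by simp
    have \<kappa>: "0 < \<kappa>" "m < 2 * (\<kappa> * c)" "2 * (\<kappa> * \<rho>) < m"
      using m c \<rho>0 \<rho>c by (auto simp: \<kappa>_def field_simps)
    have "(x - y) \<bullet> ((z - y) + \<kappa> *\<^sub>R v) \<le> 0"
    proof (rule cone)
      fix a assume a: "a \<in> nearest_points A y"
      then have "a \<in> A" "dist y a = r" using yr by (auto simp: nearest_points_def)
      moreover have "r \<le> infdist z A" using zD Deq by auto
      ultimately have "dist y a \<le> dist z a" using infdist_le[of a A z] by linarith
      then have "(dist y a)\<^sup>2 \<le> (dist z a)\<^sup>2" by (intro power_mono) auto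
      also have "\<dots> = m + 2 * ((z - y) \<bullet> (y - a)) + (dist y a)\<^sup>2"
        by (simp add: m_def dist_norm power2_norm_eq_inner algebra_simps inner_commute)
      finally have "- m \<le> 2 * ((z - y) \<bullet> (y - a))" by simp
      moreover have "\<kappa> * c \<le> \<kappa> * (v \<bullet> (y - a))" using v(2)[OF a] \<kappa> by simp
      ultimately show "0 < ((z - y) + \<kappa> *\<^sub>R v) \<bullet> (y - a)"
        unfolding inner_add_left inner_scaleR_left using \<kappa>(2) by linarith
    qed
    then have "(x - y) \<bullet> (z - y) \<le> \<kappa> * - ((x - y) \<bullet> v)" by (simp add: inner_add_right)
    also have "- ((x - y) \<bullet> v) \<le> \<rho>"
      using norm_cauchy_schwarz[of "- (x - y)" v] v(1) by (simp add: \<rho>_def dist_norm norm_minus_commute inner_diff_left)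
    then have "\<kappa> * - ((x - y) \<bullet> v) \<le> \<kappa> * \<rho>" using \<kappa> by (intro mult_left_mono) auto
    finally have "(x - y) \<bullet> (z - y) \<le> \<kappa> * \<rho>" .
    moreover have "(dist x z)\<^sup>2 = (dist x y)\<^sup>2 - 2 * ((x - y) \<bullet> (z - y)) + m"
      by (simp add: m_def dist_norm power2_norm_eq_inner algebra_simps inner_commute)
    then have "2 * ((x - y) \<bullet> (z - y)) = m" using z\<rho> by (simp add: \<rho>_def)
    ultimately show False using \<kappa> by linarith
  qed
  then have "nearest_points ?D x = {y}" using yN by blast
  then show "card (nearest_points ?D x) = 1" by simp
qed

section \<open>Convergence of the exterior sets\<close>

locale hausdorff_convergent =
  fixes A :: "nat \<Rightarrow> 'a::euclidean_space set" and A\<^sub>0 :: "'a set" and r :: real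
  assumes A: "\<And>n. compact (A n)" "\<And>n. A n \<noteq> {}"
    and A\<^sub>0: "compact A\<^sub>0" "A\<^sub>0 \<noteq> {}"
    and conv: "(\<lambda>n. hausdorff_dist (A n) A\<^sub>0) \<longlonglongrightarrow> 0"
    and r: "0 < r"
    and exterior: "exterior A\<^sub>0 r = {x. r \<le> infdist x A\<^sub>0}"
begin

lemmas D\<^sub>0 = closed_exterior[of A\<^sub>0 r] exterior_nonempty[OF A\<^sub>0, of r]

lemmas D = closed_exterior[of "A n" r for n] exterior_nonempty[OF A, of _ r]

lemma eventually_infdist_close:
  assumes "0 < e" shows "\<forall>\<^sub>F n in sequentially. \<forall>x. \<bar>infdist x (A n) - infdist x A\<^sub>0\<bar> < e"
proof -
  have "\<forall>\<^sub>F n in sequentially. hausdorff_dist (A n) A\<^sub>0 < e"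
    using conv assms by (rule order_tendstoD(2))
  then show ?thesis
    by eventually_elim (use infdist_hausdorff_dist[OF A A\<^sub>0] le_less_trans in blast)
qed

lemma eventually_in_exterior:
  assumes "r < infdist x A\<^sub>0"
  shows "\<forall>\<^sub>F n in sequentially. x \<in> exterior (A n) r"
proof -
  have "0 < infdist x A\<^sub>0 - r" using assms by simp
  from eventually_infdist_close[OF this] show ?thesis
  proof eventually_elim
    case (elim n)
    then have "r < infdist x (A n)" using spec[OF elim, of x] by linarith
    then show ?case using exterior_bounds(1)[of r "A n"] by auto
  qed
qed

lemma eventually_not_in_exterior:
  assumes "infdist x A\<^sub>0 < r"
  shows "\<forall>\<^sub>F n in sequentially. x \<notin> exterior (A n) r"
proof -
  have "0 < r - infdist x A\<^sub>0" using assms by simp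
  from eventually_infdist_close[OF this] show ?thesis
  proof eventually_elim
    case (elim n)
    then have "infdist x (A n) < r" using spec[OF elim, of x] by linarith
    then show ?case using exterior_bounds(2)[of "A n" r] by auto
  qed
qed

text \<open>On the compact set of points near \<open>x\<close> that are not close to the limiting exterior, the distance to
  \<open>A\<^sub>0\<close> stays below \<open>r\<close> by a gap.\<close>
lemma eventually_exterior_close:
  assumes e: "0 < e"
  shows "\<forall>\<^sub>F n in sequentially. \<forall>p\<in>exterior (A n) r. dist x p \<le> b \<longrightarrow> infdist p (exterior A\<^sub>0 r) < e"
proof -
  define K where "K = cball x b \<inter> {p. e \<le> infdist p (exterior A\<^sub>0 r)}"
  have K: "compact K"
    unfolding K_def by (intro compact_Int_closed compact_cball closed_Collect_le continuous_intros)
  have "\<exists>g>0. \<forall>p\<in>K. infdist p A\<^sub>0 + g \<le> r"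
  proof (cases "K = {}")
    case True
    then show ?thesis by (intro exI[of _ 1]) auto
  next
    case False
    have "continuous_on K (\<lambda>p. infdist p A\<^sub>0)" by (intro continuous_intros)
    then obtain p where p: "p \<in> K" "\<And>q. q \<in> K \<Longrightarrow> infdist q A\<^sub>0 \<le> infdist p A\<^sub>0"
      using continuous_attains_sup[OF K False] by blast
    have "p \<notin> exterior A\<^sub>0 r" using p(1) e by (auto simp: K_def)
    then have "infdist p A\<^sub>0 < r" by (auto simp: exterior)
    then show ?thesis using p(2) by (intro exI[of _ "r - infdist p A\<^sub>0"]) auto
  qed
  then obtain g where g: "0 < g" "\<And>p. p \<in> K \<Longrightarrow> infdist p A\<^sub>0 + g \<le> r" by blast
  from eventually_infdist_close[OF g(1)] show ?thesis
  proof eventually_elim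
    case (elim n)
    show ?case
    proof (intro ballI impI, rule ccontr)
      fix p assume p: "p \<in> exterior (A n) r" "dist x p \<le> b" "\<not> infdist p (exterior A\<^sub>0 r) < e"
      then have "p \<in> K" by (auto simp: K_def)
      then show False
        using g(2)[of p] spec[OF elim, of p] exterior_bounds(2)[of "A n" r] p(1) by auto
    qed
  qed
qed

text \<open>Points strictly beyond distance \<open>r\<close> from \<open>A\<^sub>0\<close> are dense in its exterior and eventually belong to the
  approximating exteriors; this bounds the distance from above. The lower bound is the preceding
  lemma.\<close>
lemma infdist_exterior_tendsto: "(\<lambda>n. infdist x (exterior (A n) r)) \<longlonglongrightarrow> infdist x (exterior A\<^sub>0 r)"
proof (rule tendstoI)
  let ?D = "exterior A\<^sub>0 r"
  have upper: "\<forall>\<^sub>F n in sequentially. infdist x (exterior (A n) r) < infdist x ?D + e" if e: "0 < e" for e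
  proof -
    have "closest_point ?D x \<in> ?D" by (rule closest_point_in_set[OF D\<^sub>0])
    then obtain y where y: "y \<notin> parallel_set A\<^sub>0 r" "dist y (closest_point ?D x) < e"
      using e unfolding exterior_def closure_approachable by auto
    have "dist x y < infdist x ?D + e"
      using dist_triangle[of x y "closest_point ?D x"] y(2) dist_closest_point[OF D\<^sub>0, of x]
      by (simp add: dist_commute)
    moreover have "\<forall>\<^sub>F n in sequentially. y \<in> exterior (A n) r"
      using y(1) by (intro eventually_in_exterior) (simp add: parallel_set_def)
    then have "\<forall>\<^sub>F n in sequentially. infdist x (exterior (A n) r) \<le> dist x y"
      by eventually_elim (rule infdist_le)
    ultimately show ?thesis by (auto elim: eventually_mono)
  qed
  fix e :: real assume e: "0 < e"
  from upper[of 1, OF zero_less_one] eventually_exterior_close[OF e, of x "infdist x ?D + 1"] upper[OF e]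
  show "\<forall>\<^sub>F n in sequentially. dist (infdist x (exterior (A n) r)) (infdist x ?D) < e"
  proof eventually_elim
    case (elim n)
    let ?p = "closest_point (exterior (A n) r) x"
    have "dist x ?p = infdist x (exterior (A n) r)" by (rule dist_closest_point[OF D])
    moreover have "infdist ?p ?D < e"
      using elim(1,2) closest_point_in_set[OF D, of n x] calculation by auto
    moreover have "infdist x ?D \<le> infdist ?p ?D + dist x ?p" by (rule infdist_triangle)
    ultimately show ?case using elim(3) by (auto simp: dist_real_def)
  qed
qed

text \<open>The projections come close to points of the limiting exterior that nearly realise the
  distance, and by compactness such points are close to the unique nearest point.\<close>
lemma closest_point_exterior_tendsto:
  assumes u: "unique_nearest_within (exterior A\<^sub>0 r) R" and x: "infdist x (exterior A\<^sub>0 r) < R"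
  shows "(\<lambda>n. closest_point (exterior (A n) r) x) \<longlonglongrightarrow> closest_point (exterior A\<^sub>0 r) x"
proof (rule tendstoI)
  let ?D = "exterior A\<^sub>0 r"
  let ?y = "closest_point ?D x"
  let ?d = "infdist x ?D"
  fix e :: real assume e: "0 < e"
  define K where "K = cball x (?d + 1) \<inter> (?D \<inter> {q. e / 2 \<le> dist q ?y})"
  have K: "compact K"
    unfolding K_def by (intro compact_Int_closed compact_cball closed_Int D\<^sub>0 closed_Collect_le continuous_intros)
  have "\<exists>g>0. \<forall>q\<in>K. ?d + g \<le> dist x q"
  proof (cases "K = {}")
    case True
    then show ?thesis by (intro exI[of _ 1]) auto
  next
    case False
    have "continuous_on K (\<lambda>q. dist x q)" by (intro continuous_intros)
    then obtain q where q: "q \<in> K" "\<And>p. p \<in> K \<Longrightarrow> dist x q \<le> dist x p"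
      using continuous_attains_inf[OF K False] by blast
    have "q \<in> ?D" "q \<noteq> ?y" using q(1) e by (auto simp: K_def)
    then have "q \<notin> nearest_points ?D x" using nearest_points_unique[OF D\<^sub>0 u x] by simp
    then have "?d < dist x q"
      using \<open>q \<in> ?D\<close> infdist_le[OF \<open>q \<in> ?D\<close>, of x] by (auto simp: nearest_points_def)
    then show ?thesis using q(2) by (intro exI[of _ "dist x q - ?d"]) auto
  qed
  then obtain g where g: "0 < g" "\<And>q. q \<in> K \<Longrightarrow> ?d + g \<le> dist x q" by blast
  define h where "h = min (min (g / 2) (e / 2)) (1 / 2)"
  have h: "0 < h" "2 * h \<le> g" "h \<le> e / 2" "2 * h \<le> 1" using g e by (auto simp: h_def)
  have "\<forall>\<^sub>F n in sequentially. infdist x (exterior (A n) r) < ?d + h"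
    by (rule order_tendstoD(2)[OF infdist_exterior_tendsto]) (use h in simp)
  with eventually_exterior_close[OF h(1), of x "?d + h"]
  show "\<forall>\<^sub>F n in sequentially. dist (closest_point (exterior (A n) r) x) ?y < e"
  proof eventually_elim
    case (elim n)
    let ?p = "closest_point (exterior (A n) r) x"
    let ?q = "closest_point ?D ?p"
    have p: "dist x ?p < ?d + h" using elim dist_closest_point[OF D, of x n] by simp
    then have "infdist ?p ?D < h" using elim(1) closest_point_in_set[OF D, of n x] by auto
    then have pq: "dist ?p ?q < h" by (simp add: dist_closest_point[OF D\<^sub>0])
    then have xq: "dist x ?q < ?d + 2 * h" using p dist_triangle[of x ?q ?p] by linarith
    have "?q \<in> ?D" by (rule closest_point_in_set[OF D\<^sub>0])
    moreover have "?q \<notin> K" using g(2)[of ?q] xq h by auto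
    ultimately have "dist ?q ?y < e / 2" using xq h by (auto simp: K_def)
    then show ?case using pq h dist_triangle[of ?p ?y ?q] by linarith
  qed
qed

text \<open>Off two null sets, the level \<open>r\<close> of the distance to \<open>A\<^sub>0\<close> and the level \<open>a\<close> of the distance to its exterior,
  each point eventually belongs to the approximating shells or eventually not, in agreement with the
  limiting shell.\<close>
lemma integral_shell_tendsto:
  fixes f :: "'a \<Rightarrow> real"
  assumes u0: "unique_nearest_within (exterior A\<^sub>0 r) R"
    and u: "\<forall>\<^sub>F n in sequentially. unique_nearest_within (exterior (A n) r) R"
    and a: "0 \<le> a" "a < R"
    and f: "continuous_on UNIV f" "bounded (range f)"
  shows "(\<lambda>n. \<integral>x\<in>shell (exterior (A n) r) a UNIV. f (closest_point (exterior (A n) r) x) \<partial>lborel)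
     \<longlonglongrightarrow> (\<integral>x\<in>shell (exterior A\<^sub>0 r) a UNIV. f (closest_point (exterior A\<^sub>0 r) x) \<partial>lborel)"
proof (cases "a = 0")
  case True
  then show ?thesis using shell_0[OF D] shell_0[OF D\<^sub>0] by (simp add: set_lebesgue_integral_def)
next
  case False
  then have a0: "0 < a" using a by simp
  obtain B where B: "\<And>x. \<bar>f x\<bar> \<le> B" using f(2) by (auto simp: bounded_iff)
  let ?g = "\<lambda>E x. indicator (shell E a UNIV) x *\<^sub>R f (closest_point E x)"
  let ?P = "parallel_set A\<^sub>0 (r + 1)"
  have meas: "(\<lambda>x. ?g E x) \<in> borel_measurable lborel"
    if E: "closed E" "E \<noteq> {}" "unique_nearest_within E R" for E
  proof -
    have "continuous_on (shell E a UNIV) (closest_point E)"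
      by (rule continuous_on_subset[OF continuous_on_closest_point_unique[OF E]]) (use a in \<open>auto simp: shell_eq\<close>)
    then have "continuous_on (shell E a UNIV) (\<lambda>x. f (closest_point E x))"
      by (intro continuous_on_compose2[OF f(1)]) auto
    from borel_measurable_continuous_on_indicator[OF borel_shell[OF E a(2)] this] show ?thesis by simp
  qed
  have cP: "closed ?P" unfolding parallel_set_def by (intro closed_Collect_le continuous_intros)
  have "\<forall>\<^sub>F n in sequentially. unique_nearest_within (exterior (A n) r) R \<and> shell (exterior (A n) r) a UNIV \<subseteq> ?P"
    using u eventually_infdist_close[OF zero_less_one]
  proof eventually_elim
    case (elim n)
    have "infdist x A\<^sub>0 \<le> r + 1" if "x \<in> shell (exterior (A n) r) a UNIV" for x
      using that shell_exterior_subset[of "A n" r a UNIV] spec[OF elim(2), of x]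
      by (auto simp: parallel_set_def)
    then show ?case using elim(1) by (auto simp: parallel_set_def)
  qed
  then obtain n0 where n0: "\<And>n. n0 \<le> n \<Longrightarrow> unique_nearest_within (exterior (A n) r) R"
    "\<And>n. n0 \<le> n \<Longrightarrow> shell (exterior (A n) r) a UNIV \<subseteq> ?P"
    by (auto simp: eventually_sequentially)
  have "(\<lambda>n. \<integral>x\<in>shell (exterior (A (n + n0)) r) a UNIV. f (closest_point (exterior (A (n + n0)) r) x) \<partial>lborel)
     \<longlonglongrightarrow> (\<integral>x\<in>shell (exterior A\<^sub>0 r) a UNIV. f (closest_point (exterior A\<^sub>0 r) x) \<partial>lborel)"
    unfolding set_lebesgue_integral_def
  proof (rule integral_dominated_convergence[where w="\<lambda>x. indicator ?P x * B"])
    show "(\<lambda>x. ?g (exterior A\<^sub>0 r) x) \<in> borel_measurable lborel"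
      by (rule meas[OF D\<^sub>0 u0])
    show "(\<lambda>x. ?g (exterior (A (n + n0)) r) x) \<in> borel_measurable lborel" for n
      by (rule meas[OF D n0(1)]) simp
    have "compact ?P" using cP bounded_parallel_set[OF A\<^sub>0] by (simp add: compact_eq_bounded_closed)
    then show "integrable lborel (\<lambda>x. indicator ?P x * B)"
      using borel_integrable_compact[of ?P "\<lambda>_. B"] by simp
    show "AE x in lborel. norm (?g (exterior (A (n + n0)) r) x)
        \<le> indicator ?P x * B" for n
    proof (rule AE_I2)
      fix x
      have "0 \<le> B" using B[of undefined] by simp
      then show "norm (?g (exterior (A (n + n0)) r) x) \<le> indicator ?P x * B"
        using n0(2)[of "n + n0"] B by (auto simp: indicator_def)
    qed
    have "AE x in lborel. infdist x E \<noteq> t" if "closed E" "E \<noteq> {}" "0 < t" for E :: "'a set" and t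
    proof -
      have b: "{x. infdist x E = t} \<in> sets borel" by (intro borel_closed closed_Collect_eq continuous_intros)
      have "{x. infdist x E = t} \<in> null_sets lebesgue"
        using negligible_distance_level_set[OF that] by (simp add: negligible_iff_null_sets)
      then have "{x. infdist x E = t} \<in> null_sets lborel"
        using b by (auto simp: null_sets_def)
      from AE_not_in[OF this] show ?thesis by simp
    qed
    from this[OF compact_imp_closed[OF A\<^sub>0(1)] A\<^sub>0(2) r] this[OF D\<^sub>0 a0]
    show "AE x in lborel. (\<lambda>n. ?g (exterior (A (n + n0)) r) x)
        \<longlonglongrightarrow> ?g (exterior A\<^sub>0 r) x"
    proof eventually_elim
      case (elim x)
      show ?case
      proof (rule LIMSEQ_ignore_initial_segment)
        consider (inside) "r < infdist x A\<^sub>0" | (far) "infdist x A\<^sub>0 < r" "a < infdist x (exterior A\<^sub>0 r)"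
          | (near) "infdist x A\<^sub>0 < r" "infdist x (exterior A\<^sub>0 r) < a"
          using elim by linarith
        then show "(\<lambda>n. ?g (exterior (A n) r) x)
          \<longlonglongrightarrow> ?g (exterior A\<^sub>0 r) x"
        proof cases
          case inside
          from eventually_in_exterior[OF inside]
          have "\<forall>\<^sub>F n in sequentially. ?g (exterior (A n) r) x = 0"
            by eventually_elim (simp add: shell_eq)
          moreover have "x \<notin> shell (exterior A\<^sub>0 r) a UNIV" using inside by (simp add: shell_eq exterior)
          ultimately show ?thesis by (simp add: tendsto_eventually)
        next
          case far
          have "\<forall>\<^sub>F n in sequentially. a < infdist x (exterior (A n) r)"
            by (rule order_tendstoD(1)[OF infdist_exterior_tendsto far(2)])
          then have "\<forall>\<^sub>F n in sequentially. ?g (exterior (A n) r) x = 0"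
            by eventually_elim (simp add: shell_eq)
          moreover have "x \<notin> shell (exterior A\<^sub>0 r) a UNIV" using far by (simp add: shell_eq)
          ultimately show ?thesis by (simp add: tendsto_eventually)
        next
          case near
          have "\<forall>\<^sub>F n in sequentially. infdist x (exterior (A n) r) < a"
            by (rule order_tendstoD(2)[OF infdist_exterior_tendsto near(2)])
          with eventually_not_in_exterior[OF near(1)]
          have ev: "\<forall>\<^sub>F n in sequentially. ?g (exterior (A n) r) x
              = f (closest_point (exterior (A n) r) x)"
            by eventually_elim (simp add: shell_eq)
          have "isCont f (closest_point (exterior A\<^sub>0 r) x)"
            using f(1) by (simp add: continuous_on_eq_continuous_at)
          then have "(\<lambda>n. f (closest_point (exterior (A n) r) x)) \<longlonglongrightarrow> f (closest_point (exterior A\<^sub>0 r) x)"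
            using near a by (intro isCont_tendsto_compose[OF _ closest_point_exterior_tendsto[OF u0]]) auto
          moreover have "x \<in> shell (exterior A\<^sub>0 r) a UNIV" using near by (simp add: shell_eq exterior)
          ultimately show ?thesis unfolding tendsto_cong[OF ev] by simp
        qed
      qed
    qed
  qed
  then show ?thesis by (rule LIMSEQ_offset)
qed

end

section \<open>Signed measures with a density\<close>

text \<open>The supremum defining the positive variation of \<open>E\<close> is attained at \<open>E \<inter> {x. 0 \<le> h x}\<close>.\<close>
lemma positive_variation_density:
  fixes M :: "'a::euclidean_space measure"
  assumes sets: "sets M = sets borel" and h: "integrable M h"
    and \<mu>: "\<And>E. E \<in> sets borel \<Longrightarrow> \<mu> E = (\<integral>x\<in>E. h x \<partial>M)"
  shows "positive_variation \<mu> = density M (\<lambda>x. ennreal (h x))"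
proof -
  have space: "space M = UNIV" using sets_eq_imp_space_eq[OF sets] by simp
  have hm [measurable]: "h \<in> borel_measurable M" using h by (rule borel_measurable_integrable)
  have int: "integrable M (\<lambda>x. indicator F x *\<^sub>R h x)" if "F \<in> sets borel" for F
    using that h sets by (intro integrable_mult_indicator) auto
  have "(SUP F\<in>{F \<in> sets borel. F \<subseteq> E}. ennreal (\<mu> F)) = emeasure (density M (\<lambda>x. ennreal (h x))) E"
    if E: "E \<in> sets borel" for E
  proof (rule antisym)
    have EM: "E \<in> sets M" using E sets by simp
    have em: "emeasure (density M (\<lambda>x. ennreal (h x))) E = (\<integral>\<^sup>+x. ennreal (indicator E x * h x) \<partial>M)"
      using EM by (subst emeasure_density) (auto intro!: nn_integral_cong simp: indicator_def)
    show "(SUP F\<in>{F \<in> sets borel. F \<subseteq> E}. ennreal (\<mu> F)) \<le> emeasure (density M (\<lambda>x. ennreal (h x))) E"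
    proof (rule SUP_least, clarify)
      fix F assume F: "F \<in> sets borel" "F \<subseteq> E"
      have "\<mu> F = (\<integral>x. indicator F x *\<^sub>R h x \<partial>M)" using \<mu>[OF F(1)] by (simp add: set_lebesgue_integral_def)
      also have "\<dots> \<le> (\<integral>x. max 0 (indicator F x *\<^sub>R h x) \<partial>M)"
        using int[OF F(1)] by (intro integral_mono integrable_max) auto
      finally have "ennreal (\<mu> F) \<le> ennreal (\<integral>x. max 0 (indicator F x *\<^sub>R h x) \<partial>M)" by (rule ennreal_leI)
      also have "\<dots> = (\<integral>\<^sup>+x. ennreal (max 0 (indicator F x *\<^sub>R h x)) \<partial>M)"
        using int[OF F(1)] by (intro nn_integral_eq_integral[symmetric] integrable_max) auto
      also have "\<dots> \<le> (\<integral>\<^sup>+x. ennreal (indicator E x * h x) \<partial>M)"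
        using F(2) by (intro nn_integral_mono) (auto simp: indicator_def max_def ennreal_neg)
      finally show "ennreal (\<mu> F) \<le> emeasure (density M (\<lambda>x. ennreal (h x))) E" using em by simp
    qed
    define F where "F = E \<inter> {x. 0 \<le> h x}"
    have "{x \<in> space M. 0 \<le> h x} \<in> sets M" by measurable
    then have F: "F \<in> sets borel" unfolding F_def using E sets space by auto
    have "emeasure (density M (\<lambda>x. ennreal (h x))) E = (\<integral>\<^sup>+x. ennreal (indicator F x *\<^sub>R h x) \<partial>M)"
      unfolding em by (intro nn_integral_cong) (auto simp: F_def indicator_def ennreal_neg)
    also have "\<dots> = ennreal (\<integral>x. indicator F x *\<^sub>R h x \<partial>M)"
      using int[OF F] by (intro nn_integral_eq_integral) (auto simp: F_def indicator_def)
    also have "\<dots> = ennreal (\<mu> F)" using \<mu>[OF F] by (simp add: set_lebesgue_integral_def)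
    also have "\<dots> \<le> (SUP F\<in>{F \<in> sets borel. F \<subseteq> E}. ennreal (\<mu> F))"
      using F by (intro SUP_upper) (auto simp: F_def)
    finally show "emeasure (density M (\<lambda>x. ennreal (h x))) E \<le> (SUP F\<in>{F \<in> sets borel. F \<subseteq> E}. ennreal (\<mu> F))" .
  qed
  then have "positive_variation \<mu> = measure_of UNIV (sets borel) (emeasure (density M (\<lambda>x. ennreal (h x))))"
    unfolding positive_variation_def
    by (intro measure_of_eq) (auto simp: sets.sigma_sets_eq[of borel, simplified])
  also have "\<dots> = density M (\<lambda>x. ennreal (h x))"
    using measure_of_of_measure[of "density M (\<lambda>x. ennreal (h x))"] by (simp add: sets space)
  finally show ?thesis .
qed

lemma signed_integral_density:
  fixes M :: "'a::euclidean_space measure"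
  assumes sets: "sets M = sets borel" and h: "integrable M h"
    and \<mu>: "\<And>E. E \<in> sets borel \<Longrightarrow> \<mu> E = (\<integral>x\<in>E. h x \<partial>M)"
    and f: "f \<in> borel_measurable borel" "bounded (range f)"
  shows "signed_integral \<mu> f = (\<integral>x. h x * f x \<partial>M)"
proof -
  obtain B where B: "\<And>x. \<bar>f x\<bar> \<le> B" using f(2) by (auto simp: bounded_iff)
  have fm [measurable]: "f \<in> borel_measurable M" using f(1) sets by (simp cong: measurable_cong_sets)
  have pos: "integral\<^sup>L (positive_variation \<nu>) f = (\<integral>x. max 0 (g x) * f x \<partial>M) \<and> integrable M (\<lambda>x. max 0 (g x) * f x)"
    if g: "integrable M g" and \<nu>: "\<And>E. E \<in> sets borel \<Longrightarrow> \<nu> E = (\<integral>x\<in>E. g x \<partial>M)" for g \<nu>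
  proof
    have [measurable]: "g \<in> borel_measurable M" using g by (rule borel_measurable_integrable)
    have "positive_variation \<nu> = density M (\<lambda>x. ennreal (g x))"
      by (rule positive_variation_density[OF sets g \<nu>])
    also have "\<dots> = density M (\<lambda>x. ennreal (max 0 (g x)))"
      by (intro density_cong) (auto simp: max_def ennreal_neg)
    finally show "integral\<^sup>L (positive_variation \<nu>) f = (\<integral>x. max 0 (g x) * f x \<partial>M)"
      by (simp add: integral_density)
    show "integrable M (\<lambda>x. max 0 (g x) * f x)"
    proof (rule Bochner_Integration.integrable_bound)
      show "integrable M (\<lambda>x. B * g x)" using g by simp
      show "AE x in M. norm (max 0 (g x) * f x) \<le> norm (B * g x)"
      proof (rule AE_I2)
        fix x
        have "\<bar>max 0 (g x)\<bar> * \<bar>f x\<bar> \<le> \<bar>g x\<bar> * B" using B by (intro mult_mono) auto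
        moreover have "0 \<le> B" using B[of x] by linarith
        ultimately show "norm (max 0 (g x) * f x) \<le> norm (B * g x)" by (simp add: abs_mult mult.commute)
      qed
    qed measurable
  qed
  have neg: "- \<mu> E = (\<integral>x\<in>E. - h x \<partial>M)" if "E \<in> sets borel" for E
    using \<mu>[OF that] by (simp add: set_lebesgue_integral_def)
  have hn: "integrable M (\<lambda>x. - h x)" using h by simp
  have "signed_integral \<mu> f = (\<integral>x. max 0 (h x) * f x \<partial>M) - (\<integral>x. max 0 (- h x) * f x \<partial>M)"
    unfolding signed_integral_def using pos[OF h \<mu>] pos[OF hn neg] by simp
  also have "\<dots> = (\<integral>x. max 0 (h x) * f x - max 0 (- h x) * f x \<partial>M)"
    using pos[OF h \<mu>] pos[OF hn neg] by (intro Bochner_Integration.integral_diff[symmetric]) auto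
  also have "\<dots> = (\<integral>x. h x * f x \<partial>M)"
    by (intro Bochner_Integration.integral_cong) (auto simp: max_def)
  finally show ?thesis .
qed

text \<open>The densities of the \<open>N i\<close> with respect to \<open>M\<close> combine to a density of \<open>\<mu>\<close>.\<close>
lemma signed_integral_linear_combination:
  fixes M :: "'a::euclidean_space measure" and N :: "'i \<Rightarrow> 'a measure"
  assumes I: "finite I" and M: "finite_measure M" "sets M = sets borel"
    and N: "\<And>i. i \<in> I \<Longrightarrow> finite_measure (N i)" "\<And>i. i \<in> I \<Longrightarrow> sets (N i) = sets borel"
      "\<And>i. i \<in> I \<Longrightarrow> absolutely_continuous M (N i)"
    and \<mu>: "\<And>E. E \<in> sets borel \<Longrightarrow> \<mu> E = (\<Sum>i\<in>I. w i * measure (N i) E)"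
    and f: "f \<in> borel_measurable borel" "bounded (range f)"
  shows "signed_integral \<mu> f = (\<Sum>i\<in>I. w i * (\<integral>x. f x \<partial>N i))"
proof -
  interpret M: finite_measure M by fact
  have "\<exists>h. h \<in> borel_measurable M \<and> (\<forall>x. 0 \<le> h x) \<and> N i = density M (\<lambda>x. ennreal (h x))" if i: "i \<in> I" for i
  proof -
    have "sets (N i) = sets M" using N(2)[OF i] M(2) by simp
    from M.real_RN_deriv[OF N(1)[OF i] N(3)[OF i] this] obtain h where
      h: "h \<in> borel_measurable M" "AE x in M. RN_deriv M (N i) x = ennreal (h x)" "\<And>x. 0 \<le> h x" by metis
    have "N i = density M (RN_deriv M (N i))"
      using M.density_RN_deriv[OF N(3)[OF i]] N(2)[OF i] M(2) by simp
    also have "\<dots> = density M (\<lambda>x. ennreal (h x))"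
      using h by (intro density_cong) auto
    finally show ?thesis using h by blast
  qed
  then obtain h where hm: "\<And>i. i \<in> I \<Longrightarrow> h i \<in> borel_measurable M" and h0: "\<And>i x. i \<in> I \<Longrightarrow> 0 \<le> h i x"
    and hN: "\<And>i. i \<in> I \<Longrightarrow> N i = density M (\<lambda>x. ennreal (h i x))" by metis
  have fm: "f \<in> borel_measurable M" using f(1) M(2) by (simp cong: measurable_cong_sets)
  have int: "integrable (N i) g" if i: "i \<in> I" and g: "g \<in> borel_measurable borel" "bounded (range g)" for i and g :: "'a \<Rightarrow> real"
  proof -
    interpret finite_measure "N i" by (rule N(1)[OF i])
    obtain B where "\<And>x. \<bar>g x\<bar> \<le> B" using g(2) by (auto simp: bounded_iff)
    then show ?thesis
      using g(1) N(2)[OF i] by (intro integrable_const_bound[of _ B]) (auto cong: measurable_cong_sets)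
  qed
  have inth: "integrable M (\<lambda>x. h i x * g x)" "(\<integral>x. g x \<partial>N i) = (\<integral>x. h i x * g x \<partial>M)"
    if "i \<in> I" "g \<in> borel_measurable borel" "bounded (range g)" for i and g :: "'a \<Rightarrow> real"
  proof -
    have gm: "g \<in> borel_measurable M" using that(2) M(2) by (simp cong: measurable_cong_sets)
    show "integrable M (\<lambda>x. h i x * g x)"
      using int[OF that] unfolding hN[OF that(1)]
      by (subst (asm) integrable_density) (use gm hm h0 that(1) in auto)
    show "(\<integral>x. g x \<partial>N i) = (\<integral>x. h i x * g x \<partial>M)"
      unfolding hN[OF that(1)] by (subst integral_density) (use gm hm h0 that(1) in auto)
  qed
  define H where "H x = (\<Sum>i\<in>I. w i * h i x)" for x
  have H: "integrable M H"
    unfolding H_def using inth(1)[of _ "\<lambda>_. 1"] by (intro Bochner_Integration.integrable_sum integrable_mult_right) auto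
  have \<mu>H: "\<mu> E = (\<integral>x\<in>E. H x \<partial>M)" if E: "E \<in> sets borel" for E
  proof -
    have ind: "indicator E \<in> borel_measurable (borel :: 'a measure)" "bounded (range (indicator E :: 'a \<Rightarrow> real))"
      using E by (auto simp: bounded_iff indicator_def intro!: exI[of _ 1])
    have "\<mu> E = (\<Sum>i\<in>I. w i * (\<integral>x. h i x * indicator E x \<partial>M))"
      unfolding \<mu>[OF E]
    proof (intro sum.cong refl arg_cong2[where f="(*)"])
      fix i assume i: "i \<in> I"
      interpret finite_measure "N i" by (rule N(1)[OF i])
      have "measure (N i) E = (\<integral>x. indicator E x \<partial>N i)"
        using E N(2)[OF i] by simp
      then show "measure (N i) E = (\<integral>x. h i x * indicator E x \<partial>M)"
        using inth(2)[OF i ind] by simp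
    qed
    also have "\<dots> = (\<integral>x. (\<Sum>i\<in>I. w i * (h i x * indicator E x)) \<partial>M)"
      using inth(1)[OF _ ind] by (subst Bochner_Integration.integral_sum) auto
    also have "\<dots> = (\<integral>x\<in>E. H x \<partial>M)"
      unfolding set_lebesgue_integral_def H_def
      by (intro Bochner_Integration.integral_cong) (auto simp: sum_distrib_left mult_ac)
    finally show ?thesis .
  qed
  have "signed_integral \<mu> f = (\<integral>x. H x * f x \<partial>M)"
    by (rule signed_integral_density[OF M(2) H \<mu>H f])
  also have "\<dots> = (\<integral>x. (\<Sum>i\<in>I. w i * (h i x * f x)) \<partial>M)"
    by (intro Bochner_Integration.integral_cong) (simp_all add: H_def sum_distrib_right mult.assoc)
  also have "\<dots> = (\<Sum>i\<in>I. w i * (\<integral>x. f x \<partial>N i))"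
    using inth[OF _ f] by (subst Bochner_Integration.integral_sum) auto
  finally show ?thesis .
qed

section \<open>Weak convergence of the curvature measures\<close>

text \<open>The shells increase with the radius, so the image measure belonging to the largest node \<open>\<tau>\<close> dominates
  all the others.\<close>
lemma signed_integral_parallel_curvature_measure:
  fixes A :: "'a::euclidean_space set"
  assumes A: "compact A" "A \<noteq> {}" and t: "0 < \<tau>" "\<tau> < R" and u: "unique_nearest_within (exterior A r) R"
    and i: "i < DIM('a)" and f: "continuous_on UNIV f" "bounded (range f)"
  shows "signed_integral (parallel_curvature_measure A r i) f = (\<Sum>a\<in>steiner_nodes DIM('a) \<tau>.
     (-1) ^ (DIM('a) - i - 1) * steiner_weight DIM('a) \<tau> i a *
       (\<integral>x\<in>shell (exterior A r) a UNIV. f (closest_point (exterior A r) x) \<partial>lborel))"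
    and "finite_signed_measure (parallel_curvature_measure A r i)"
proof -
  let ?D = "exterior A r"
  let ?d = "DIM('a)"
  note D = closed_exterior[of A r] exterior_nonempty[OF A, of r]
  note N = steiner_nodes[OF DIM_positive[where 'a='a] t(1)]
  have reach: "ereal \<tau> < reach ?D"
    using less_le_trans[OF _ unique_le_reach[OF u]] t by simp
  note eq = parallel_curvature_measure_eq[OF A t(1) reach _ i]
  have bsh: "bounded (shell ?D a F)" for a F
    by (rule bounded_subset[OF bounded_parallel_set[OF A] shell_exterior_subset])
  have aR: "a < R" if "a \<in> steiner_nodes ?d \<tau>" for a using that N(3) t by force
  have sh: "shell ?D a UNIV \<in> sets borel" if "a \<in> steiner_nodes ?d \<tau>" for a
    by (rule borel_shell[OF D u aR[OF that]]) simp
  define M where "M a = distr (restrict_space lborel (shell ?D a UNIV)) borel (closest_point ?D)" for a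
  have cp: "closest_point ?D \<in> restrict_space lborel (shell ?D a UNIV) \<rightarrow>\<^sub>M borel" if a: "a \<in> steiner_nodes ?d \<tau>" for a
  proof -
    have "continuous_on (shell ?D a UNIV) (closest_point ?D)"
      by (rule continuous_on_subset[OF continuous_on_closest_point_unique[OF D u]]) (use aR[OF a] in \<open>auto simp: shell_eq\<close>)
    from borel_measurable_continuous_on_restrict[OF this] show ?thesis
      by (simp add: measurable_def sets_restrict_space space_restrict_space)
  qed
  have emM: "emeasure (M a) F = emeasure lborel (shell ?D a F)" if a: "a \<in> steiner_nodes ?d \<tau>" and F: "F \<in> sets borel" for a F
  proof -
    have "emeasure (M a) F = emeasure (restrict_space lborel (shell ?D a UNIV)) (shell ?D a F)"
      unfolding M_def using F
      by (subst emeasure_distr[OF cp[OF a]])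
        (auto simp: space_restrict_space shell_def intro!: arg_cong2[of _ _ _ _ emeasure])
    also have "\<dots> = emeasure lborel (shell ?D a F)"
      using sh[OF a] by (subst emeasure_restrict_space) (auto simp: shell_def)
    finally show ?thesis .
  qed
  have finM: "finite_measure (M a)" if a: "a \<in> steiner_nodes ?d \<tau>" for a
    by (rule finite_measureI) (use emM[OF a, of UNIV] emeasure_bounded_finite[OF bsh, of a UNIV] in \<open>simp add: M_def less_top\<close>)
  have \<tau>N: "\<tau> \<in> steiner_nodes ?d \<tau>"
    unfolding steiner_nodes_def by (intro image_eqI[of _ _ ?d]) auto
  have ac: "absolutely_continuous (M \<tau>) (M a)" if a: "a \<in> steiner_nodes ?d \<tau>" for a
    unfolding absolutely_continuous_def
  proof
    fix E assume "E \<in> null_sets (M \<tau>)"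
    then have E: "E \<in> sets borel" "emeasure lborel (shell ?D \<tau> E) = 0"
      using emM[OF \<tau>N, of E] by (auto simp: null_sets_def M_def)
    have "shell ?D a E \<subseteq> shell ?D \<tau> E" using a N(3) by (auto simp: shell_eq)
    then have "emeasure lborel (shell ?D a E) \<le> emeasure lborel (shell ?D \<tau> E)"
      using borel_shell[OF D u t(2) E(1)] by (intro emeasure_mono) auto
    then show "E \<in> null_sets (M a)" using E emM[OF a E(1)] by (auto simp: null_sets_def M_def)
  qed
  have "signed_integral (parallel_curvature_measure A r i) f =
     (\<Sum>a\<in>steiner_nodes ?d \<tau>. ((-1) ^ (?d - i - 1) * steiner_weight ?d \<tau> i a) * (\<integral>x. f x \<partial>M a))"
  proof (rule signed_integral_linear_combination[OF N(1) finM[OF \<tau>N]])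
    show "parallel_curvature_measure A r i E =
        (\<Sum>a\<in>steiner_nodes ?d \<tau>. ((-1) ^ (?d - i - 1) * steiner_weight ?d \<tau> i a) * measure (M a) E)" if E: "E \<in> sets borel" for E
      unfolding eq[OF E] steiner_measure_def sum_distrib_left
      by (intro sum.cong) (auto simp: measure_def emM E)
    show "f \<in> borel_measurable borel" by (rule borel_measurable_continuous_onI[OF f(1)])
  qed (use finM ac f(2) in \<open>auto simp: M_def\<close>)
  also have "\<dots> = (\<Sum>a\<in>steiner_nodes ?d \<tau>. ((-1) ^ (?d - i - 1) * steiner_weight ?d \<tau> i a) *
       (\<integral>x\<in>shell ?D a UNIV. f (closest_point ?D x) \<partial>lborel))"
  proof (intro sum.cong refl arg_cong2[where f="(*)"])
    fix a assume a: "a \<in> steiner_nodes ?d \<tau>"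
    have "(\<integral>x. f x \<partial>M a) = (\<integral>x. f (closest_point ?D x) \<partial>restrict_space lborel (shell ?D a UNIV))"
      unfolding M_def by (intro integral_distr cp[OF a] borel_measurable_continuous_onI f)
    also have "\<dots> = (\<integral>x\<in>shell ?D a UNIV. f (closest_point ?D x) \<partial>lborel)"
      unfolding set_lebesgue_integral_def using sh[OF a] by (intro integral_restrict_space) auto
    finally show "(\<integral>x. f x \<partial>M a) = (\<integral>x\<in>shell ?D a UNIV. f (closest_point ?D x) \<partial>lborel)" .
  qed
  finally show "signed_integral (parallel_curvature_measure A r i) f = (\<Sum>a\<in>steiner_nodes ?d \<tau>.
     (-1) ^ (?d - i - 1) * steiner_weight ?d \<tau> i a * (\<integral>x\<in>shell ?D a UNIV. f (closest_point ?D x) \<partial>lborel))" .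
  show "finite_signed_measure (parallel_curvature_measure A r i)"
    unfolding finite_signed_measure_def
  proof (intro allI impI)
    fix F :: "nat \<Rightarrow> 'a set" assume F: "range F \<subseteq> sets borel" "disjoint_family F"
    have "(\<lambda>n. (-1) ^ (?d - i - 1) * steiner_measure ?D \<tau> i (F n)) sums ((-1) ^ (?d - i - 1) * steiner_measure ?D \<tau> i (\<Union>n. F n))"
      by (intro sums_mult steiner_measure_sums[OF D u t F bsh])
    moreover have "F n \<in> sets borel" "(\<Union>n. F n) \<in> sets borel" for n using F(1) by auto
    ultimately show "(\<lambda>n. parallel_curvature_measure A r i (F n)) sums parallel_curvature_measure A r i (\<Union>n. F n)"
      using eq by simp
  qed
qed

theorem theorem5p2:
  fixes A :: "nat \<Rightarrow> 'a::euclidean_space set" and A\<^sub>0 :: "'a set" and r :: real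
  assumes "\<And>n. compact (A n)" and "\<And>n. A n \<noteq> {}"
    and "compact A\<^sub>0" and "A\<^sub>0 \<noteq> {}"
    and "(\<lambda>n. hausdorff_dist (A n) A\<^sub>0) \<longlonglongrightarrow> 0"
    and "0 < r" and "r \<notin> critical_values A\<^sub>0"
  shows "(\<forall>\<^sub>F n in sequentially. r \<notin> critical_values (A n)) \<and>
    (\<forall>i<DIM('a). weakly_converges
       (\<lambda>n. parallel_curvature_measure (A n) r i) (parallel_curvature_measure A\<^sub>0 r i))"
proof -
  note A = assms(1,2) and A0 = assms(3,4) and conv = assms(5) and r = assms(6,7)
  obtain c where c: "0 < c" and dir: "\<And>y. \<bar>infdist y A\<^sub>0 - r\<bar> \<le> c \<Longrightarrow>
     \<exists>v. norm v = 1 \<and> (\<forall>a. infdist a A\<^sub>0 \<le> c \<longrightarrow> dist y a \<le> r + c \<longrightarrow> c \<le> v \<bullet> (y - a))"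
    using noncritical_uniform_direction[OF A0 r] by metis
  have tr: "transversal B r c" if "compact B" "B \<noteq> {}" "hausdorff_dist B A\<^sub>0 \<le> c" for B
    by (rule transversal_hausdorff[OF A0 that(1,2) dir that(3)])
  have "hausdorff_dist A\<^sub>0 A\<^sub>0 = 0"
    using A0 by (simp add: hausdorff_dist_def)
  then have tr0: "transversal A\<^sub>0 r c" using c by (intro tr A0) simp
  have "\<forall>\<^sub>F n in sequentially. hausdorff_dist (A n) A\<^sub>0 < c"
    by (rule order_tendstoD(2)[OF conv c])
  then have trn: "\<forall>\<^sub>F n in sequentially. transversal (A n) r c"
    by eventually_elim (intro tr A less_imp_le)
  interpret hausdorff_convergent A A\<^sub>0 r
    by unfold_locales (use A A0 conv r exterior_eq[OF A0 r(1) tr0 c] in auto)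
  have u0: "unique_nearest_within (exterior A\<^sub>0 r) c"
    by (rule exterior_unique_nearest[OF A0 r(1) tr0 c])
  have un: "\<forall>\<^sub>F n in sequentially. unique_nearest_within (exterior (A n) r) c"
    using trn by eventually_elim (rule exterior_unique_nearest[OF A r(1) _ c])
  define \<tau> where "\<tau> = c / 2"
  have \<tau>: "0 < \<tau>" "\<tau> < c" using c by (auto simp: \<tau>_def)
  note N = steiner_nodes[OF DIM_positive[where 'a='a] \<tau>(1)]
  have "\<forall>\<^sub>F n in sequentially. r \<notin> critical_values (A n)"
    using trn by eventually_elim (rule transversal_not_critical[OF _ c])
  moreover have "weakly_converges (\<lambda>n. parallel_curvature_measure (A n) r i) (parallel_curvature_measure A\<^sub>0 r i)"
    if i: "i < DIM('a)" for i
    unfolding weakly_converges_def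
  proof (intro conjI allI impI)
    show "finite_signed_measure (parallel_curvature_measure A\<^sub>0 r i)"
      by (rule signed_integral_parallel_curvature_measure(2)[OF A0 \<tau> u0 i continuous_on_const[of UNIV 0]]) simp
    show "\<forall>\<^sub>F n in sequentially. finite_signed_measure (parallel_curvature_measure (A n) r i)"
      using un
      by eventually_elim
        (rule signed_integral_parallel_curvature_measure(2)[OF A \<tau> _ i continuous_on_const[of UNIV 0]], auto)
    fix f :: "'a \<Rightarrow> real" assume f: "continuous_on UNIV f" "bounded (range f)"
    define I where "I E = (\<Sum>a\<in>steiner_nodes DIM('a) \<tau>.
       (-1) ^ (DIM('a) - i - 1) * steiner_weight DIM('a) \<tau> i a *
         (\<integral>x\<in>shell (exterior E r) a UNIV. f (closest_point (exterior E r) x) \<partial>lborel))" for E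
    have "(\<lambda>n. I (A n)) \<longlonglongrightarrow> I A\<^sub>0"
      unfolding I_def
    proof (intro tendsto_sum tendsto_mult tendsto_const integral_shell_tendsto[OF u0 un _ _ f])
      fix a assume "a \<in> steiner_nodes DIM('a) \<tau>"
      then show "0 \<le> a" "a < c" using N(3) \<tau> by force+
    qed
    moreover have "\<forall>\<^sub>F n in sequentially. I (A n) = signed_integral (parallel_curvature_measure (A n) r i) f"
      using un unfolding I_def
      by eventually_elim (rule signed_integral_parallel_curvature_measure(1)[OF A \<tau> _ i f, symmetric])
    moreover have "I A\<^sub>0 = signed_integral (parallel_curvature_measure A\<^sub>0 r i) f"
      unfolding I_def by (rule signed_integral_parallel_curvature_measure(1)[OF A0 \<tau> u0 i f, symmetric])
    ultimately show "(\<lambda>n. signed_integral (parallel_curvature_measure (A n) r i) f)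
        \<longlonglongrightarrow> signed_integral (parallel_curvature_measure A\<^sub>0 r i) f"
      using Lim_transform_eventually by metis
  qed
  ultimately show ?thesis by blast
qed

end
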